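(* Let $n\ge 3$ and $1<p<\frac{n+2}{n-2}$. Let $\psi\in C^2([0,+\infty))$ be positive on $(0,+\infty)$ with $\psi(0)=\psi''(0)=0$, $\psi'(0)=1$ and $\psi'(r)\ge 0$ for every $r>0$, and assume that the following limits exist and satisfy $$\lim_{r\to+\infty}\frac{\psi'(r)}{\psi(r)}=\lim_{r\to+\infty}\frac{\psi''(r)}{\psi'(r)}=l\in(0,+\infty].$$ Set $\delta:=\frac{2(n-1)}{p+3}$ and let the function $$G(r):=\delta\,\psi^{\delta(p-1)-2}(r)\left[(\delta+2-n)(\psi'(r))^2-\psi''(r)\psi(r)\right]\qquad(r>0)$$ satisfy the $\Lambda$-property. If $l=+\infty$, assume in addition that $$\frac{\psi'(r)}{\psi(r)}=o(\psi^{\delta}(r)),\qquad \frac{\psi''(r)}{\psi'(r)}=o(\psi^{\delta}(r))\qquad\text{as } r\to+\infty.$$ Then the Cauchy problem $$-\frac{1}{\psi(r)^{n-1}}\left[\psi(r)^{n-1}u'(r)\right]'=|u(r)|^{p-1}u(r)\quad(r>0),\qquad u(0)=\alpha,\quad u'(0)=0,$$ (with $\alpha$ ranging over the nonzero reals) admits a unique positive solution $U$ belonging to $H^1(M)$. Moreover, every solution of this Cauchy problem with $0<\alpha<U(0)$ is of one sign, while any solution with $\alpha>U(0)$ is sign-changing.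
   Context: $(M,g)$ is the $n$-dimensional Riemannian model with pole $o$ and metric $ds^2=dr^2+\psi(r)^2d\Theta^2$ in polar coordinates $(r,\Theta)\in(0,\infty)\times\mathbb{S}^{n-1}$ around $o$ ($M$ is diffeomorphic to $\mathbb{R}^n$); a function $u(r)$ is regarded as a radial function on $M$ ($r$ being the distance from $o$). The Cauchy problem is the radial form of $-\Delta_g u=|u|^{p-1}u$ on $M$; its solution is unique for each $\alpha$. $H^1(M)=\{u\in L^2(V_g):\nabla_g u\in L^2(V_g)\}$, where $V_g$ is the Riemannian measure and $\nabla_g$ the Riemannian gradient. $\Lambda$-property: a differentiable function $G:(0,+\infty)\to\mathbb{R}$ satisfies the $\Lambda$-property if there exists $0\le r_1\le+\infty$ such that $G'\ge 0$ in $(0,r_1)$ and $G'\le 0$ in $(r_1,+\infty)$, with $G'\not\equiv 0$. *)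

theory Defs
  imports "HOL-Analysis.Analysis" "HOL-Library.Landau_Symbols"
begin

subsection \<open>The Riemannian model and its Sobolev space\<close>

text \<open>
  A metric tensor on real^'n is given as a family of bilinear forms g x v w (base point x).
  In the global chart x = r * Theta the tangent vector v has dr(v) = v \<bullet> Theta, and the
  component of v orthogonal to Theta is r * dTheta(v), so that dr^2 + psi(r)^2 dTheta^2 takes the
  form below. At the pole this extends by the Euclidean inner product, because psi'(0) = 1.
\<close>

definition model_metric :: "(real \<Rightarrow> real) \<Rightarrow> real^'n \<Rightarrow> real^'n \<Rightarrow> real^'n \<Rightarrow> real" where
  "model_metric \<psi> x v w =
     (if x = 0 then v \<bullet> w
      else (let r = norm x; \<theta> = x /\<^sub>R r in
        (v \<bullet> \<theta>) * (w \<bullet> \<theta>)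
        + (\<psi> r / r)\<^sup>2 * ((v - (v \<bullet> \<theta>) *\<^sub>R \<theta>) \<bullet> (w - (w \<bullet> \<theta>) *\<^sub>R \<theta>))))"

definition riemannian_volume :: "(real^'n \<Rightarrow> real^'n \<Rightarrow> real^'n \<Rightarrow> real) \<Rightarrow> (real^'n) measure" where
  "riemannian_volume g =
     density lborel (\<lambda>x. ennreal (sqrt (det (\<chi> i j. g x (axis i 1) (axis j 1)))))"

definition C1_test_function :: "(real^'n \<Rightarrow> real) \<Rightarrow> bool" where
  "C1_test_function \<phi> \<longleftrightarrow>
     (\<forall>x. \<phi> differentiable (at x)) \<and>
     (\<forall>v. continuous_on UNIV (\<lambda>x. frechet_derivative \<phi> (at x) v)) \<and>
     bounded {x. \<phi> x \<noteq> 0}"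

text \<open>
  X is the Riemannian gradient of u in the weak sense: the covector field g(X, _) is the
  distributional differential of u. The differential does not depend on the coordinates, so it can
  be tested in the global chart against Lebesgue measure.
\<close>

definition weak_riemannian_gradient ::
  "(real^'n \<Rightarrow> real^'n \<Rightarrow> real^'n \<Rightarrow> real) \<Rightarrow> (real^'n \<Rightarrow> real) \<Rightarrow> (real^'n \<Rightarrow> real^'n) \<Rightarrow> bool" where
  "weak_riemannian_gradient g u X \<longleftrightarrow>
     (\<forall>K. compact K \<longrightarrow> set_integrable lborel K u) \<and>
     (\<forall>K i. compact K \<longrightarrow> set_integrable lborel K (\<lambda>x. g x (X x) (axis i 1))) \<and>
     (\<forall>\<phi> i. C1_test_function \<phi> \<longrightarrow>
        (\<integral>x. u x * frechet_derivative \<phi> (at x) (axis i 1) \<partial>lborel)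
        = - (\<integral>x. g x (X x) (axis i 1) * \<phi> x \<partial>lborel))"

definition H1 :: "(real^'n \<Rightarrow> real^'n \<Rightarrow> real^'n \<Rightarrow> real) \<Rightarrow> (real^'n \<Rightarrow> real) set" where
  "H1 g = {u. u \<in> borel_measurable borel \<and>
              integrable (riemannian_volume g) (\<lambda>x. (u x)\<^sup>2) \<and>
              (\<exists>X. X \<in> borel_measurable borel \<and>
                   weak_riemannian_gradient g u X \<and>
                   integrable (riemannian_volume g) (\<lambda>x. g x (X x) (X x)))}"

subsection \<open>The Lambda-property and the Cauchy problem\<close>

definition Lambda_property :: "(real \<Rightarrow> real) \<Rightarrow> bool" where
  "Lambda_property G \<longleftrightarrow>
     (\<forall>r>0. G differentiable (at r)) \<and>
     (\<exists>r\<^sub>1::ereal. 0 \<le> r\<^sub>1 \<and>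
        (\<forall>r>0. ereal r < r\<^sub>1 \<longrightarrow> deriv G r \<ge> 0) \<and>
        (\<forall>r>0. r\<^sub>1 < ereal r \<longrightarrow> deriv G r \<le> 0)) \<and>
     (\<exists>r>0. deriv G r \<noteq> 0)"

text \<open>
  Only the values of u on [0, \<infinity>) matter; derivatives are one-sided at 0.
\<close>

definition cauchy_solution ::
  "(real \<Rightarrow> real) \<Rightarrow> nat \<Rightarrow> real \<Rightarrow> real \<Rightarrow> (real \<Rightarrow> real) \<Rightarrow> bool" where
  "cauchy_solution \<psi> n p \<alpha> u \<longleftrightarrow>
     (\<exists>u'. (\<forall>r\<ge>0. (u has_real_derivative u' r) (at r within {0..})) \<and>
           continuous_on {0..} u' \<and>
           u 0 = \<alpha> \<and> u' 0 = 0 \<and>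
           (\<forall>r>0. (\<lambda>s. \<psi> s ^ (n - 1) * u' s) differentiable (at r) \<and>
                  - (1 / \<psi> r ^ (n - 1)) * deriv (\<lambda>s. \<psi> s ^ (n - 1) * u' s) r
                  = \<bar>u r\<bar> powr (p - 1) * u r))"

definition positive_sol :: "(real \<Rightarrow> real) \<Rightarrow> bool" where
  "positive_sol u \<longleftrightarrow> (\<forall>r\<ge>0. u r > 0)"

definition one_sign :: "(real \<Rightarrow> real) \<Rightarrow> bool" where
  "one_sign u \<longleftrightarrow> (\<forall>r\<ge>0. u r > 0) \<or> (\<forall>r\<ge>0. u r < 0)"

definition sign_changing :: "(real \<Rightarrow> real) \<Rightarrow> bool" where
  "sign_changing u \<longleftrightarrow> (\<exists>r\<ge>0. u r > 0) \<and> (\<exists>r\<ge>0. u r < 0)"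

end

theory Submission
  imports Defs
begin

text \<open>
  Write \<open>N = n - 1\<close> and let \<open>u\<^sub>\<alpha>\<close> be the solution with \<open>u(0) = \<alpha> > 0\<close>. As long as it is
  positive it decreases, since its flux \<open>z = - \<psi>\<^sup>N u'\<close> increases from 0. The proof is by shooting in
  \<open>\<alpha>\<close>, and three facts carry it.

  The energy. The functions \<open>v = \<psi>\<^sup>\<delta> u\<close> and \<open>y = \<psi>\<^sup>N\<^sup>-\<^sup>2\<^sup>\<delta> v'\<close> satisfy a Hamiltonian system
  with energy \<open>E = y\<^sup>2 / 2 + v\<^sup>p\<^sup>+\<^sup>1 / (p + 1) + G v\<^sup>2 / 2\<close>, so that \<open>E' = G' v\<^sup>2 / 2\<close>. By the
  \<open>\<Lambda>\<close>-property \<open>E\<close> first increases from 0 and then decreases. So \<open>E \<ge> 0\<close> up to the first zero of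
  \<open>u\<close>, if there is one (\<open>energy_nonneg_before_zero\<close>), and \<open>E \<ge> 0\<close> on the half-line if \<open>E\<close>
  vanishes at infinity (\<open>energy_nonneg_of_vanishing\<close>).

  The comparison. If \<open>\<alpha> < \<beta>\<close>, both solutions are positive and \<open>E\<^sub>\<alpha> \<ge> 0\<close>, then
  \<open>q = u\<^sub>\<beta> / u\<^sub>\<alpha>\<close> is decreasing (\<open>wronskian_neg\<close>). The argument uses \<open>X = E\<^sub>\<beta> - q\<^sup>2 E\<^sub>\<alpha>\<close>, whose
  derivative \<open>- 2 q q' E\<^sub>\<alpha>\<close> contains no \<open>G'\<close>. It follows that \<open>u\<^sub>\<beta>\<close> vanishes whenever
  \<open>u\<^sub>\<alpha>\<close> does (\<open>zero_propagates\<close>), so the initial values of positive solutions form an interval. It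
  also follows that at most one positive solution has an energy that vanishes at infinity
  (\<open>vanishing_energy_unique\<close>): for two of them the monotone function \<open>X\<close> would vanish at both ends.

  The dichotomy at infinity. A positive solution either decays fast, \<open>u = O(\<psi>\<^sup>-\<^sup>N)\<close> with bounded
  flux, or is not \<open>O(\<psi>\<^sup>-\<^sup>\<beta>)\<close> for any \<open>\<beta> > 0\<close> (\<open>decay_imp_fast\<close>). Square integrability
  against \<open>\<psi>\<^sup>N\<close> forces fast decay (\<open>square_integrable_imp_fast\<close>), fast decay gives membership in
  \<open>H\<^sup>1\<close> (\<open>fast_imp_H1\<close>) and an energy that vanishes at infinity
  (\<open>fast_imp_energy_vanishes\<close>), and a positive solution with \<open>E \<ge> 0\<close> everywhere decays fast
  (\<open>energy_nonneg_imp_fast\<close>).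

  Small initial values give positive solutions, because otherwise \<open>E \<ge> 0\<close>, while nearly constant
  solutions have negative energy at a suitable radius (\<open>small_data_positive\<close>). Large initial values
  give solutions with a zero: subcriticality makes the energy near the pole tend to infinity with
  \<open>\<alpha>\<close>, while positive solutions are bounded at a fixed radius uniformly in \<open>\<alpha>\<close>
  (\<open>large_data_vanish\<close>). At the threshold \<open>\<alpha>\<^sub>0\<close> between the two kinds the solution is positive
  and its energy is a limit of nonnegative energies, so it decays fast; it is the solution \<open>U\<close>. Any
  positive solution in \<open>H\<^sup>1\<close> decays fast and therefore coincides with it.
\<close>

section \<open>Radial solutions as a first-order system\<close>

locale radial_model =
  fixes N :: nat and p :: real and \<psi> \<psi>' \<psi>'' :: "real \<Rightarrow> real"
  assumes N2: "2 \<le> N" and p1: "1 < p"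
    and psi_deriv: "\<And>r. r \<ge> 0 \<Longrightarrow> (\<psi> has_real_derivative \<psi>' r) (at r within {0..})"
    and psi'_deriv: "\<And>r. r \<ge> 0 \<Longrightarrow> (\<psi>' has_real_derivative \<psi>'' r) (at r within {0..})"
    and psi''_cont: "continuous_on {0..} \<psi>''"
    and psi_pos: "\<And>r. r > 0 \<Longrightarrow> \<psi> r > 0"
    and psi_0: "\<psi> 0 = 0" "\<psi>'' 0 = 0" "\<psi>' 0 = 1"
    and psi'_nonneg: "\<And>r. r > 0 \<Longrightarrow> \<psi>' r \<ge> 0"
begin

lemma psi_has_derivative [derivative_intros]:
  assumes "r > 0"
  shows "(\<psi> has_real_derivative \<psi>' r) (at r)" "(\<psi>' has_real_derivative \<psi>'' r) (at r)"
proof -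
  have "at r within {0..} = at r"
    using assms by (intro at_within_interior) auto
  then show "(\<psi> has_real_derivative \<psi>' r) (at r)" "(\<psi>' has_real_derivative \<psi>'' r) (at r)"
    using psi_deriv[of r] psi'_deriv[of r] assms by auto
qed

lemma psi_cont: "continuous_on {0..} \<psi>" "continuous_on {0..} \<psi>'"
  using psi_deriv psi'_deriv by (auto intro!: DERIV_continuous_on)

lemma psi_nonneg: "r \<ge> 0 \<Longrightarrow> \<psi> r \<ge> 0"
  using psi_pos[of r] psi_0 by (cases "r = 0") auto

lemma psi_mono:
  assumes "0 \<le> s" "s \<le> r"
  shows "\<psi> s \<le> \<psi> r"
proof (rule DERIV_nonneg_imp_increasing_open[OF assms(2)])
  show "\<exists>y. (\<psi> has_real_derivative y) (at x) \<and> 0 \<le> y" if "s < x" "x < r" for x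
    using psi_has_derivative[of x] psi'_nonneg[of x] that assms by force
  show "continuous_on {s..r} \<psi>"
    by (rule continuous_on_subset[OF psi_cont(1)]) (use assms in auto)
qed

lemma psi_power_mono:
  assumes "0 \<le> s" "s \<le> r"
  shows "\<psi> s ^ N \<le> \<psi> r ^ N"
  by (rule power_mono[OF psi_mono[OF assms] psi_nonneg[OF assms(1)]])

text \<open>
  The truncation of the nonlinearity by zero on the negative axis does not change solutions as long
  as they are nonnegative. It makes every solution decreasing on its whole life, hence bounded
  above by its initial value, and this is what makes the nonlinearity effectively Lipschitz.
\<close>
definition nonlin :: "real \<Rightarrow> real" where
  "nonlin x = (max 0 x) powr p"

text \<open>
  The flux \<open>z = - \<psi>\<^sup>N u'\<close>, with \<open>N = n - 1\<close>, replaces the derivative: it vanishes at the pole and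
  is continuous there, whereas the equation for \<open>u\<close> itself is singular. At the pole the quotient
  \<open>z 0 / \<psi> 0 ^ N\<close> is \<open>0 / 0 = 0\<close>, which is the right value of \<open>- u'\<close>. The source \<open>A\<close> is kept
  general so that one estimate serves both the iteration and the comparison of solutions.
\<close>
definition radial_system ::
  "real \<Rightarrow> (real \<Rightarrow> real) \<Rightarrow> (real \<Rightarrow> real) \<Rightarrow> (real \<Rightarrow> real) \<Rightarrow> bool" where
  "radial_system R A u z \<longleftrightarrow> z 0 = 0 \<and> continuous_on {0..R} u \<and> continuous_on {0..R} z \<and>
     (\<forall>r\<in>{0<..<R}. (u has_real_derivative - (z r / \<psi> r ^ N)) (at r) \<and>
                     (z has_real_derivative \<psi> r ^ N * A r) (at r))"

definition sol :: "real \<Rightarrow> real \<Rightarrow> (real \<Rightarrow> real) \<Rightarrow> (real \<Rightarrow> real) \<Rightarrow> bool" where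
  "sol R \<alpha> u z \<longleftrightarrow> u 0 = \<alpha> \<and> radial_system R (\<lambda>r. nonlin (u r)) u z"

lemma solD:
  assumes "sol R \<alpha> u z"
  shows "u 0 = \<alpha>" "z 0 = 0" "continuous_on {0..R} u" "continuous_on {0..R} z"
    "\<And>r. 0 < r \<Longrightarrow> r < R \<Longrightarrow> (u has_real_derivative - (z r / \<psi> r ^ N)) (at r)"
    "\<And>r. 0 < r \<Longrightarrow> r < R \<Longrightarrow> (z has_real_derivative \<psi> r ^ N * nonlin (u r)) (at r)"
  using assms by (auto simp: sol_def radial_system_def)

text \<open>
  Since \<open>\<psi>\<close> is nondecreasing, the weight \<open>\<psi>\<^sup>N\<close> under the inner integral is at most the one in
  front of it. The two integrations of the radial operator therefore gain a factor
  \<open>1 / \<mu>\<^sup>2\<close> on functions bounded by \<open>exp (\<mu> r)\<close>, which drives both existence and continuous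
  dependence, in spite of the singularity at the pole.
\<close>
lemma radial_system_estimate:
  assumes u: "radial_system R A u z" and v: "radial_system R B v y"
    and r: "0 \<le> r" "r \<le> R" and l: "0 < \<mu>" and K: "0 \<le> K"
    and bound: "\<And>t. 0 < t \<Longrightarrow> t < r \<Longrightarrow> \<bar>A t - B t\<bar> \<le> K * exp (\<mu> * t)"
  shows "\<bar>z r - y r\<bar> \<le> \<psi> r ^ N * (K * exp (\<mu> * r) / \<mu>)"
    and "\<bar>(u r - v r) - (u 0 - v 0)\<bar> \<le> K * exp (\<mu> * r) / \<mu>\<^sup>2"
proof -
  have zy: "\<bar>z s - y s\<bar> \<le> \<psi> s ^ N * (K * exp (\<mu> * s) / \<mu>)" if s: "0 \<le> s" "s \<le> r" for s
  proof (cases "s = 0")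
    case True
    then show ?thesis using u v l K psi_0 N2 by (auto simp: radial_system_def)
  next
    case False
    then have s0: "0 < s" using s by simp
    have "norm ((z s - y s) - (z 0 - y 0)) \<le> \<psi> s ^ N * (K * exp (\<mu> * s) / \<mu>) - \<psi> s ^ N * (K * exp (\<mu> * 0) / \<mu>)"
    proof (rule differentiable_bound_general[OF s0, where f' = "\<lambda>t. \<psi> t ^ N * A t - \<psi> t ^ N * B t"
           and \<phi>' = "\<lambda>t. \<psi> s ^ N * (K * exp (\<mu> * t))"])
      show "continuous_on {0..s} (\<lambda>t. z t - y t)"
        using u v s r unfolding radial_system_def
        by (intro continuous_intros) (auto intro: continuous_on_subset)
      show "continuous_on {0..s} (\<lambda>t. \<psi> s ^ N * (K * exp (\<mu> * t) / \<mu>))"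
        using l by (intro continuous_intros) auto
    next
      fix t assume t: "0 < t" "t < s"
      show "((\<lambda>t. z t - y t) has_vector_derivative \<psi> t ^ N * A t - \<psi> t ^ N * B t) (at t)"
        using u v t s r unfolding radial_system_def has_real_derivative_iff_has_vector_derivative[symmetric]
        by (intro derivative_intros) auto
      show "((\<lambda>t. \<psi> s ^ N * (K * exp (\<mu> * t) / \<mu>)) has_vector_derivative \<psi> s ^ N * (K * exp (\<mu> * t))) (at t)"
        unfolding has_real_derivative_iff_has_vector_derivative[symmetric]
        using l by (auto intro!: derivative_eq_intros)
      have "norm (\<psi> t ^ N * A t - \<psi> t ^ N * B t) = \<psi> t ^ N * \<bar>A t - B t\<bar>"
        using psi_nonneg[of t] t by (simp add: right_diff_distrib[symmetric] abs_mult power_abs)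
      also have "\<dots> \<le> \<psi> s ^ N * (K * exp (\<mu> * t))"
        using psi_power_mono[of t s] bound[of t] t s psi_nonneg[of s] by (intro mult_mono) auto
      finally show "norm (\<psi> t ^ N * A t - \<psi> t ^ N * B t) \<le> \<psi> s ^ N * (K * exp (\<mu> * t))" .
    qed
    moreover have "z 0 = 0" "y 0 = 0" using u v by (auto simp: radial_system_def)
    moreover have "0 \<le> \<psi> s ^ N * (K * exp (\<mu> * 0) / \<mu>)"
      using K l psi_nonneg[of s] s by simp
    ultimately show ?thesis by simp
  qed
  then show "\<bar>z r - y r\<bar> \<le> \<psi> r ^ N * (K * exp (\<mu> * r) / \<mu>)" using r by simp
  show "\<bar>(u r - v r) - (u 0 - v 0)\<bar> \<le> K * exp (\<mu> * r) / \<mu>\<^sup>2"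
  proof (cases "r = 0")
    case True
    then show ?thesis using K by simp
  next
    case False
    then have r0: "0 < r" using r by simp
    have "norm ((u r - v r) - (u 0 - v 0)) \<le> K * exp (\<mu> * r) / \<mu>\<^sup>2 - K * exp (\<mu> * 0) / \<mu>\<^sup>2"
    proof (rule differentiable_bound_general[OF r0, where f' = "\<lambda>t. - (z t / \<psi> t ^ N) - - (y t / \<psi> t ^ N)"
           and \<phi>' = "\<lambda>t. K * exp (\<mu> * t) / \<mu>"])
      show "continuous_on {0..r} (\<lambda>t. u t - v t)"
        using u v r unfolding radial_system_def
        by (intro continuous_intros) (auto intro: continuous_on_subset)
      show "continuous_on {0..r} (\<lambda>t. K * exp (\<mu> * t) / \<mu>\<^sup>2)"
        using l by (intro continuous_intros) auto
    next
      fix t assume t: "0 < t" "t < r"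
      show "((\<lambda>t. u t - v t) has_vector_derivative - (z t / \<psi> t ^ N) - - (y t / \<psi> t ^ N)) (at t)"
        using u v t r unfolding radial_system_def has_real_derivative_iff_has_vector_derivative[symmetric]
        by (intro derivative_intros) auto
      show "((\<lambda>t. K * exp (\<mu> * t) / \<mu>\<^sup>2) has_vector_derivative K * exp (\<mu> * t) / \<mu>) (at t)"
        unfolding has_real_derivative_iff_has_vector_derivative[symmetric]
        using l by (auto intro!: derivative_eq_intros simp: power2_eq_square)
      have pos: "0 < \<psi> t ^ N" using psi_pos t by simp
      have "norm (- (z t / \<psi> t ^ N) - - (y t / \<psi> t ^ N)) = \<bar>z t - y t\<bar> / \<psi> t ^ N"
        using pos by (simp add: diff_divide_distrib[symmetric] abs_minus_commute)
      also have "\<dots> \<le> K * exp (\<mu> * t) / \<mu>"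
        using zy[of t] t pos by (simp add: pos_divide_le_eq mult.commute)
      finally show "norm (- (z t / \<psi> t ^ N) - - (y t / \<psi> t ^ N)) \<le> K * exp (\<mu> * t) / \<mu>" .
    qed
    moreover have "0 \<le> K * exp (\<mu> * 0) / \<mu>\<^sup>2" using K by simp
    ultimately show ?thesis by simp
  qed
qed

lemma powr_lipschitz:
  assumes "0 \<le> x" "0 \<le> y" "x \<le> M" "y \<le> M"
  shows "\<bar>x powr p - y powr p\<bar> \<le> p * M powr (p - 1) * \<bar>x - y\<bar>"
proof -
  have *: "\<bar>x powr p - y powr p\<bar> \<le> p * M powr (p - 1) * \<bar>x - y\<bar>"
    if xy: "0 \<le> x" "x < y" "y \<le> M" for x y
  proof -
    have "norm (y powr p - x powr p) \<le> p * M powr (p - 1) * y - p * M powr (p - 1) * x"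
    proof (rule differentiable_bound_general[OF xy(2), where f' = "\<lambda>t. p * t powr (p - 1)"
           and \<phi>' = "\<lambda>t. p * M powr (p - 1)"])
      show "continuous_on {x..y} (\<lambda>t. t powr p)"
        using xy p1 by (intro continuous_on_powr') (auto intro!: continuous_intros)
      show "continuous_on {x..y} (\<lambda>t. p * M powr (p - 1) * t)" by (intro continuous_intros)
    next
      fix t assume t: "x < t" "t < y"
      show "((\<lambda>t. t powr p) has_vector_derivative p * t powr (p - 1)) (at t)"
        unfolding has_real_derivative_iff_has_vector_derivative[symmetric]
        using t xy by (auto intro!: derivative_eq_intros)
      show "((\<lambda>t. p * M powr (p - 1) * t) has_vector_derivative p * M powr (p - 1)) (at t)"
        unfolding has_real_derivative_iff_has_vector_derivative[symmetric]
        by (auto intro!: derivative_eq_intros)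
      show "norm (p * t powr (p - 1)) \<le> p * M powr (p - 1)"
        using t xy p1 by (simp add: powr_mono2)
    qed
    then show ?thesis using xy by (simp add: abs_minus_commute algebra_simps)
  qed
  consider "x < y" | "y < x" | "x = y" by linarith
  then show ?thesis
    using *[of x y] *[of y x] assms by cases (auto simp: abs_minus_commute)
qed

lemma nonlin_lipschitz:
  assumes "x \<le> M" "y \<le> M" "0 \<le> M"
  shows "\<bar>nonlin x - nonlin y\<bar> \<le> p * M powr (p - 1) * \<bar>x - y\<bar>"
proof -
  have "\<bar>nonlin x - nonlin y\<bar> \<le> p * M powr (p - 1) * \<bar>max 0 x - max 0 y\<bar>"
    unfolding nonlin_def using assms by (intro powr_lipschitz) auto
  also have "\<dots> \<le> p * M powr (p - 1) * \<bar>x - y\<bar>"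
    using p1 by (intro mult_left_mono) auto
  finally show ?thesis .
qed

lemma nonlin_nonneg [simp]: "0 \<le> nonlin x"
  by (simp add: nonlin_def)

lemma nonlin_mono: "x \<le> y \<Longrightarrow> nonlin x \<le> nonlin y"
  unfolding nonlin_def using p1 by (intro powr_mono2) auto

lemma nonlin_pos: "0 < x \<Longrightarrow> nonlin x = x powr p"
  by (simp add: nonlin_def)

lemma nonlin_cont: "continuous_on S u \<Longrightarrow> continuous_on S (\<lambda>r. nonlin (u r))"
  unfolding nonlin_def using p1 by (intro continuous_on_powr') (auto intro!: continuous_intros)

lemma z_mono:
  assumes "radial_system R A u z" "\<And>r. A r \<ge> 0" "0 \<le> s" "s \<le> r" "r \<le> R"
  shows "z s \<le> z r"
proof (rule DERIV_nonneg_imp_increasing_open[OF assms(4)])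
  show "\<exists>y. (z has_real_derivative y) (at x) \<and> 0 \<le> y" if "s < x" "x < r" for x
    using assms psi_nonneg[of x] that unfolding radial_system_def
    by (intro exI[of _ "\<psi> x ^ N * A x"]) auto
  show "continuous_on {s..r} z"
    using assms unfolding radial_system_def by (auto intro: continuous_on_subset)
qed

lemma z_nonneg:
  assumes "radial_system R A u z" "\<And>r. A r \<ge> 0" "0 \<le> r" "r \<le> R"
  shows "0 \<le> z r"
  using z_mono[OF assms(1,2), of 0 r] assms by (auto simp: radial_system_def)

lemma u_antimono:
  assumes "radial_system R A u z" "\<And>r. A r \<ge> 0" "0 \<le> s" "s \<le> r" "r \<le> R"
  shows "u r \<le> u s"
proof (rule DERIV_nonpos_imp_decreasing_open[OF assms(4)])
  show "\<exists>y. (u has_real_derivative y) (at x) \<and> y \<le> 0" if "s < x" "x < r" for x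
    using assms psi_pos[of x] that z_nonneg[OF assms(1,2), of x] unfolding radial_system_def
    by (intro exI[of _ "- (z x / \<psi> x ^ N)"]) auto
  show "continuous_on {s..r} u"
    using assms unfolding radial_system_def by (auto intro: continuous_on_subset)
qed

lemma sol_monotone:
  assumes "sol R \<alpha> u z" "0 \<le> s" "s \<le> r" "r \<le> R"
  shows "u r \<le> u s" "z s \<le> z r" "0 \<le> z s" "u r \<le> \<alpha>"
  using assms u_antimono[of R "\<lambda>r. nonlin (u r)" u z s r] z_mono[of R "\<lambda>r. nonlin (u r)" u z s r]
    z_nonneg[of R "\<lambda>r. nonlin (u r)" u z s] u_antimono[of R "\<lambda>r. nonlin (u r)" u z 0 r]
  by (auto simp: sol_def)

text \<open>
  The factor 2 comes from absorbing half of the weighted maximum of the difference into itself,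
  which is possible because \<open>\<mu>\<^sup>2\<close> is twice the Lipschitz constant.
\<close>
lemma continuous_dependence:
  assumes u: "sol R \<alpha> u z" and v: "sol R \<beta> v y" and M: "\<alpha> \<le> M" "\<beta> \<le> M" "0 < M"
    and L: "L = p * M powr (p - 1)" and mu: "\<mu> = sqrt (2 * L)"
    and r: "0 \<le> r" "r \<le> R"
  shows "\<bar>u r - v r\<bar> \<le> 2 * \<bar>\<alpha> - \<beta>\<bar> * exp (\<mu> * r)"
    and "\<bar>z r - y r\<bar> \<le> \<psi> r ^ N * (\<mu> * \<bar>\<alpha> - \<beta>\<bar> * exp (\<mu> * r))"
proof -
  have L0: "L > 0" using M p1 L by simp
  then have mu0: "\<mu> > 0" and mu2: "\<mu>\<^sup>2 = 2 * L" using mu by auto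
  \<comment> \<open>the weighted difference, to be estimated at its maximum\<close>
  define d where "d t = \<bar>u t - v t\<bar> * exp (- \<mu> * t)" for t
  have "continuous_on {0..R} d"
    unfolding d_def using solD[OF u] solD[OF v] by (intro continuous_intros) auto
  then obtain t0 where t0: "t0 \<in> {0..R}" and max: "\<And>t. t \<in> {0..R} \<Longrightarrow> d t \<le> d t0"
    using continuous_attains_sup[of "{0..R}" d] r by auto
  define D where "D = d t0"
  have D0: "D \<ge> 0" by (simp add: D_def d_def)
  have uv: "\<bar>u t - v t\<bar> \<le> D * exp (\<mu> * t)" if "0 \<le> t" "t \<le> R" for t
    using max[of t] that unfolding D_def[symmetric] by (simp add: d_def exp_minus field_simps)
  have bound: "\<bar>nonlin (u t) - nonlin (v t)\<bar> \<le> (L * D) * exp (\<mu> * t)" if "0 < t" "t < R" for t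
  proof -
    have "\<bar>nonlin (u t) - nonlin (v t)\<bar> \<le> L * \<bar>u t - v t\<bar>"
      unfolding L using sol_monotone(4)[OF u, of t t] sol_monotone(4)[OF v, of t t] that M
      by (intro nonlin_lipschitz) auto
    also have "\<dots> \<le> L * (D * exp (\<mu> * t))"
      using uv[of t] that L0 by (intro mult_left_mono) auto
    finally show ?thesis by (simp add: mult.assoc)
  qed
  have sys: "radial_system R (\<lambda>r. nonlin (u r)) u z" "radial_system R (\<lambda>r. nonlin (v r)) v y"
    and init: "u 0 = \<alpha>" "v 0 = \<beta>"
    using u v by (auto simp: sol_def)
  note est = radial_system_estimate[OF sys, where \<mu> = \<mu> and K = "L * D"]
  have "\<bar>(u t0 - v t0) - (u 0 - v 0)\<bar> \<le> L * D * exp (\<mu> * t0) / \<mu>\<^sup>2"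
    by (rule est(2)) (use t0 mu0 L0 D0 bound in auto)
  also have "\<dots> = D * exp (\<mu> * t0) / 2"
    using L0 by (simp add: mu2)
  finally have "\<bar>u t0 - v t0\<bar> \<le> \<bar>\<alpha> - \<beta>\<bar> + D * exp (\<mu> * t0) / 2"
    unfolding init by linarith
  moreover have "\<bar>u t0 - v t0\<bar> = D * exp (\<mu> * t0)"
    by (simp add: D_def d_def exp_minus field_simps)
  ultimately have "D * exp (\<mu> * t0) \<le> 2 * \<bar>\<alpha> - \<beta>\<bar>" by (simp add: field_simps)
  moreover have "D * 1 \<le> D * exp (\<mu> * t0)"
    using D0 mu0 t0 by (intro mult_left_mono) auto
  ultimately have D: "D \<le> 2 * \<bar>\<alpha> - \<beta>\<bar>" by linarith
  show "\<bar>u r - v r\<bar> \<le> 2 * \<bar>\<alpha> - \<beta>\<bar> * exp (\<mu> * r)"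
    using order_trans[OF uv[OF r] mult_right_mono[OF D, of "exp (\<mu> * r)"]] by simp
  have "\<bar>z r - y r\<bar> \<le> \<psi> r ^ N * (L * D * exp (\<mu> * r) / \<mu>)"
    by (rule est(1)) (use r mu0 L0 D0 bound in auto)
  also have "L * D * exp (\<mu> * r) / \<mu> = \<mu> / 2 * D * exp (\<mu> * r)"
  proof -
    have "L = \<mu> * \<mu> / 2" using mu2 by (simp add: power2_eq_square)
    then have "L * D * exp (\<mu> * r) / \<mu> = (\<mu> * \<mu> / 2) * D * exp (\<mu> * r) / \<mu>" by (simp only:)
    then show ?thesis using mu0 by simp
  qed
  also have "\<psi> r ^ N * (\<mu> / 2 * D * exp (\<mu> * r)) \<le> \<psi> r ^ N * (\<mu> / 2 * (2 * \<bar>\<alpha> - \<beta>\<bar>) * exp (\<mu> * r))"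
    using psi_nonneg[OF r(1)] mu0 D by (intro mult_left_mono mult_right_mono) auto
  finally show "\<bar>z r - y r\<bar> \<le> \<psi> r ^ N * (\<mu> * \<bar>\<alpha> - \<beta>\<bar> * exp (\<mu> * r))" by simp
qed

corollary sol_unique:
  assumes "sol R \<alpha> u z" "sol R \<alpha> v y" "0 \<le> r" "r \<le> R"
  shows "u r = v r" "z r = y r"
  using continuous_dependence[OF assms(1,2), of "max 1 \<alpha>", OF _ _ _ refl refl assms(3,4)] by auto

end

section \<open>Global existence\<close>

context radial_model
begin

lemma integral_operator_system:
  assumes A: "continuous_on {0..} A" and B: "\<And>t. 0 \<le> t \<Longrightarrow> \<bar>A t\<bar> \<le> B"
    and Z: "Z = (\<lambda>r. integral {0..r} (\<lambda>t. \<psi> t ^ N * A t))"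
  shows "radial_system R A (\<lambda>r. \<alpha> - integral {0..r} (\<lambda>t. Z t / \<psi> t ^ N)) Z"
proof -
  have contA: "continuous_on {0..S} (\<lambda>t. \<psi> t ^ N * A t)" for S
    by (intro continuous_intros continuous_on_subset[OF A] continuous_on_subset[OF psi_cont(1)]) auto
  have derZ: "(Z has_real_derivative \<psi> t ^ N * A t) (at t within {0..S})" if "t \<in> {0..S}" for t S
    unfolding Z by (rule integral_has_real_derivative[OF contA that])
  have contZ: "continuous_on {0..S} Z" for S
    using derZ by (intro DERIV_continuous_on) auto
  have Zbound: "\<bar>Z t / \<psi> t ^ N\<bar> \<le> B * t" if t: "0 \<le> t" for t
  proof (cases "t = 0")
    case True
    then show ?thesis by (simp add: Z)
  next
    case False
    then have t0: "0 < t" and pos: "0 < \<psi> t ^ N" using t psi_pos by auto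
    have "norm (Z t) \<le> (\<psi> t ^ N * B) * (t - 0)"
      unfolding Z
    proof (rule integral_bound[OF t contA])
      fix s assume s: "s \<in> {0..t}"
      then show "norm (\<psi> s ^ N * A s) \<le> \<psi> t ^ N * B"
        using psi_power_mono[of s t] B[of s] psi_nonneg[of s] psi_nonneg[of t]
        by (simp add: abs_mult power_abs mult_mono)
    qed
    then show ?thesis using pos by (simp add: pos_divide_le_eq mult_ac)
  qed
  have contq: "continuous_on {0..S} (\<lambda>t. Z t / \<psi> t ^ N)" for S
    unfolding continuous_on_eq_continuous_within
  proof
    fix t assume t: "t \<in> {0..S}"
    show "continuous (at t within {0..S}) (\<lambda>t. Z t / \<psi> t ^ N)"
    proof (cases "t = 0")
      case True
      have "((\<lambda>t. Z t / \<psi> t ^ N) \<longlongrightarrow> 0) (at 0 within {0..S})"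
      proof (rule Lim_null_comparison)
        show "\<forall>\<^sub>F t in at 0 within {0..S}. norm (Z t / \<psi> t ^ N) \<le> B * t"
          using Zbound by (auto simp: eventually_at intro!: exI[of _ 1])
        show "((\<lambda>t. B * t) \<longlongrightarrow> 0) (at 0 within {0..S})"
          by (auto intro!: tendsto_eq_intros)
      qed
      moreover have "Z 0 = 0" by (simp add: Z)
      ultimately show ?thesis using True by (simp add: continuous_within)
    next
      case False
      have "continuous (at t within {0..S}) Z" "continuous (at t within {0..S}) \<psi>"
        using contZ[of S] continuous_on_subset[OF psi_cont(1), of "{0..S}"] t
        by (auto simp: continuous_on_eq_continuous_within)
      then show ?thesis
        using False t psi_pos[of t] by (intro continuous_intros) auto
    qed
  qed
  have derq: "((\<lambda>r. integral {0..r} (\<lambda>t. Z t / \<psi> t ^ N)) has_real_derivative Z t / \<psi> t ^ N) (at t within {0..S})"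
    if "t \<in> {0..S}" for t S
    by (rule integral_has_real_derivative[OF contq that])
  have conti: "continuous_on {0..S} (\<lambda>r. integral {0..r} (\<lambda>t. Z t / \<psi> t ^ N))" for S
    using derq by (intro DERIV_continuous_on) auto
  show ?thesis
    unfolding radial_system_def
  proof (intro conjI ballI)
    show "Z 0 = 0" by (simp add: Z)
    show "continuous_on {0..R} (\<lambda>r. \<alpha> - integral {0..r} (\<lambda>t. Z t / \<psi> t ^ N))"
      by (intro continuous_intros conti)
    show "continuous_on {0..R} Z" by (rule contZ)
    fix r assume r: "r \<in> {0<..<R}"
    show "(Z has_real_derivative \<psi> r ^ N * A r) (at r)"
      using derZ[of r R] r by (simp add: at_within_Icc_at)
    have "((\<lambda>r. integral {0..r} (\<lambda>t. Z t / \<psi> t ^ N)) has_real_derivative Z r / \<psi> r ^ N) (at r)"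
      using derq[of r R] r by (simp add: at_within_Icc_at)
    then show "((\<lambda>r. \<alpha> - integral {0..r} (\<lambda>t. Z t / \<psi> t ^ N)) has_real_derivative - (Z r / \<psi> r ^ N)) (at r)"
      by (auto intro!: derivative_eq_intros)
  qed
qed

text \<open>
  The nonlinearity is also cut off above the initial value, so that the integral operator is a
  contraction for the supremum norm with weight \<open>exp (- \<mu> r)\<close>. Its fixed point decreases, hence it
  never feels the upper cut-off.
\<close>
theorem global_solution_exists:
  assumes al: "0 < \<alpha>"
  shows "\<exists>u z. \<forall>R. sol R \<alpha> u z"
proof -
  define L where "L = p * \<alpha> powr (p - 1)"
  define \<mu> where "\<mu> = sqrt (2 * L)"
  have L0: "L > 0" using al p1 L_def by simp
  then have mu0: "\<mu> > 0" and mu2: "\<mu>\<^sup>2 = 2 * L" using \<mu>_def by auto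
  define F where "F x = nonlin (min \<alpha> x)" for x
  have F_lip: "\<bar>F x - F y\<bar> \<le> L * \<bar>x - y\<bar>" for x y
  proof -
    have "\<bar>F x - F y\<bar> \<le> L * \<bar>min \<alpha> x - min \<alpha> y\<bar>"
      unfolding F_def L_def using al by (intro nonlin_lipschitz) auto
    also have "\<dots> \<le> L * \<bar>x - y\<bar>" using L0 by (intro mult_left_mono) auto
    finally show ?thesis .
  qed
  have F_bound: "\<bar>F x\<bar> \<le> \<alpha> powr p" and F_nonneg: "0 \<le> F x" for x
  proof -
    show "0 \<le> F x" by (simp add: F_def)
    moreover have "F x \<le> nonlin \<alpha>" unfolding F_def by (intro nonlin_mono) auto
    ultimately show "\<bar>F x\<bar> \<le> \<alpha> powr p" using al by (simp add: nonlin_pos)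
  qed
  have F_cont: "continuous_on S (\<lambda>t. F (u t))" if "continuous_on S u" for S u
    unfolding F_def using that by (intro nonlin_cont continuous_intros) auto
  define Z where "Z u r = integral {0..r} (\<lambda>t. \<psi> t ^ N * F (u t))" for u :: "real \<Rightarrow> real" and r
  define T where "T u r = \<alpha> - integral {0..r} (\<lambda>t. Z u t / \<psi> t ^ N)" for u r
  have sys: "radial_system R (\<lambda>r. F (u r)) (T u) (Z u)" if "continuous_on {0..} u" for R u
    unfolding T_def[abs_def]
    by (rule integral_operator_system[where B = "\<alpha> powr p"])
       (use that F_bound F_cont in \<open>auto simp: Z_def\<close>)
  have T0: "T u 0 = \<alpha>" for u by (simp add: T_def)
  have T_est: "\<bar>T u r - T v r\<bar> \<le> K / 2 * exp (\<mu> * r)"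
    if "continuous_on {0..} u" "continuous_on {0..} v" "0 \<le> K" "0 \<le> r"
      "\<And>t. 0 \<le> t \<Longrightarrow> \<bar>u t - v t\<bar> \<le> K * exp (\<mu> * t)" for u v K r
  proof -
    have "\<bar>(T u r - T v r) - (T u 0 - T v 0)\<bar> \<le> L * K * exp (\<mu> * r) / \<mu>\<^sup>2"
    proof (rule radial_system_estimate(2)[OF sys[of u r] sys[of v r]])
      fix t assume "0 < t" "t < r"
      then have "\<bar>F (u t) - F (v t)\<bar> \<le> L * (K * exp (\<mu> * t))"
        using order_trans[OF F_lip[of "u t" "v t"] mult_left_mono[OF that(5)[of t], of L]] L0 by auto
      then show "\<bar>F (u t) - F (v t)\<bar> \<le> L * K * exp (\<mu> * t)" by (simp add: mult.assoc)
    qed (use that mu0 L0 in auto)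
    then show ?thesis using L0 by (simp add: T0 mu2)
  qed
  have contT: "continuous_on {0..} (T u)" if "continuous_on {0..} u" for u
    unfolding continuous_on_eq_continuous_within
  proof
    fix t :: real assume t: "t \<in> {0..}"
    have "continuous_on {0..t+1} (T u)" using sys[OF that, of "t+1"] by (auto simp: radial_system_def)
    then have "continuous (at t within {0..t+1}) (T u)"
      using t by (auto simp: continuous_on_eq_continuous_within)
    moreover have "at t within {0..t+1} = at t within {0..}"
      using t by (intro at_within_nhd[of t "{..<t+1}"]) auto
    ultimately show "continuous (at t within {0..}) (T u)" by simp
  qed
  define pull :: "(real \<Rightarrow>\<^sub>C real) \<Rightarrow> real \<Rightarrow> real" where
    "pull g = (\<lambda>t. exp (\<mu> * t) * apply_bcontfun g t)" for g
  define push where "push u = (\<lambda>r. exp (- \<mu> * max 0 r) * u (max 0 r))" for u :: "real \<Rightarrow> real"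
  have pull_cont: "continuous_on {0..} (pull g)" for g
    unfolding pull_def by (intro continuous_intros) auto
  have push_cont: "continuous_on UNIV (push u)" if "continuous_on {0..} u" for u
    unfolding push_def
    by (intro continuous_intros continuous_on_compose2[OF that]) auto
  have T_const: "T (\<lambda>_. 0) r = \<alpha>" for r
  proof -
    have "F 0 = 0" using al p1 by (simp add: F_def nonlin_def)
    then show ?thesis by (simp add: T_def Z_def)
  qed
  have in_bcont: "push (T (pull g)) \<in> bcontfun" for g
  proof (rule bcontfun_normI)
    show "continuous_on UNIV (push (T (pull g)))" by (intro push_cont contT pull_cont)
    fix r :: real
    define r' where "r' = max 0 r"
    have r': "0 \<le> r'" by (simp add: r'_def)
    have "\<bar>T (pull g) r' - T (\<lambda>_. 0) r'\<bar> \<le> norm g / 2 * exp (\<mu> * r')"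
      using norm_bounded[of g] by (intro T_est pull_cont r') (auto simp: pull_def abs_mult mult.commute)
    then have "\<bar>T (pull g) r'\<bar> \<le> \<alpha> + norm g / 2 * exp (\<mu> * r')"
      unfolding T_const using al by linarith
    also have "\<dots> \<le> \<alpha> * exp (\<mu> * r') + norm g / 2 * exp (\<mu> * r')"
      using al mu0 r' by simp
    also have "\<dots> = (\<alpha> + norm g / 2) * exp (\<mu> * r')" by (simp add: algebra_simps)
    finally show "norm (push (T (pull g)) r) \<le> \<alpha> + norm g / 2"
      by (simp add: push_def r'_def[symmetric] abs_mult exp_minus field_simps)
  qed
  define \<Phi> where "\<Phi> g = Bcontfun (push (T (pull g)))" for g
  have app: "apply_bcontfun (\<Phi> g) = push (T (pull g))" for g
    unfolding \<Phi>_def by (rule Bcontfun_inverse[OF in_bcont])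
  have "\<forall>g h. dist (\<Phi> g) (\<Phi> h) \<le> 1/2 * dist g h"
  proof (intro allI dist_bound)
    fix g h :: "real \<Rightarrow>\<^sub>C real" and r :: real
    define r' where "r' = max 0 r"
    have r': "0 \<le> r'" by (simp add: r'_def)
    have "\<bar>T (pull g) r' - T (pull h) r'\<bar> \<le> dist g h / 2 * exp (\<mu> * r')"
    proof (intro T_est pull_cont r')
      fix t :: real assume "0 \<le> t"
      have "\<bar>pull g t - pull h t\<bar> = exp (\<mu> * t) * dist (g t) (h t)"
        by (simp add: pull_def right_diff_distrib[symmetric] abs_mult dist_real_def)
      also have "\<dots> \<le> exp (\<mu> * t) * dist g h"
        by (intro mult_left_mono dist_bounded) auto
      finally show "\<bar>pull g t - pull h t\<bar> \<le> dist g h * exp (\<mu> * t)" by (simp add: mult.commute)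
    qed auto
    then show "dist (\<Phi> g r) (\<Phi> h r) \<le> 1/2 * dist g h"
      by (simp add: app push_def r'_def[symmetric] dist_real_def right_diff_distrib[symmetric]
          abs_mult exp_minus field_simps)
  qed
  then obtain g where g: "\<Phi> g = g"
    using banach_fix_type[of "1/2" \<Phi>] by auto
  define u where "u = pull g"
  have u_cont: "continuous_on {0..} u" unfolding u_def by (rule pull_cont)
  have fixed: "u r = T u r" if "0 \<le> r" for r
  proof -
    have "g r = push (T u) r" using app[of g] g by (simp add: u_def)
    then have "exp (\<mu> * r) * g r = T u r"
      using that by (simp add: push_def exp_minus)
    then show ?thesis by (simp add: u_def pull_def)
  qed
  have "sol R \<alpha> (T u) (Z u)" for R
  proof -
    have le: "T u r \<le> \<alpha>" if "0 \<le> r" for r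
      using u_antimono[OF sys[OF u_cont, of r], of 0 r] F_nonneg that by (simp add: T0)
    have "F (u r) = nonlin (T u r)" if "0 \<le> r" for r
      using le[OF that] fixed[OF that] by (simp add: F_def)
    then show ?thesis
      using sys[OF u_cont, of R] unfolding sol_def T0 radial_system_def by auto
  qed
  then show ?thesis by blast
qed

text \<open>
  From here on a solution with initial value \<open>\<alpha> > 0\<close> is always the global one of the truncated
  problem; it is the solution of the original problem up to its first zero.
\<close>
definition usol :: "real \<Rightarrow> real \<Rightarrow> real" where
  "usol \<alpha> = (SOME u. \<exists>z. \<forall>R. sol R \<alpha> u z)"

definition zsol :: "real \<Rightarrow> real \<Rightarrow> real" where
  "zsol \<alpha> = (SOME z. \<forall>R. sol R \<alpha> (usol \<alpha>) z)"

lemma sol_usol: "0 < \<alpha> \<Longrightarrow> sol R \<alpha> (usol \<alpha>) (zsol \<alpha>)"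
proof -
  assume "0 < \<alpha>"
  then have "\<exists>z. \<forall>R. sol R \<alpha> (usol \<alpha>) z"
    unfolding usol_def using someI_ex[OF global_solution_exists] by blast
  then have "\<forall>R. sol R \<alpha> (usol \<alpha>) (zsol \<alpha>)"
    unfolding zsol_def by (rule someI_ex)
  then show ?thesis by blast
qed

end

section \<open>Monotonicity, zeros and the Cauchy problem\<close>

lemma first_zero:
  fixes v :: "real \<Rightarrow> real"
  assumes cont: "continuous_on {a..r} v" and "v a > 0" "a \<le> r" "v r \<le> 0"
  obtains R where "a < R" "R \<le> r" "v R = 0" "\<And>s. a \<le> s \<Longrightarrow> s < R \<Longrightarrow> v s > 0"
proof -
  define S where "S = {s \<in> {a..r}. v s = 0}"
  have "S \<noteq> {}"
    using IVT2'[of v r 0 a] assms by (auto simp: S_def)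
  moreover have "compact S"
  proof -
    have "S = {a..r} \<inter> v -` {0}" by (auto simp: S_def)
    then have "closed S"
      using continuous_closed_preimage[OF cont closed_atLeastAtMost closed_singleton] by metis
    moreover have "S \<subseteq> {a..r}" by (auto simp: S_def)
    ultimately show ?thesis
      using compact_Int_closed[of "{a..r}" S] by (simp add: Int_absorb1)
  qed
  ultimately obtain R where R: "R \<in> S" and least: "\<And>s. s \<in> S \<Longrightarrow> R \<le> s"
    using compact_attains_inf[of S] by auto
  show thesis
  proof (rule that)
    show "a < R" using R assms(2) by (cases "R = a") (auto simp: S_def)
    show "R \<le> r" "v R = 0" using R by (auto simp: S_def)
    fix s assume s: "a \<le> s" "s < R"
    show "v s > 0"
    proof (rule ccontr)
      assume "\<not> v s > 0"
      moreover have "continuous_on {a..s} v"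
        by (rule continuous_on_subset[OF cont]) (use s R in \<open>auto simp: S_def\<close>)
      ultimately obtain x where "a \<le> x" "x \<le> s" "v x = 0"
        using IVT2'[of v s 0 a] assms(2) s by auto
      then have "x \<in> S" using s R by (auto simp: S_def)
      then show False using least[of x] \<open>x \<le> s\<close> s by simp
    qed
  qed
qed

text \<open>
  Monotonicity down to an endpoint where only a limit is available: most quantities below are
  singular at the pole.
\<close>
lemma limit_le_of_deriv_nonneg:
  fixes f :: "real \<Rightarrow> real"
  assumes lim: "(f \<longlongrightarrow> L) (at_right a)" and r: "a < r"
    and deriv: "\<And>x. a < x \<Longrightarrow> x < r \<Longrightarrow> \<exists>y. (f has_real_derivative y) (at x) \<and> 0 \<le> y"
    and cont: "continuous_on {a<..r} f"
  shows "L \<le> f r"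
proof -
  have "f s \<le> f r" if s: "a < s" "s < r" for s
  proof (rule DERIV_nonneg_imp_increasing_open[of s r f])
    show "\<exists>y. (f has_real_derivative y) (at x) \<and> 0 \<le> y" if "s < x" "x < r" for x
      using deriv[of x] that s by simp
    show "continuous_on {s..r} f" by (rule continuous_on_subset[OF cont]) (use s in auto)
  qed (use s in simp)
  then have ev: "\<forall>\<^sub>F s in at_right a. f s \<le> f r"
    using r by (auto simp: eventually_at dist_real_def intro!: exI[of _ "r - a"])
  show ?thesis by (rule tendsto_upperbound[OF lim ev]) auto
qed

context radial_model
begin

text \<open>
  The flux is the integral of a source at most \<open>\<psi>\<^sup>N \<alpha>\<^sup>p\<close>; dividing by \<open>\<psi>\<^sup>N\<close> shows that \<open>u'\<close>
  vanishes linearly at the pole, in spite of the singular coefficient.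
\<close>
lemma z_upper:
  assumes "sol R \<alpha> u z" "0 < \<alpha>" "0 \<le> r" "r \<le> R"
  shows "z r \<le> \<psi> r ^ N * (\<alpha> powr p * r)"
proof (cases "r = 0")
  case True
  then show ?thesis using solD(2)[OF assms(1)] by simp
next
  case False
  then have r0: "0 < r" using assms by simp
  have "norm (z r - z 0) \<le> \<psi> r ^ N * (\<alpha> powr p * r) - \<psi> r ^ N * (\<alpha> powr p * 0)"
  proof (rule differentiable_bound_general[OF r0, where f' = "\<lambda>t. \<psi> t ^ N * nonlin (u t)"
         and \<phi>' = "\<lambda>t. \<psi> r ^ N * \<alpha> powr p"])
    show "continuous_on {0..r} z" using solD(4)[OF assms(1)] assms(4) by (auto intro: continuous_on_subset)
    show "continuous_on {0..r} (\<lambda>t. \<psi> r ^ N * (\<alpha> powr p * t))" by (intro continuous_intros)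
  next
    fix t assume t: "0 < t" "t < r"
    show "(z has_vector_derivative \<psi> t ^ N * nonlin (u t)) (at t)"
      unfolding has_real_derivative_iff_has_vector_derivative[symmetric]
      using solD(6)[OF assms(1), of t] t assms by auto
    show "((\<lambda>t. \<psi> r ^ N * (\<alpha> powr p * t)) has_vector_derivative \<psi> r ^ N * \<alpha> powr p) (at t)"
      unfolding has_real_derivative_iff_has_vector_derivative[symmetric]
      by (auto intro!: derivative_eq_intros)
    have "nonlin (u t) \<le> nonlin \<alpha>"
      using sol_monotone(4)[OF assms(1), of t t] t assms by (intro nonlin_mono) auto
    then show "norm (\<psi> t ^ N * nonlin (u t)) \<le> \<psi> r ^ N * \<alpha> powr p"
      using psi_power_mono[of t r] psi_nonneg[of t] psi_nonneg[of r] t assms(2,3)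
      by (simp add: abs_mult power_abs nonlin_pos mult_mono)
  qed
  then show ?thesis using solD(2)[OF assms(1)] by simp
qed

lemma u_lower:
  assumes "sol R \<alpha> u z" "0 < \<alpha>" "0 \<le> r" "r \<le> R"
  shows "\<alpha> - \<alpha> powr p * r\<^sup>2 / 2 \<le> u r"
proof -
  have "u 0 + \<alpha> powr p * 0\<^sup>2 / 2 \<le> u r + \<alpha> powr p * r\<^sup>2 / 2"
  proof (rule DERIV_nonneg_imp_increasing_open[OF assms(3)])
    fix t assume t: "0 < t" "t < r"
    have "z t / \<psi> t ^ N \<le> \<alpha> powr p * t"
      using z_upper[OF assms(1,2), of t] t assms psi_pos[of t] by (simp add: pos_divide_le_eq mult.commute)
    moreover have "((\<lambda>r. u r + \<alpha> powr p * r\<^sup>2 / 2) has_real_derivative - (z t / \<psi> t ^ N) + \<alpha> powr p * t) (at t)"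
      using solD(5)[OF assms(1), of t] t assms(4) by (auto intro!: derivative_eq_intros)
    ultimately show "\<exists>y. ((\<lambda>r. u r + \<alpha> powr p * r\<^sup>2 / 2) has_real_derivative y) (at t) \<and> 0 \<le> y"
      by (intro exI conjI) auto
  next
    show "continuous_on {0..r} (\<lambda>r. u r + \<alpha> powr p * r\<^sup>2 / 2)"
      using solD(3)[OF assms(1)] assms(4) by (intro continuous_intros) (auto intro: continuous_on_subset)
  qed
  then show ?thesis using solD(1)[OF assms(1)] by simp
qed

lemma z_pos:
  assumes "sol R \<alpha> u z" "0 < \<alpha>" "0 < r" "r \<le> R"
  shows "0 < z r"
proof -
  have "(u \<longlongrightarrow> u 0) (at 0 within {0..R})"
    using solD(3)[OF assms(1)] assms by (auto simp: continuous_on_def)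
  then have "\<forall>\<^sub>F t in at 0 within {0..R}. u t > 0"
    using solD(1)[OF assms(1)] assms(2) by (intro order_tendstoD) auto
  then obtain d where d: "d > 0" "\<And>t. 0 < t \<Longrightarrow> t \<le> R \<Longrightarrow> t < d \<Longrightarrow> u t > 0"
    unfolding eventually_at by (auto simp: dist_real_def)
  define s where "s = min d r"
  have s: "0 < s" "s \<le> r" "s \<le> d" using d assms by (auto simp: s_def)
  have "z 0 < z s"
  proof (rule DERIV_pos_imp_increasing_open[OF s(1)])
    fix t assume t: "0 < t" "t < s"
    then have "0 < \<psi> t ^ N * nonlin (u t)"
      using d(2)[of t] s assms psi_pos[of t] by (auto simp: nonlin_pos)
    then show "\<exists>y. (z has_real_derivative y) (at t) \<and> 0 < y"
      using solD(6)[OF assms(1), of t] t s assms by (intro exI conjI) auto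
  next
    show "continuous_on {0..s} z"
      using solD(4)[OF assms(1)] s assms by (auto intro: continuous_on_subset)
  qed
  also have "z s \<le> z r" using sol_monotone(2)[OF assms(1), of s r] s assms by simp
  finally show ?thesis using solD(2)[OF assms(1)] by simp
qed

lemma u_strict_antimono:
  assumes "sol R \<alpha> u z" "0 < \<alpha>" "0 \<le> s" "s < r" "r \<le> R"
  shows "u r < u s"
proof (rule DERIV_neg_imp_decreasing_open[OF assms(4)])
  fix t assume t: "s < t" "t < r"
  then have "0 < z t / \<psi> t ^ N" using z_pos[OF assms(1,2), of t] assms psi_pos[of t] by auto
  then show "\<exists>y. (u has_real_derivative y) (at t) \<and> y < 0"
    using solD(5)[OF assms(1), of t] t assms by (intro exI[of _ "- (z t / \<psi> t ^ N)"]) auto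
next
  show "continuous_on {s..r} u"
    using solD(3)[OF assms(1)] assms by (auto intro: continuous_on_subset)
qed

lemma usol_0: "0 < \<alpha> \<Longrightarrow> usol \<alpha> 0 = \<alpha>"
  using solD(1)[OF sol_usol] .

lemma continuous_on_halfline:
  fixes g :: "real \<Rightarrow> real"
  assumes "\<And>R. continuous_on {0..R} g"
  shows "continuous_on {0..} g"
  unfolding continuous_on_eq_continuous_within
proof
  fix t :: real assume t: "t \<in> {0..}"
  have "continuous (at t within {0..t+1}) g"
    using assms[of "t+1"] t by (auto simp: continuous_on_eq_continuous_within)
  moreover have "at t within {0..t+1} = at t within {0..}"
    using t by (intro at_within_nhd[of t "{..<t+1}"]) auto
  ultimately show "continuous (at t within {0..}) g" by simp
qed

lemma usol_cont: "0 < \<alpha> \<Longrightarrow> continuous_on {0..} (usol \<alpha>)"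
  using solD(3)[OF sol_usol] by (intro continuous_on_halfline) auto

lemma zsol_cont: "0 < \<alpha> \<Longrightarrow> continuous_on {0..} (zsol \<alpha>)"
  using solD(4)[OF sol_usol] by (intro continuous_on_halfline) auto

lemma usol_antimono: "0 < \<alpha> \<Longrightarrow> 0 \<le> s \<Longrightarrow> s \<le> r \<Longrightarrow> usol \<alpha> r \<le> usol \<alpha> s"
  using sol_monotone(1)[OF sol_usol] by blast

lemma usol_has_derivative_0:
  assumes al: "0 < \<alpha>"
  shows "(usol \<alpha> has_real_derivative 0) (at 0 within {0..})"
proof -
  have "((\<lambda>r. (usol \<alpha> r - usol \<alpha> 0) / (r - 0)) \<longlongrightarrow> 0) (at 0 within {0..})"
  proof (rule Lim_null_comparison)
    show "\<forall>\<^sub>F r in at 0 within {0..}. norm ((usol \<alpha> r - usol \<alpha> 0) / (r - 0)) \<le> \<alpha> powr p * r / 2"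
      unfolding eventually_at
    proof (intro exI[of _ 1] conjI ballI impI)
      fix r :: real assume "r \<in> {0..}" "r \<noteq> 0 \<and> dist r 0 < 1"
      then have r: "0 < r" by auto
      have "\<bar>usol \<alpha> r - usol \<alpha> 0\<bar> \<le> \<alpha> powr p * r / 2 * r"
        using u_lower[OF sol_usol[OF al] al, of r r] usol_antimono[OF al, of 0 r] usol_0[OF al] r
        by (simp add: power2_eq_square)
      then show "norm ((usol \<alpha> r - usol \<alpha> 0) / (r - 0)) \<le> \<alpha> powr p * r / 2"
        using r by (simp add: pos_divide_le_eq)
    qed simp
    show "((\<lambda>r. \<alpha> powr p * r / 2) \<longlongrightarrow> 0) (at 0 within {0..})"
      by (auto intro!: tendsto_eq_intros)
  qed
  then show ?thesis by (simp add: has_field_derivative_iff)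
qed

lemma zsol_quotient_cont:
  assumes al: "0 < \<alpha>"
  shows "continuous_on {0..} (\<lambda>r. zsol \<alpha> r / \<psi> r ^ N)"
  unfolding continuous_on_eq_continuous_within
proof
  fix t :: real assume t: "t \<in> {0..}"
  show "continuous (at t within {0..}) (\<lambda>r. zsol \<alpha> r / \<psi> r ^ N)"
  proof (cases "t = 0")
    case True
    have "((\<lambda>r. zsol \<alpha> r / \<psi> r ^ N) \<longlongrightarrow> 0) (at 0 within {0..})"
    proof (rule Lim_null_comparison)
      show "\<forall>\<^sub>F r in at 0 within {0..}. norm (zsol \<alpha> r / \<psi> r ^ N) \<le> \<alpha> powr p * r"
        unfolding eventually_at
      proof (intro exI[of _ 1] conjI ballI impI)
        fix r :: real assume "r \<in> {0..}" "r \<noteq> 0 \<and> dist r 0 < 1"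
        then have r: "0 < r" by auto
        then show "norm (zsol \<alpha> r / \<psi> r ^ N) \<le> \<alpha> powr p * r"
          using z_upper[OF sol_usol[OF al] al, of r r] sol_monotone(3)[OF sol_usol[OF al], of r r r] psi_pos[OF r]
          by (simp add: pos_divide_le_eq mult.commute)
      qed simp
      show "((\<lambda>r. \<alpha> powr p * r) \<longlongrightarrow> 0) (at 0 within {0..})"
        by (auto intro!: tendsto_eq_intros)
    qed
    then show ?thesis using True solD(2)[OF sol_usol[OF al]] by (simp add: continuous_within)
  next
    case False
    have "continuous (at t within {0..}) (zsol \<alpha>)" "continuous (at t within {0..}) \<psi>"
      using zsol_cont[OF al] psi_cont(1) t by (auto simp: continuous_on_eq_continuous_within)
    then show ?thesis
      using False t psi_pos[of t] by (intro continuous_intros) auto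
  qed
qed

lemma usol_has_derivative:
  assumes "0 < \<alpha>" "0 < r"
  shows "(usol \<alpha> has_real_derivative - (zsol \<alpha> r / \<psi> r ^ N)) (at r)"
    "(zsol \<alpha> has_real_derivative \<psi> r ^ N * nonlin (usol \<alpha> r)) (at r)"
  using solD(5,6)[OF sol_usol[OF assms(1), of "r+1"], of r] assms by auto

lemma cauchy_solution_usol:
  assumes al: "0 < \<alpha>" and pos: "\<forall>r\<ge>0. usol \<alpha> r > 0"
  shows "cauchy_solution \<psi> (Suc N) p \<alpha> (usol \<alpha>)"
  unfolding cauchy_solution_def
proof (intro exI[of _ "\<lambda>r. - (zsol \<alpha> r / \<psi> r ^ N)"] conjI allI impI)
  have z0: "zsol \<alpha> 0 = 0" using solD(2)[OF sol_usol[OF al]] .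
  fix r :: real
  show "(usol \<alpha> has_real_derivative - (zsol \<alpha> r / \<psi> r ^ N)) (at r within {0..})" if "0 \<le> r"
  proof (cases "r = 0")
    case True
    then show ?thesis using usol_has_derivative_0[OF al] z0 by simp
  next
    case False
    then show ?thesis
      using usol_has_derivative(1)[OF al, of r] that by (auto intro: has_field_derivative_at_within)
  qed
  show "continuous_on {0..} (\<lambda>r. - (zsol \<alpha> r / \<psi> r ^ N))"
    by (intro continuous_intros zsol_quotient_cont al)
  show "usol \<alpha> 0 = \<alpha>" by (rule usol_0[OF al])
  show "- (zsol \<alpha> 0 / \<psi> 0 ^ N) = 0" by (simp add: z0)
  assume r: "0 < r"
  have der: "((\<lambda>s. \<psi> s ^ (Suc N - 1) * - (zsol \<alpha> s / \<psi> s ^ N)) has_real_derivative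
         - (\<psi> r ^ N * nonlin (usol \<alpha> r))) (at r)"
  proof (rule has_field_derivative_transform_within_open[where S = "{0<..}"])
    show "((\<lambda>s. - zsol \<alpha> s) has_real_derivative - (\<psi> r ^ N * nonlin (usol \<alpha> r))) (at r)"
      by (intro derivative_intros usol_has_derivative al r)
    show "- zsol \<alpha> s = \<psi> s ^ (Suc N - 1) * - (zsol \<alpha> s / \<psi> s ^ N)" if "s \<in> {0<..}" for s
      using psi_pos[of s] that by simp
  qed (use r in auto)
  show "(\<lambda>s. \<psi> s ^ (Suc N - 1) * - (zsol \<alpha> s / \<psi> s ^ N)) differentiable (at r)"
    using der real_differentiable_def by blast
  have "usol \<alpha> r > 0" using pos r by simp
  then show "- (1 / \<psi> r ^ (Suc N - 1)) * deriv (\<lambda>s. \<psi> s ^ (Suc N - 1) * - (zsol \<alpha> s / \<psi> s ^ N)) r =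
        \<bar>usol \<alpha> r\<bar> powr (p - 1) * usol \<alpha> r"
    unfolding DERIV_imp_deriv[OF der]
    using psi_pos[OF r] by (simp add: nonlin_pos powr_diff)
qed

text \<open>
  Conversely a classical solution solves the system until it becomes
  negative. The flux does not depend on where this happens, hence the order of the quantifiers.
\<close>
lemma cauchy_imp_sol:
  assumes "cauchy_solution \<psi> (Suc N) p \<alpha> v"
  shows "\<exists>z. \<forall>R. (\<forall>r. 0 \<le> r \<longrightarrow> r < R \<longrightarrow> 0 \<le> v r) \<longrightarrow> sol R \<alpha> v z"
proof -
  from assms obtain v' where v:
    "\<And>r. 0 \<le> r \<Longrightarrow> (v has_real_derivative v' r) (at r within {0..})"
    "continuous_on {0..} v'" "v 0 = \<alpha>" "v' 0 = 0"
    "\<And>r. 0 < r \<Longrightarrow> (\<lambda>s. \<psi> s ^ N * v' s) differentiable (at r)"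
    "\<And>r. 0 < r \<Longrightarrow> - (1 / \<psi> r ^ N) * deriv (\<lambda>s. \<psi> s ^ N * v' s) r = \<bar>v r\<bar> powr (p - 1) * v r"
    unfolding cauchy_solution_def by auto
  define z where "z r = - (\<psi> r ^ N * v' r)" for r
  have "sol R \<alpha> v z" if nn: "\<forall>r. 0 \<le> r \<longrightarrow> r < R \<longrightarrow> 0 \<le> v r" for R
    unfolding sol_def radial_system_def
  proof (intro conjI ballI)
    show "v 0 = \<alpha>" by fact
    show "z 0 = 0" by (simp add: z_def v)
    show "continuous_on {0..R} v"
      using v(1) by (intro DERIV_continuous_on[where D = v']) (auto intro: DERIV_subset[where s = "{0..}"])
    show "continuous_on {0..R} z"
      unfolding z_def
      by (intro continuous_intros continuous_on_subset[OF v(2)] continuous_on_subset[OF psi_cont(1)]) auto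
    fix r assume r: "r \<in> {0<..<R}"
    have "at r within {0..} = at r" using r by (intro at_within_interior) auto
    then show "(v has_real_derivative - (z r / \<psi> r ^ N)) (at r)"
      using v(1)[of r] r psi_pos[of r] by (simp add: z_def)
    have "((\<lambda>s. \<psi> s ^ N * v' s) has_real_derivative deriv (\<lambda>s. \<psi> s ^ N * v' s) r) (at r)"
      using v(5)[of r] r by (auto simp: DERIV_deriv_iff_real_differentiable)
    then have "(z has_real_derivative - deriv (\<lambda>s. \<psi> s ^ N * v' s) r) (at r)"
      unfolding z_def by (intro derivative_intros)
    moreover have "- deriv (\<lambda>s. \<psi> s ^ N * v' s) r = \<psi> r ^ N * nonlin (v r)"
    proof -
      have "- deriv (\<lambda>s. \<psi> s ^ N * v' s) r = \<psi> r ^ N * (\<bar>v r\<bar> powr (p - 1) * v r)"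
        using v(6)[of r] r psi_pos[of r] by (simp add: field_simps)
      moreover have "\<bar>v r\<bar> powr (p - 1) * v r = nonlin (v r)"
        using nn r by (cases "v r = 0") (auto simp: nonlin_def powr_diff)
      ultimately show ?thesis by simp
    qed
    ultimately show "(z has_real_derivative \<psi> r ^ N * nonlin (v r)) (at r)" by simp
  qed
  then show ?thesis by blast
qed

lemma cauchy_cont:
  assumes "cauchy_solution \<psi> n p \<alpha> v"
  shows "continuous_on {0..} v" "v 0 = \<alpha>"
proof -
  from assms obtain v' where "v 0 = \<alpha>" "\<And>r. 0 \<le> r \<Longrightarrow> (v has_real_derivative v' r) (at r within {0..})"
    unfolding cauchy_solution_def by blast
  then show "continuous_on {0..} v" "v 0 = \<alpha>"
    by (auto intro!: DERIV_continuous_on[where D = v'])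
qed

lemma cauchy_eq_usol:
  assumes "cauchy_solution \<psi> (Suc N) p \<alpha> v" "0 < \<alpha>" "\<And>r. 0 \<le> r \<Longrightarrow> r < R \<Longrightarrow> 0 \<le> v r"
    and "0 \<le> r" "r \<le> R"
  shows "v r = usol \<alpha> r"
proof -
  obtain z where "\<forall>R. (\<forall>r. 0 \<le> r \<longrightarrow> r < R \<longrightarrow> 0 \<le> v r) \<longrightarrow> sol R \<alpha> v z"
    using cauchy_imp_sol[OF assms(1)] by blast
  then have "sol R \<alpha> v z" using assms(3) by simp
  then show ?thesis using sol_unique(1)[OF _ sol_usol[OF assms(2)] assms(4,5)] by blast
qed

lemma cauchy_usol_positive:
  assumes v: "cauchy_solution \<psi> (Suc N) p \<alpha> v" and al: "0 < \<alpha>"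
    and pos: "\<forall>r\<ge>0. usol \<alpha> r > 0" and r: "0 \<le> r"
  shows "v r = usol \<alpha> r"
proof -
  have "0 \<le> v s" if s: "0 \<le> s" for s
  proof (rule ccontr)
    assume "\<not> 0 \<le> v s"
    with s obtain R where R: "0 < R" "v R = 0" "\<And>t. 0 \<le> t \<Longrightarrow> t < R \<Longrightarrow> v t > 0"
      using first_zero[OF continuous_on_subset[OF cauchy_cont(1)[OF v] Icc_subset_Ici_iff[THEN iffD2]], of 0 s]
        cauchy_cont(2)[OF v] al
      by (metis not_le_imp_less order_less_imp_le order_refl)
    then have "v R = usol \<alpha> R" by (intro cauchy_eq_usol[OF v al]) (auto intro: less_imp_le)
    then show False using R(1,2) pos[rule_format, of R] by simp
  qed
  then show ?thesis using cauchy_eq_usol[OF v al, of r r] r by simp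
qed

text \<open>
  If \<open>v\<close> never became negative it would agree with the truncated solution everywhere; but that one
  is strictly decreasing and so is negative beyond its zero.
\<close>
lemma cauchy_usol_sign_changing:
  assumes v: "cauchy_solution \<psi> (Suc N) p \<alpha> v" and al: "0 < \<alpha>"
    and zero: "0 \<le> R" "usol \<alpha> R \<le> 0"
  shows "sign_changing v"
proof -
  have "\<exists>r\<ge>0. v r < 0"
  proof (rule ccontr)
    assume "\<not> ?thesis"
    then have nn: "\<And>r. 0 \<le> r \<Longrightarrow> 0 \<le> v r" by (meson not_less)
    have "v (R + 1) = usol \<alpha> (R + 1)"
      by (rule cauchy_eq_usol[OF v al nn]) (use zero in auto)
    moreover have "usol \<alpha> (R + 1) < usol \<alpha> R"
      using u_strict_antimono[OF sol_usol[OF al] al, of R "R + 1" "R + 1"] zero by simp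
    ultimately show False using zero nn[of "R + 1"] by simp
  qed
  moreover have "v 0 > 0" using cauchy_cont(2)[OF v] al by simp
  ultimately show ?thesis unfolding sign_changing_def by (meson order_refl)
qed

end

section \<open>The energy in scaled variables\<close>

locale subcritical_model = radial_model N p \<psi> \<psi>' \<psi>'' for N p \<psi> \<psi>' \<psi>'' +
  fixes \<delta> :: real and G :: "real \<Rightarrow> real"
  assumes subcritical: "p < (real N + 3) / (real N - 1)"
    and delta: "\<delta> = 2 * real N / (p + 3)"
    and G_def: "G = (\<lambda>r. \<delta> * \<psi> r powr (\<delta> * (p - 1) - 2) *
                   ((\<delta> + 1 - real N) * (\<psi>' r)\<^sup>2 - \<psi>'' r * \<psi> r))"
    and Lambda: "Lambda_property G"
begin

lemma delta_eq: "\<delta> * (p + 3) = 2 * real N"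
  using delta p1 by simp

text \<open>
  The lower bound is subcriticality, the upper one is \<open>p > 1\<close>, and \<open>N \<ge> 2\<close> gives the third.
\<close>
lemma delta_bounds: "(real N - 1) / 2 < \<delta>" "\<delta> < real N / 2" "0 < real N - 1 - \<delta>" "0 < \<delta>"
proof -
  have N: "real N \<ge> 2" using N2 by simp
  have *: "p * (real N - 1) < real N + 3" using subcritical N by (simp add: pos_less_divide_eq)
  have "(real N - 1) * (p + 3) < 2 * (2 * real N)"
    using * by (simp add: algebra_simps)
  then have "(real N - 1) * (p + 3) < 2 * \<delta> * (p + 3)" using delta_eq by (simp add: algebra_simps)
  then show "(real N - 1) / 2 < \<delta>" using p1 by simp
  have "real N * 4 < real N * (p + 3)" using N p1 by simp
  then have "2 * \<delta> * (p + 3) < real N * (p + 3)"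
    using delta_eq by (simp add: algebra_simps)
  then show 2: "\<delta> < real N / 2" using p1 by simp
  then show "0 < real N - 1 - \<delta>" using N by simp
  show "0 < \<delta>" using delta p1 N by simp
qed

text \<open>
  Subcriticality in the form used at the pole: the power of \<open>\<psi>\<close> in \<open>G\<close> is negative.
\<close>
lemma sigma_pos: "0 < 2 - \<delta> * (p - 1)"
  using delta_eq delta_bounds by (simp add: algebra_simps)

lemma psi_powr_deriv:
  assumes "0 < r"
  shows "((\<lambda>r. \<psi> r powr c) has_real_derivative c * \<psi> r powr (c - 1) * \<psi>' r) (at r)"
  using DERIV_fun_powr[OF psi_has_derivative(1)[OF assms], of c] psi_pos[OF assms] by simp

lemma psi_power_powr: "0 < r \<Longrightarrow> \<psi> r ^ N = \<psi> r powr N"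
  using psi_pos by (simp add: powr_realpow)

text \<open>
  In these variables the equation becomes the Hamiltonian system \<open>v' = B y\<close>,
  \<open>y' = - B (G v + v\<^sup>p)\<close> with a common factor \<open>B = \<psi>\<^sup>2\<^sup>\<delta>\<^sup>-\<^sup>N\<close>, that is, \<open>v'' + G v + v\<^sup>p = 0\<close>
  in the time variable \<open>\<integral> B dr\<close>. The exponent \<open>\<delta>\<close> is the one for which the damping disappears and
  the nonlinear term becomes autonomous.
\<close>
definition scaled :: "(real \<Rightarrow> real) \<Rightarrow> real \<Rightarrow> real" where
  "scaled u r = \<psi> r powr \<delta> * u r"

definition momentum :: "(real \<Rightarrow> real) \<Rightarrow> (real \<Rightarrow> real) \<Rightarrow> real \<Rightarrow> real" where
  "momentum u z r = \<delta> * \<psi> r powr (real N - \<delta> - 1) * \<psi>' r * u r - \<psi> r powr (- \<delta>) * z r"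

definition energy :: "(real \<Rightarrow> real) \<Rightarrow> (real \<Rightarrow> real) \<Rightarrow> real \<Rightarrow> real" where
  "energy u z r = (momentum u z r)\<^sup>2 / 2 + scaled u r powr (p + 1) / (p + 1) + G r * (scaled u r)\<^sup>2 / 2"

lemma scaled_pos: "0 < r \<Longrightarrow> 0 < u r \<Longrightarrow> 0 < scaled u r"
  using psi_pos[of r] by (simp add: scaled_def)

lemma scaled_deriv:
  assumes r: "0 < r" and u: "(u has_real_derivative - (z r / \<psi> r ^ N)) (at r)"
  shows "(scaled u has_real_derivative \<psi> r powr (2 * \<delta> - real N) * momentum u z r) (at r)"
proof -
  have P: "0 < \<psi> r" using psi_pos r by simp
  have "(scaled u has_real_derivative \<delta> * \<psi> r powr (\<delta> - 1) * \<psi>' r * u r + \<psi> r powr \<delta> * - (z r / \<psi> r ^ N)) (at r)"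
    unfolding scaled_def[abs_def]
    using DERIV_mult[OF psi_powr_deriv[OF r] u] by (simp add: mult.commute[of "\<psi> r powr \<delta>"])
  moreover have "\<psi> r powr (2 * \<delta> - real N) * \<psi> r powr (real N - \<delta> - 1) = \<psi> r powr (\<delta> - 1)"
    "\<psi> r powr (2 * \<delta> - real N) * \<psi> r powr (- \<delta>) = \<psi> r powr (\<delta> - real N)"
    by (simp_all add: powr_add[symmetric])
  moreover have "\<psi> r powr \<delta> * - (z r / \<psi> r ^ N) = - (\<psi> r powr (\<delta> - real N) * z r)"
    using P by (simp add: psi_power_powr[OF r] powr_diff)
  ultimately show ?thesis
    by (simp add: momentum_def right_diff_distrib mult.assoc[symmetric] mult.commute[of _ \<delta>])
       (simp add: mult.assoc)
qed

text \<open>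
  The flux terms cancel, and the powers of \<open>\<psi>\<close> in front of \<open>u\<close> and of \<open>u\<^sup>p\<close> match because
  \<open>\<delta> (p + 3) = 2 N\<close>.
\<close>
lemma momentum_deriv:
  assumes r: "0 < r" and u: "(u has_real_derivative - (z r / \<psi> r ^ N)) (at r)"
    and z: "(z has_real_derivative \<psi> r ^ N * nonlin (u r)) (at r)" and pos: "0 < u r"
  shows "(momentum u z has_real_derivative
      - (\<psi> r powr (2 * \<delta> - real N) * (G r * scaled u r + scaled u r powr p))) (at r)"
proof -
  have P: "0 < \<psi> r" using psi_pos r by simp
  let ?P = "\<lambda>c. \<psi> r powr c"
  define D where "D = (\<delta> * ((real N - \<delta> - 1) * ?P (real N - \<delta> - 1 - 1) * \<psi>' r) * \<psi>' r
      + \<delta> * ?P (real N - \<delta> - 1) * \<psi>'' r) * u r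
      + \<delta> * ?P (real N - \<delta> - 1) * \<psi>' r * - (z r / \<psi> r ^ N)
      - ((- \<delta>) * ?P (- \<delta> - 1) * \<psi>' r * z r + ?P (- \<delta>) * (\<psi> r ^ N * nonlin (u r)))"
  have "(momentum u z has_real_derivative D) (at r)"
    unfolding momentum_def[abs_def]
    by (rule derivative_eq_intros psi_powr_deriv psi_has_derivative u z r refl | simp add: D_def algebra_simps)+
  moreover have "D = - (?P (2 * \<delta> - real N) * (G r * scaled u r + scaled u r powr p))"
  proof -
    have shift: "?P (real N - \<delta> - 1) = \<psi> r * ?P (real N - \<delta> - 2)"
      using P powr_add[of "\<psi> r" 1 "real N - \<delta> - 2"] by simp
    have zz: "?P (real N - \<delta> - 1) * (z r / \<psi> r ^ N) = ?P (- \<delta> - 1) * z r"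
    proof -
      have "?P (real N - \<delta> - 1) = ?P (- \<delta> - 1) * ?P (real N)" by (simp add: powr_add[symmetric] algebra_simps)
      then show ?thesis using P by (simp add: psi_power_powr[OF r])
    qed
    have nl: "?P (- \<delta>) * (\<psi> r ^ N * nonlin (u r)) = ?P (2 * \<delta> - real N) * scaled u r powr p"
    proof -
      have e: "- \<delta> + real N = (2 * \<delta> - real N) + \<delta> * p" using delta_eq by (simp add: algebra_simps)
      have "?P (- \<delta>) * ?P (real N) = ?P (2 * \<delta> - real N) * ?P (\<delta> * p)"
        by (simp only: powr_add[symmetric] e)
      moreover have "scaled u r powr p = ?P (\<delta> * p) * u r powr p"
        using P pos by (simp add: scaled_def powr_mult powr_powr)
      ultimately show ?thesis using pos by (simp add: psi_power_powr[OF r] nonlin_pos mult.assoc[symmetric])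
    qed
    have gv: "?P (2 * \<delta> - real N) * (G r * scaled u r)
        = \<delta> * ?P (real N - \<delta> - 2) * ((\<delta> + 1 - real N) * (\<psi>' r)\<^sup>2 - \<psi>'' r * \<psi> r) * u r"
    proof -
      have e: "2 * \<delta> - real N + ((\<delta> * (p - 1) - 2) + \<delta>) = real N - \<delta> - 2"
        using delta_eq by (simp add: algebra_simps)
      have "?P (2 * \<delta> - real N) * (?P (\<delta> * (p - 1) - 2) * ?P \<delta>) = ?P (real N - \<delta> - 2)"
        by (simp only: powr_add[symmetric] e)
      then have *: "?P (real N - \<delta> - 2) = ?P (2 * \<delta> - real N) * (?P (\<delta> * (p - 1) - 2) * ?P \<delta>)" by simp
      show ?thesis unfolding * by (simp add: G_def scaled_def)
    qed
    have "D = (\<delta> * ((real N - \<delta> - 1) * ?P (real N - \<delta> - 2) * \<psi>' r) * \<psi>' r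
      + \<delta> * (\<psi> r * ?P (real N - \<delta> - 2)) * \<psi>'' r) * u r
      - \<delta> * \<psi>' r * (?P (real N - \<delta> - 1) * (z r / \<psi> r ^ N))
      + \<delta> * \<psi>' r * (?P (- \<delta> - 1) * z r) - ?P (- \<delta>) * (\<psi> r ^ N * nonlin (u r))"
      unfolding D_def shift by (simp add: algebra_simps)
    also have "\<dots> = - (\<delta> * ?P (real N - \<delta> - 2) * ((\<delta> + 1 - real N) * (\<psi>' r)\<^sup>2 - \<psi>'' r * \<psi> r) * u r)
       - ?P (2 * \<delta> - real N) * scaled u r powr p"
      unfolding zz nl by (simp add: algebra_simps power2_eq_square)
    also have "\<dots> = - (?P (2 * \<delta> - real N) * (G r * scaled u r + scaled u r powr p))"
      unfolding gv[symmetric] by (simp add: algebra_simps)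
    finally show ?thesis .
  qed
  ultimately show ?thesis by simp
qed

lemma G_deriv: "0 < r \<Longrightarrow> (G has_real_derivative deriv G r) (at r)"
  using Lambda by (auto simp: Lambda_property_def DERIV_deriv_iff_real_differentiable)

text \<open>
  The explicit dependence of the energy on the radius is only through \<open>G\<close>; the rest is conserved
  by the Hamiltonian system.
\<close>
lemma energy_deriv:
  assumes r: "0 < r" and u: "(u has_real_derivative - (z r / \<psi> r ^ N)) (at r)"
    and z: "(z has_real_derivative \<psi> r ^ N * nonlin (u r)) (at r)" and pos: "0 < u r"
  shows "(energy u z has_real_derivative deriv G r * (scaled u r)\<^sup>2 / 2) (at r)"
proof -
  note v = scaled_deriv[where z = z, OF r u] and y = momentum_deriv[where u = u and z = z, OF r u z pos]
  have vp: "0 < scaled u r" using scaled_pos[of r u] r pos by simp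
  let ?B = "\<psi> r powr (2 * \<delta> - real N)"
  have pw: "((\<lambda>r. scaled u r powr (p + 1)) has_real_derivative
      (p + 1) * scaled u r powr p * (?B * momentum u z r)) (at r)"
    using DERIV_fun_powr[OF v vp, of "p + 1"] by simp
  have a: "((\<lambda>r. (momentum u z r)\<^sup>2 / 2) has_real_derivative
      momentum u z r * - (?B * (G r * scaled u r + scaled u r powr p))) (at r)"
    by (rule derivative_eq_intros y refl | simp)+
  have b: "((\<lambda>r. scaled u r powr (p + 1) / (p + 1)) has_real_derivative
      scaled u r powr p * (?B * momentum u z r)) (at r)"
    using DERIV_cdivide[OF pw, of "p + 1"] p1 by (simp add: mult.assoc)
  have c: "((\<lambda>r. G r * (scaled u r)\<^sup>2 / 2) has_real_derivative
      deriv G r * (scaled u r)\<^sup>2 / 2 + G r * (scaled u r * (?B * momentum u z r))) (at r)"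
    by (rule derivative_eq_intros v G_deriv[OF r] refl | simp)+
  have "momentum u z r * - (?B * (G r * scaled u r + scaled u r powr p))
      + scaled u r powr p * (?B * momentum u z r)
      + (deriv G r * (scaled u r)\<^sup>2 / 2 + G r * (scaled u r * (?B * momentum u z r)))
     = deriv G r * (scaled u r)\<^sup>2 / 2"
    by (simp add: algebra_simps)
  then show ?thesis
    using DERIV_add[OF DERIV_add[OF a b] c] unfolding energy_def[abs_def] by (simp only:)
qed

lemma psi_tendsto_0: "(\<psi> \<longlongrightarrow> 0) (at_right 0)" "(\<psi>' \<longlongrightarrow> 1) (at_right 0)" "(\<psi>'' \<longlongrightarrow> 0) (at_right 0)"
proof -
  have *: "(f \<longlongrightarrow> f 0) (at_right 0)" if "continuous_on {0..} f" for f :: "real \<Rightarrow> real"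
    using that by (auto simp: continuous_on_def intro: tendsto_within_subset)
  show "(\<psi> \<longlongrightarrow> 0) (at_right 0)" "(\<psi>' \<longlongrightarrow> 1) (at_right 0)" "(\<psi>'' \<longlongrightarrow> 0) (at_right 0)"
    using *[OF psi_cont(1)] *[OF psi_cont(2)] *[OF psi''_cont] psi_0 by auto
qed

lemma psi_powr_tendsto_0: "0 < c \<Longrightarrow> ((\<lambda>r. \<psi> r powr c) \<longlongrightarrow> 0) (at_right 0)"
  using psi_tendsto_0(1) psi_pos
  by (intro tendsto_zero_powrI[where b = c]) (auto simp: eventually_at_filter less_imp_le)

lemma sol_tendsto_0:
  assumes "sol R \<alpha> u z" "0 < R"
  shows "(u \<longlongrightarrow> \<alpha>) (at_right 0)" "(z \<longlongrightarrow> 0) (at_right 0)"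
proof -
  have *: "(f \<longlongrightarrow> f 0) (at_right 0)" if "continuous_on {0..R} f" for f :: "real \<Rightarrow> real"
  proof -
    have "(f \<longlongrightarrow> f 0) (at 0 within {0..R})" using that assms(2) by (auto simp: continuous_on_def)
    then show ?thesis using assms(2) by (simp add: at_within_Icc_at_right)
  qed
  show "(u \<longlongrightarrow> \<alpha>) (at_right 0)" "(z \<longlongrightarrow> 0) (at_right 0)"
    using *[OF solD(3)[OF assms(1)]] *[OF solD(4)[OF assms(1)]] solD(1,2)[OF assms(1)] by auto
qed

lemma G_scaled:
  "G r * (scaled u r)\<^sup>2 = \<delta> * \<psi> r powr (2 * (real N - \<delta> - 1)) *
      ((\<delta> + 1 - real N) * (\<psi>' r)\<^sup>2 - \<psi>'' r * \<psi> r) * (u r)\<^sup>2"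
proof -
  have "(\<delta> * (p - 1) - 2) + (\<delta> + \<delta>) = 2 * (real N - \<delta> - 1)"
    using delta_eq by (simp add: algebra_simps)
  then have "\<psi> r powr (\<delta> * (p - 1) - 2) * (\<psi> r powr \<delta> * \<psi> r powr \<delta>) = \<psi> r powr (2 * (real N - \<delta> - 1))"
    by (simp only: powr_add[symmetric])
  then show ?thesis by (simp add: G_def scaled_def power2_eq_square mult_ac)
qed

text \<open>
  Although \<open>G\<close> is unbounded at the pole, \<open>G v\<^sup>2\<close> carries the power \<open>2 (N - \<delta> - 1) > 0\<close> of
  \<open>\<psi>\<close>.
\<close>
lemma energy_terms_tendsto_0:
  assumes s: "sol R \<alpha> u z" and "0 < R" "0 < \<alpha>"
  shows "(scaled u \<longlongrightarrow> 0) (at_right 0)" "(momentum u z \<longlongrightarrow> 0) (at_right 0)"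
    "((\<lambda>r. G r * (scaled u r)\<^sup>2) \<longlongrightarrow> 0) (at_right 0)" "(energy u z \<longlongrightarrow> 0) (at_right 0)"
proof -
  note d = delta_bounds
  note lims = sol_tendsto_0[OF s assms(2)] psi_tendsto_0
  show v: "(scaled u \<longlongrightarrow> 0) (at_right 0)"
    unfolding scaled_def[abs_def] using tendsto_mult[OF psi_powr_tendsto_0[OF d(4)] lims(1)] by simp
  have "((\<lambda>r. \<psi> r powr (- \<delta>) * z r) \<longlongrightarrow> 0) (at_right 0)"
  proof (rule Lim_null_comparison)
    show "\<forall>\<^sub>F r in at_right 0. norm (\<psi> r powr (- \<delta>) * z r) \<le> \<psi> r powr (real N - \<delta>) * (\<alpha> powr p * r)"
      unfolding eventually_at
    proof (intro exI[of _ R] conjI ballI impI)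
      fix r :: real assume "r \<in> {0<..}" "r \<noteq> 0 \<and> dist r 0 < R"
      then have r: "0 < r" "r \<le> R" by auto
      have "norm (\<psi> r powr (- \<delta>) * z r) = \<psi> r powr (- \<delta>) * z r"
        using sol_monotone(3)[OF s, of r r] r by simp
      also have "\<dots> \<le> \<psi> r powr (- \<delta>) * (\<psi> r ^ N * (\<alpha> powr p * r))"
        using z_upper[OF s assms(3), of r] r by (intro mult_left_mono) auto
      also have "\<dots> = \<psi> r powr (real N - \<delta>) * (\<alpha> powr p * r)"
        using powr_add[of "\<psi> r" "- \<delta>" "real N"] psi_power_powr[OF r(1)] by simp
      finally show "norm (\<psi> r powr (- \<delta>) * z r) \<le> \<psi> r powr (real N - \<delta>) * (\<alpha> powr p * r)" .
    qed (rule assms)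
    have "((\<lambda>r. \<psi> r powr (real N - \<delta>) * (\<alpha> powr p * r)) \<longlongrightarrow> 0 * (\<alpha> powr p * 0)) (at_right 0)"
      using d by (intro tendsto_intros psi_powr_tendsto_0) auto
    then show "((\<lambda>r. \<psi> r powr (real N - \<delta>) * (\<alpha> powr p * r)) \<longlongrightarrow> 0) (at_right 0)" by simp
  qed
  moreover have "((\<lambda>r. \<delta> * \<psi> r powr (real N - \<delta> - 1) * \<psi>' r * u r) \<longlongrightarrow> \<delta> * 0 * 1 * \<alpha>) (at_right 0)"
    using d by (intro tendsto_intros psi_powr_tendsto_0 lims) auto
  ultimately show y: "(momentum u z \<longlongrightarrow> 0) (at_right 0)"
    unfolding momentum_def[abs_def] using tendsto_diff by fastforce
  have "((\<lambda>r. \<delta> * \<psi> r powr (2 * (real N - \<delta> - 1)) * ((\<delta> + 1 - real N) * (\<psi>' r)\<^sup>2 - \<psi>'' r * \<psi> r) * (u r)\<^sup>2)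
      \<longlongrightarrow> \<delta> * 0 * ((\<delta> + 1 - real N) * 1\<^sup>2 - 0 * 0) * \<alpha>\<^sup>2) (at_right 0)"
    using d by (intro tendsto_intros psi_powr_tendsto_0 lims) auto
  then show gv: "((\<lambda>r. G r * (scaled u r)\<^sup>2) \<longlongrightarrow> 0) (at_right 0)"
    unfolding G_scaled by simp
  have "((\<lambda>r. scaled u r powr (p + 1)) \<longlongrightarrow> 0) (at_right 0)"
  proof (rule tendsto_zero_powrI[OF v tendsto_const])
    have "\<forall>\<^sub>F r in at_right 0. 0 < u r" using lims(1) assms(3) by (rule order_tendstoD)
    moreover have "\<forall>\<^sub>F r in at_right (0::real). 0 < r" by (simp add: eventually_at_filter)
    ultimately show "\<forall>\<^sub>F r in at_right 0. 0 \<le> scaled u r"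
      by eventually_elim (simp add: scaled_def)
  qed (use p1 in auto)
  then have "((\<lambda>r. (momentum u z r)\<^sup>2 / 2 + scaled u r powr (p + 1) / (p + 1) + G r * (scaled u r)\<^sup>2 / 2)
     \<longlongrightarrow> 0\<^sup>2 / 2 + 0 / (p + 1) + 0 / 2) (at_right 0)"
    using p1 by (intro tendsto_intros y gv) auto
  then show "(energy u z \<longlongrightarrow> 0) (at_right 0)"
    unfolding energy_def[abs_def] by simp
qed

text \<open>
  The \<open>\<Lambda>\<close>-property seen from a fixed radius, which lies on one side of the turning point of \<open>G\<close>.
\<close>
lemma Lambda_split:
  assumes "0 < r"
  shows "(\<forall>s. 0 < s \<and> s < r \<longrightarrow> 0 \<le> deriv G s) \<or> (\<forall>s>r. deriv G s \<le> 0)"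
proof -
  obtain r1 :: ereal where r1: "\<forall>r>0. ereal r < r1 \<longrightarrow> deriv G r \<ge> 0" "\<forall>r>0. r1 < ereal r \<longrightarrow> deriv G r \<le> 0"
    using Lambda unfolding Lambda_property_def by blast
  show ?thesis
  proof (cases "ereal r \<le> r1")
    case True
    have "0 \<le> deriv G s" if "0 < s" "s < r" for s
      using r1(1) True that by (meson less_ereal.simps(1) order_less_le_trans)
    then show ?thesis by blast
  next
    case False
    have "deriv G s \<le> 0" if "r < s" for s
      using r1(2) False that assms by (meson less_ereal.simps(1) less_trans not_le)
    then show ?thesis by blast
  qed
qed

lemma sol_deriv_interior:
  assumes "sol R \<alpha> u z" "\<And>r. 0 < r \<Longrightarrow> r < R \<Longrightarrow> 0 < u r" "0 < r" "r < R"
  shows "(scaled u has_real_derivative \<psi> r powr (2 * \<delta> - real N) * momentum u z r) (at r)"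
    "(momentum u z has_real_derivative
      - (\<psi> r powr (2 * \<delta> - real N) * (G r * scaled u r + scaled u r powr p))) (at r)"
    "(energy u z has_real_derivative deriv G r * (scaled u r)\<^sup>2 / 2) (at r)"
  using scaled_deriv[where u = u and z = z, OF assms(3) solD(5)[OF assms(1,3,4)]]
    momentum_deriv[where u = u and z = z, OF assms(3) solD(5,6)[OF assms(1,3,4)] assms(2)[OF assms(3,4)]]
    energy_deriv[where u = u and z = z, OF assms(3) solD(5,6)[OF assms(1,3,4)] assms(2)[OF assms(3,4)]]
  by auto

lemma energy_cont:
  assumes "sol R \<alpha> u z" "\<And>r. 0 < r \<Longrightarrow> r < R \<Longrightarrow> 0 < u r" "S \<subseteq> {0<..<R}"
  shows "continuous_on S (energy u z)"
proof (rule DERIV_continuous_on)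
  fix x assume "x \<in> S"
  then show "(energy u z has_real_derivative deriv G x * (scaled u x)\<^sup>2 / 2) (at x within S)"
    using sol_deriv_interior(3)[OF assms(1,2), of x] assms(3) by (auto simp: has_field_derivative_at_within)
qed

text \<open>
  The energy starts from 0 and, by the \<open>\<Lambda>\<close>-property, first increases and then decreases. So at
  each radius it is at least the smaller of 0 and any later value.
\<close>
lemma energy_lower_bound:
  assumes s: "sol R \<alpha> u z" and pos: "\<And>r. 0 < r \<Longrightarrow> r < R \<Longrightarrow> 0 < u r" and "0 < \<alpha>"
    and r: "0 < r" "r \<le> t" "t < R" and e: "0 \<le> e" "- e \<le> energy u z t"
  shows "- e \<le> energy u z r"
proof (rule disjE[OF Lambda_split[OF r(1)]])
  note dE = sol_deriv_interior(3)[OF s pos]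
  assume up: "\<forall>s. 0 < s \<and> s < r \<longrightarrow> 0 \<le> deriv G s"
  have "0 \<le> energy u z r"
  proof (rule limit_le_of_deriv_nonneg[OF energy_terms_tendsto_0(4)[OF s _ assms(3)] r(1)])
    show "0 < R" using r by simp
    show "\<exists>y. (energy u z has_real_derivative y) (at x) \<and> 0 \<le> y" if "0 < x" "x < r" for x
      using dE[of x] up that r by (intro exI conjI) auto
    show "continuous_on {0<..r} (energy u z)"
      by (rule energy_cont[OF s pos]) (use r in auto)
  qed
  then show ?thesis using e by simp
next
  note dE = sol_deriv_interior(3)[OF s pos]
  assume down: "\<forall>s>r. deriv G s \<le> 0"
  have "energy u z t \<le> energy u z r"
  proof (rule DERIV_nonpos_imp_decreasing_open[OF r(2)])
    show "\<exists>y. (energy u z has_real_derivative y) (at x) \<and> y \<le> 0" if "r < x" "x < t" for x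
      using dE[of x] down that r by (intro exI conjI) (auto simp: mult_nonpos_nonneg)
    show "continuous_on {r..t} (energy u z)"
      by (rule energy_cont[OF s pos]) (use r in auto)
  qed
  then show ?thesis using e by simp
qed

text \<open>
  At a zero of \<open>u\<close> only the kinetic part of the energy is left, so the energy is nonnegative there,
  and then at all smaller radii.
\<close>
lemma energy_nonneg_before_zero:
  assumes s: "sol R \<alpha> u z" and pos: "\<And>r. 0 < r \<Longrightarrow> r < R \<Longrightarrow> 0 < u r" and al: "0 < \<alpha>"
    and zero: "u R = 0" and r: "0 < r" "r < R"
  shows "0 \<le> energy u z r"
proof -
  have "(u \<longlongrightarrow> 0) (at_left R)"
  proof -
    have "(u \<longlongrightarrow> u R) (at R within {0..R})"
      using solD(3)[OF s] r by (auto simp: continuous_on_def)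
    then show ?thesis using zero r by (simp add: at_within_Icc_at_left)
  qed
  moreover have "isCont \<psi> R" "isCont G R"
    using psi_has_derivative(1)[of R] G_deriv[of R] r by (auto intro: DERIV_isCont)
  then have "(\<psi> \<longlongrightarrow> \<psi> R) (at_left R)" "(G \<longlongrightarrow> G R) (at_left R)"
    by (auto simp: isCont_def intro: tendsto_within_subset)
  ultimately have lim: "((\<lambda>t. G t * (\<psi> t powr \<delta> * u t)\<^sup>2) \<longlongrightarrow> G R * (\<psi> R powr \<delta> * 0)\<^sup>2) (at_left R)"
    using psi_pos[of R] r by (intro tendsto_intros) auto
  show ?thesis
  proof (rule field_le_epsilon)
    fix e :: real assume e: "0 < e"
    have "\<forall>\<^sub>F t in at_left R. - e < G t * (scaled u t)\<^sup>2"
      using lim e unfolding scaled_def by (intro order_tendstoD) auto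
    moreover have "\<forall>\<^sub>F t in at_left R. r < t \<and> t < R"
      using r eventually_at_left[of r R] by auto
    ultimately have "\<forall>\<^sub>F t in at_left R. - e < G t * (scaled u t)\<^sup>2 \<and> r < t \<and> t < R"
      by eventually_elim auto
    then obtain t where t: "- e < G t * (scaled u t)\<^sup>2" "r < t" "t < R"
      using eventually_happens' trivial_limit_at_left_real by blast
    have "0 \<le> (momentum u z t)\<^sup>2 / 2 + scaled u t powr (p + 1) / (p + 1)" using p1 by simp
    then have "- e \<le> energy u z t" unfolding energy_def using t(1) e by linarith
    then have "- e \<le> energy u z r"
      using energy_lower_bound[OF s pos al r(1), of t e] t e by simp
    then show "0 \<le> energy u z r + e" by simp
  qed
qed

end

section \<open>Comparison of two solutions\<close>

context subcritical_model
begin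

definition wronskian ::
  "(real \<Rightarrow> real) \<Rightarrow> (real \<Rightarrow> real) \<Rightarrow> (real \<Rightarrow> real) \<Rightarrow> (real \<Rightarrow> real) \<Rightarrow> real \<Rightarrow> real" where
  "wronskian u\<^sub>1 z\<^sub>1 u\<^sub>2 z\<^sub>2 r =
     momentum u\<^sub>2 z\<^sub>2 r * scaled u\<^sub>1 r - scaled u\<^sub>2 r * momentum u\<^sub>1 z\<^sub>1 r"

definition excess ::
  "(real \<Rightarrow> real) \<Rightarrow> (real \<Rightarrow> real) \<Rightarrow> (real \<Rightarrow> real) \<Rightarrow> (real \<Rightarrow> real) \<Rightarrow> real \<Rightarrow> real" where
  "excess u\<^sub>1 z\<^sub>1 u\<^sub>2 z\<^sub>2 r = energy u\<^sub>2 z\<^sub>2 r - (u\<^sub>2 r / u\<^sub>1 r)\<^sup>2 * energy u\<^sub>1 z\<^sub>1 r"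

text \<open>
  The comparison principle behind the whole classification. Let \<open>q = v\<^sub>2 / v\<^sub>1 = u\<^sub>2 / u\<^sub>1\<close> and
  \<open>X = E\<^sub>2 - q\<^sup>2 E\<^sub>1\<close>. The derivative of \<open>G\<close> cancels in \<open>X' = - 2 q q' E\<^sub>1\<close>, so \<open>X\<close> increases while
  \<open>q\<close> decreases. At a first critical point of \<open>q\<close> only the nonlinear terms survive in \<open>X\<close>, and
  \<open>X \<ge> 0\<close> forces \<open>q \<ge> 1\<close> there; but as long as \<open>q > 1\<close> the Wronskian of \<open>v\<^sub>1, v\<^sub>2\<close> is strictly
  decreasing from 0, which excludes the critical point.
\<close>
context
  fixes R \<alpha> \<beta> u\<^sub>1 z\<^sub>1 u\<^sub>2 z\<^sub>2
  assumes s1: "sol R \<alpha> u\<^sub>1 z\<^sub>1" and s2: "sol R \<beta> u\<^sub>2 z\<^sub>2"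
    and ab: "0 < \<alpha>" "\<alpha> < \<beta>"
    and pos1: "\<And>r. 0 < r \<Longrightarrow> r < R \<Longrightarrow> 0 < u\<^sub>1 r"
    and pos2: "\<And>r. 0 < r \<Longrightarrow> r < R \<Longrightarrow> 0 < u\<^sub>2 r"
    and E1: "\<And>r. 0 < r \<Longrightarrow> r < R \<Longrightarrow> 0 \<le> energy u\<^sub>1 z\<^sub>1 r"
begin

abbreviation wr :: "real \<Rightarrow> real" where "wr \<equiv> wronskian u\<^sub>1 z\<^sub>1 u\<^sub>2 z\<^sub>2"

abbreviation exc :: "real \<Rightarrow> real" where "exc \<equiv> excess u\<^sub>1 z\<^sub>1 u\<^sub>2 z\<^sub>2"

lemma ratio_scaled: "0 < r \<Longrightarrow> u\<^sub>2 r / u\<^sub>1 r = scaled u\<^sub>2 r / scaled u\<^sub>1 r"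
  using psi_pos[of r] by (simp add: scaled_def)

lemma wronskian_deriv:
  assumes r: "0 < r" "r < R"
  shows "(wr has_real_derivative \<psi> r powr (2 * \<delta> - real N) *
      (scaled u\<^sub>2 r * scaled u\<^sub>1 r powr p - scaled u\<^sub>2 r powr p * scaled u\<^sub>1 r)) (at r)"
proof -
  note d = sol_deriv_interior[OF s1 pos1 r] sol_deriv_interior[OF s2 pos2 r]
  show ?thesis
    using DERIV_diff[OF DERIV_mult[OF d(5) d(1)] DERIV_mult[OF d(4) d(2)]]
    unfolding wronskian_def[abs_def] by (simp add: algebra_simps)
qed

lemma ratio_deriv:
  assumes r: "0 < r" "r < R"
  shows "((\<lambda>r. u\<^sub>2 r / u\<^sub>1 r) has_real_derivative
      \<psi> r powr (2 * \<delta> - real N) * wr r / (scaled u\<^sub>1 r)\<^sup>2) (at r)"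
proof (rule has_field_derivative_transform_within_open[where S = "{0<..}"])
  note d = sol_deriv_interior[OF s1 pos1 r] sol_deriv_interior[OF s2 pos2 r]
  have "scaled u\<^sub>1 r \<noteq> 0" using scaled_pos[OF r(1), of u\<^sub>1] pos1[OF r] by simp
  then show "((\<lambda>r. scaled u\<^sub>2 r / scaled u\<^sub>1 r) has_real_derivative
      \<psi> r powr (2 * \<delta> - real N) * wr r / (scaled u\<^sub>1 r)\<^sup>2) (at r)"
    using DERIV_divide[OF d(4) d(1)] unfolding wronskian_def
    by (simp add: power2_eq_square algebra_simps)
qed (use r ratio_scaled in auto)

lemma excess_deriv:
  assumes r: "0 < r" "r < R"
  shows "(exc has_real_derivative
      - 2 * (u\<^sub>2 r / u\<^sub>1 r) * (\<psi> r powr (2 * \<delta> - real N) * wr r / (scaled u\<^sub>1 r)\<^sup>2) * energy u\<^sub>1 z\<^sub>1 r) (at r)"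
proof -
  note d = sol_deriv_interior(3)[OF s1 pos1 r] sol_deriv_interior(3)[OF s2 pos2 r]
  define q q' where "q = u\<^sub>2 r / u\<^sub>1 r" and "q' = \<psi> r powr (2 * \<delta> - real N) * wr r / (scaled u\<^sub>1 r)\<^sup>2"
  have "((\<lambda>r. (u\<^sub>2 r / u\<^sub>1 r)\<^sup>2) has_real_derivative 2 * q * q') (at r)"
    using DERIV_power[OF ratio_deriv[OF r], of 2] unfolding q_def q'_def by (simp add: mult_ac)
  note D = DERIV_diff[OF d(2) DERIV_mult[OF this d(1)]]
  have qq: "q\<^sup>2 * (scaled u\<^sub>1 r)\<^sup>2 = (scaled u\<^sub>2 r)\<^sup>2"
    using scaled_pos[OF r(1), of u\<^sub>1] pos1[OF r] unfolding q_def ratio_scaled[OF r(1)]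
    by (simp add: power_divide)
  have e: "deriv G r * (scaled u\<^sub>2 r)\<^sup>2 / 2 - (2 * q * q' * energy u\<^sub>1 z\<^sub>1 r + deriv G r * (scaled u\<^sub>1 r)\<^sup>2 / 2 * q\<^sup>2)
      = - 2 * q * q' * energy u\<^sub>1 z\<^sub>1 r"
    by (simp add: qq[symmetric])
  show ?thesis
    using D unfolding excess_def[abs_def] q_def[symmetric] q'_def[symmetric] e .
qed

lemma ratio_tendsto: "0 < R \<Longrightarrow> ((\<lambda>r. u\<^sub>2 r / u\<^sub>1 r) \<longlongrightarrow> \<beta> / \<alpha>) (at_right 0)"
  using sol_tendsto_0(1)[OF s1] sol_tendsto_0(1)[OF s2] ab by (intro tendsto_divide) auto

lemma excess_tendsto:
  assumes "0 < R"
  shows "(exc \<longlongrightarrow> 0) (at_right 0)"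
proof -
  have "(exc \<longlongrightarrow> 0 - (\<beta> / \<alpha>)\<^sup>2 * 0) (at_right 0)"
    unfolding excess_def[abs_def]
    by (intro tendsto_intros ratio_tendsto energy_terms_tendsto_0(4)[OF s1] energy_terms_tendsto_0(4)[OF s2])
       (use assms ab in auto)
  then show ?thesis by simp
qed

lemma wronskian_tendsto:
  assumes "0 < R"
  shows "(wr \<longlongrightarrow> 0) (at_right 0)"
proof -
  have "(wr \<longlongrightarrow> 0 * 0 - 0 * 0) (at_right 0)"
    unfolding wronskian_def[abs_def]
    by (intro tendsto_intros energy_terms_tendsto_0[OF s1] energy_terms_tendsto_0[OF s2])
       (use assms ab in auto)
  then show ?thesis by simp
qed

lemma wronskian_cont:
  assumes "S \<subseteq> {0<..<R}"
  shows "continuous_on S wr" "continuous_on S (\<lambda>r. u\<^sub>2 r / u\<^sub>1 r)" "continuous_on S exc"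
proof -
  have *: "continuous_on S f" if "\<And>r. 0 < r \<Longrightarrow> r < R \<Longrightarrow> \<exists>D. (f has_real_derivative D) (at r)" for f :: "real \<Rightarrow> real"
  proof (rule continuous_at_imp_continuous_on, rule ballI)
    fix x assume "x \<in> S"
    then have "0 < x" "x < R" using assms by auto
    then show "isCont f x" using that[of x] DERIV_isCont by blast
  qed
  show "continuous_on S wr" "continuous_on S (\<lambda>r. u\<^sub>2 r / u\<^sub>1 r)" "continuous_on S exc"
    by (rule *; use wronskian_deriv ratio_deriv excess_deriv in blast)+
qed

lemma wronskian_neg_while_above:
  assumes r: "0 < r" "r < R" and above: "\<And>s. 0 < s \<Longrightarrow> s < r \<Longrightarrow> u\<^sub>1 s < u\<^sub>2 s"
  shows "wr r < 0"
proof -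
  have neg: "\<psi> x powr (2 * \<delta> - real N) *
      (scaled u\<^sub>2 x * scaled u\<^sub>1 x powr p - scaled u\<^sub>2 x powr p * scaled u\<^sub>1 x) < 0"
    if x: "0 < x" "x < r" for x
  proof -
    have P: "0 < \<psi> x" using psi_pos x by simp
    have v: "0 < scaled u\<^sub>1 x" "scaled u\<^sub>1 x < scaled u\<^sub>2 x"
      using scaled_pos[of x u\<^sub>1] pos1[of x] above[OF x] x r P by (auto simp: scaled_def)
    then have "scaled u\<^sub>1 x powr (p - 1) < scaled u\<^sub>2 x powr (p - 1)"
      using p1 by (intro powr_less_mono2) auto
    then have "scaled u\<^sub>2 x * (scaled u\<^sub>1 x * scaled u\<^sub>1 x powr (p - 1)) < scaled u\<^sub>2 x * (scaled u\<^sub>1 x * scaled u\<^sub>2 x powr (p - 1))"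
      using v by simp
    moreover have "scaled u\<^sub>1 x * scaled u\<^sub>1 x powr (p - 1) = scaled u\<^sub>1 x powr p"
      "scaled u\<^sub>2 x * scaled u\<^sub>2 x powr (p - 1) = scaled u\<^sub>2 x powr p"
      using v by (simp_all add: powr_mult_base)
    ultimately have "scaled u\<^sub>2 x * scaled u\<^sub>1 x powr p - scaled u\<^sub>2 x powr p * scaled u\<^sub>1 x < 0"
      by (simp add: mult_ac mult.left_commute)
    then show ?thesis using P by (simp add: mult_pos_neg)
  qed
  define h where "h = r / 2"
  have h: "0 < h" "h < r" using r by (auto simp: h_def)
  have "0 \<le> - wr h"
  proof (rule limit_le_of_deriv_nonneg[OF _ h(1)])
    show "((\<lambda>r. - wr r) \<longlongrightarrow> 0) (at_right 0)"
      using tendsto_minus[OF wronskian_tendsto] r by simp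
    show "\<exists>y. ((\<lambda>r. - wr r) has_real_derivative y) (at x) \<and> 0 \<le> y" if "0 < x" "x < h" for x
      using DERIV_minus[OF wronskian_deriv[of x]] neg[of x] that h r
      by (intro exI conjI) (assumption | auto intro: less_imp_le)+
    show "continuous_on {0<..h} (\<lambda>r. - wr r)"
      by (intro continuous_on_minus wronskian_cont(1)) (use h r in auto)
  qed
  moreover have "wr r < wr h"
  proof (rule DERIV_neg_imp_decreasing_open[OF h(2)])
    show "\<exists>y. (wr has_real_derivative y) (at x) \<and> y < 0" if "h < x" "x < r" for x
      using wronskian_deriv[of x] neg[of x] that h r by (intro exI conjI) auto
    show "continuous_on {h..r} wr"
      by (rule wronskian_cont(1)) (use h r in auto)
  qed
  ultimately show ?thesis by simp
qed

lemma excess_nonneg: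
  assumes r: "0 < r" "r < R" and m: "\<And>s. 0 < s \<Longrightarrow> s < r \<Longrightarrow> wr s < 0"
  shows "0 \<le> exc r"
proof (rule limit_le_of_deriv_nonneg[OF excess_tendsto r(1)])
  show "0 < R" using r by simp
  show "\<exists>y. (exc has_real_derivative y) (at x) \<and> 0 \<le> y" if x: "0 < x" "x < r" for x
  proof (intro exI conjI)
    show "(exc has_real_derivative - 2 * (u\<^sub>2 x / u\<^sub>1 x) *
      (\<psi> x powr (2 * \<delta> - real N) * wr x / (scaled u\<^sub>1 x)\<^sup>2) * energy u\<^sub>1 z\<^sub>1 x) (at x)"
      using excess_deriv[of x] x r by simp
    have "0 \<le> 2 * (u\<^sub>2 x / u\<^sub>1 x) *
      (\<psi> x powr (2 * \<delta> - real N) * (- wr x) / (scaled u\<^sub>1 x)\<^sup>2) * energy u\<^sub>1 z\<^sub>1 x"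
      by (intro mult_nonneg_nonneg divide_nonneg_nonneg)
         (use m[OF x] E1[of x] pos1[of x] pos2[of x] x r in auto)
    then show "0 \<le> - 2 * (u\<^sub>2 x / u\<^sub>1 x) *
      (\<psi> x powr (2 * \<delta> - real N) * wr x / (scaled u\<^sub>1 x)\<^sup>2) * energy u\<^sub>1 z\<^sub>1 x" by simp
  qed
  show "continuous_on {0<..r} exc" by (rule wronskian_cont(3)) (use r in auto)
qed

lemma wronskian_neg:
  assumes r: "0 < r" "r < R"
  shows "wr r < 0"
proof (rule ccontr)
  assume neg: "\<not> wr r < 0"
  have R0: "0 < R" using r by simp
  have "((\<lambda>s. u\<^sub>2 s - u\<^sub>1 s) \<longlongrightarrow> \<beta> - \<alpha>) (at_right 0)"
    using sol_tendsto_0(1)[OF s1 R0] sol_tendsto_0(1)[OF s2 R0] by (rule tendsto_diff[rotated])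
  then have "\<forall>\<^sub>F s in at_right 0. 0 < u\<^sub>2 s - u\<^sub>1 s" by (rule order_tendstoD(1)) (use ab in simp)
  then obtain d where d: "0 < d" "\<And>s. 0 < s \<Longrightarrow> s < d \<Longrightarrow> u\<^sub>1 s < u\<^sub>2 s"
    unfolding eventually_at by (auto simp: dist_real_def)
  define a where "a = min d r"
  have a: "0 < a" "a \<le> r" "a \<le> d" using d r by (auto simp: a_def)
  have early: "wr s < 0" if "0 < s" "s \<le> a" for s
    using that a r d by (intro wronskian_neg_while_above) auto
  have "continuous_on {a..r} (\<lambda>s. - wr s)"
    by (intro continuous_on_minus wronskian_cont(1)) (use a r in auto)
  moreover have "0 < - wr a" "- wr r \<le> 0" using early[of a] a neg by auto
  ultimately obtain c where c: "a < c" "c \<le> r" "- wr c = 0"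
      "\<And>s. a \<le> s \<Longrightarrow> s < c \<Longrightarrow> 0 < - wr s"
    using first_zero[of a r "\<lambda>s. - wr s"] a by metis
  have c0: "0 < c" "c < R" using a c r by auto
  have before: "wr s < 0" if "0 < s" "s < c" for s
    using early[of s] c(4)[of s] that by linarith
  have v1: "0 < scaled u\<^sub>1 c" and v2: "0 < scaled u\<^sub>2 c"
    using scaled_pos[OF c0(1), of u\<^sub>1] scaled_pos[OF c0(1), of u\<^sub>2] pos1 pos2 c0 by auto
  define q where "q = u\<^sub>2 c / u\<^sub>1 c"
  have q0: "0 < q" using pos1[OF c0] pos2[OF c0] by (simp add: q_def)
  have q: "q = scaled u\<^sub>2 c / scaled u\<^sub>1 c" unfolding q_def by (rule ratio_scaled[OF c0(1)])
  then have v2q: "scaled u\<^sub>2 c = q * scaled u\<^sub>1 c" using v1 by simp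
  have yq: "momentum u\<^sub>2 z\<^sub>2 c = q * momentum u\<^sub>1 z\<^sub>1 c"
    using c(3) v1 unfolding wronskian_def v2q by simp
  have "exc c = (q powr (p + 1) - q\<^sup>2) * (scaled u\<^sub>1 c powr (p + 1) / (p + 1))"
    unfolding excess_def energy_def q_def[symmetric] v2q yq
    using v1 q0 by (simp add: powr_mult power_mult_distrib algebra_simps add_divide_distrib diff_divide_distrib)
  moreover have "0 \<le> exc c" by (rule excess_nonneg[OF c0 before])
  moreover have "0 < scaled u\<^sub>1 c powr (p + 1) / (p + 1)" using v1 p1 by simp
  ultimately have "0 \<le> q powr (p + 1) - q\<^sup>2"
    by (metis zero_le_mult_iff not_less)
  then have qq: "q powr 2 \<le> q powr (p + 1)" using q0 by (simp add: powr_numeral)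
  have "1 \<le> q"
  proof (rule ccontr)
    assume "\<not> 1 \<le> q"
    then have "q powr (p + 1) < q powr 2" using q0 p1 by (intro powr_less_mono') auto
    then show False using qq by simp
  qed
  have "u\<^sub>1 s < u\<^sub>2 s" if s: "0 < s" "s < c" for s
  proof -
    have "u\<^sub>2 c / u\<^sub>1 c < u\<^sub>2 s / u\<^sub>1 s"
    proof (rule DERIV_neg_imp_decreasing_open[OF s(2)])
      show "continuous_on {s..c} (\<lambda>r. u\<^sub>2 r / u\<^sub>1 r)"
        by (rule wronskian_cont(2)) (use s c0 in auto)
      show "\<exists>y. ((\<lambda>r. u\<^sub>2 r / u\<^sub>1 r) has_real_derivative y) (at x) \<and> y < 0" if "s < x" "x < c" for x
      proof (intro exI conjI)
        show "((\<lambda>r. u\<^sub>2 r / u\<^sub>1 r) has_real_derivative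
            \<psi> x powr (2 * \<delta> - real N) * wr x / (scaled u\<^sub>1 x)\<^sup>2) (at x)"
          using ratio_deriv[of x] that s c0 by simp
        show "\<psi> x powr (2 * \<delta> - real N) * wr x / (scaled u\<^sub>1 x)\<^sup>2 < 0"
          by (intro divide_neg_pos mult_pos_neg)
             (use before[of x] that s c0 scaled_pos[of x u\<^sub>1] pos1[of x] psi_pos[of x] in auto)
      qed
    qed
    then have "1 < u\<^sub>2 s / u\<^sub>1 s" using \<open>1 \<le> q\<close> by (simp add: q_def)
    then show ?thesis using pos1[of s] s c0 by simp
  qed
  then have "wr c < 0" by (rule wronskian_neg_while_above[OF c0])
  then show False using c(3) by simp
qed

lemma ratio_bound:
  assumes r: "0 \<le> r" "r < R"
  shows "u\<^sub>2 r \<le> \<beta> / \<alpha> * u\<^sub>1 r"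
proof (cases "r = 0")
  case True
  then show ?thesis using solD(1)[OF s1] solD(1)[OF s2] ab by simp
next
  case False
  then have r0: "0 < r" using r by simp
  have "- (\<beta> / \<alpha>) \<le> - (u\<^sub>2 r / u\<^sub>1 r)"
  proof (rule limit_le_of_deriv_nonneg[OF tendsto_minus[OF ratio_tendsto] r0])
    show "0 < R" using r by simp
    show "\<exists>y. ((\<lambda>r. - (u\<^sub>2 r / u\<^sub>1 r)) has_real_derivative y) (at x) \<and> 0 \<le> y" if "0 < x" "x < r" for x
    proof (intro exI conjI)
      show "((\<lambda>r. - (u\<^sub>2 r / u\<^sub>1 r)) has_real_derivative
         - (\<psi> x powr (2 * \<delta> - real N) * wr x / (scaled u\<^sub>1 x)\<^sup>2)) (at x)"
        using that r by (intro DERIV_minus ratio_deriv) auto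
      show "0 \<le> - (\<psi> x powr (2 * \<delta> - real N) * wr x / (scaled u\<^sub>1 x)\<^sup>2)"
        using wronskian_neg[of x] that r by (simp add: mult_nonneg_nonpos divide_nonpos_nonneg)
    qed
    show "continuous_on {0<..r} (\<lambda>r. - (u\<^sub>2 r / u\<^sub>1 r))"
      by (intro continuous_on_minus wronskian_cont(2)) (use r in auto)
  qed
  then show ?thesis using pos1[of r] r0 r by (simp add: pos_divide_le_eq)
qed

end

text \<open>
  A solution with a larger initial value is bounded by a multiple of a vanishing one up to the zero
  of the latter, so it cannot be positive there.
\<close>
lemma zero_propagates:
  assumes ab: "0 < \<alpha>" "\<alpha> < \<beta>" and zero: "0 \<le> R" "usol \<alpha> R \<le> 0"
  shows "\<exists>r\<ge>0. usol \<beta> r \<le> 0"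
proof (rule ccontr)
  assume "\<not> ?thesis"
  then have pos2: "\<And>r. 0 \<le> r \<Longrightarrow> 0 < usol \<beta> r" by (meson not_le)
  obtain c where c: "0 < c" "usol \<alpha> c = 0" "\<And>s. 0 \<le> s \<Longrightarrow> s < c \<Longrightarrow> 0 < usol \<alpha> s"
    using first_zero[of 0 R "usol \<alpha>"] continuous_on_subset[OF usol_cont[OF ab(1)], of "{0..R}"]
      usol_0[OF ab(1)] zero ab(1) by auto
  have b: "0 < \<beta>" using ab by simp
  have le: "usol \<beta> r \<le> \<beta> / \<alpha> * usol \<alpha> r" if "0 \<le> r" "r < c" for r
  proof (rule ratio_bound[OF sol_usol[OF ab(1)] sol_usol[OF b] ab])
    show "0 \<le> energy (usol \<alpha>) (zsol \<alpha>) s" if "0 < s" "s < c" for s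
      using energy_nonneg_before_zero[OF sol_usol[OF ab(1)] _ ab(1) c(2) that] c(3) by simp
  qed (use that c pos2 in auto)
  have lim: "(usol \<gamma> \<longlongrightarrow> usol \<gamma> c) (at_left c)" if "0 < \<gamma>" for \<gamma>
    using DERIV_isCont[OF usol_has_derivative(1)[OF that c(1)]]
    by (auto simp: isCont_def intro: tendsto_within_subset)
  have "usol \<beta> c \<le> \<beta> / \<alpha> * usol \<alpha> c"
  proof (rule tendsto_le[OF _ _ lim[OF b]])
    show "((\<lambda>r. \<beta> / \<alpha> * usol \<alpha> r) \<longlongrightarrow> \<beta> / \<alpha> * usol \<alpha> c) (at_left c)"
      by (intro tendsto_intros lim ab)
    show "\<forall>\<^sub>F r in at_left c. usol \<beta> r \<le> \<beta> / \<alpha> * usol \<alpha> r"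
      using eventually_at_left[OF c(1)] le c(1) by (auto intro!: exI[of _ 0])
  qed simp
  then show False using pos2[of c] c by simp
qed

lemma energy_nonneg_of_vanishing:
  assumes al: "0 < \<alpha>" and pos: "\<And>r. 0 \<le> r \<Longrightarrow> 0 < usol \<alpha> r"
    and lim: "(energy (usol \<alpha>) (zsol \<alpha>) \<longlongrightarrow> 0) at_top" and r: "0 < r"
  shows "0 \<le> energy (usol \<alpha>) (zsol \<alpha>) r"
proof (rule field_le_epsilon)
  fix e :: real assume e: "0 < e"
  have "\<forall>\<^sub>F t in at_top. - e < energy (usol \<alpha>) (zsol \<alpha>) t"
    using lim e by (intro order_tendstoD) auto
  then have "\<forall>\<^sub>F t in at_top. - e < energy (usol \<alpha>) (zsol \<alpha>) t \<and> r \<le> t"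
    using eventually_ge_at_top[of r] by eventually_elim auto
  then obtain t where t: "- e < energy (usol \<alpha>) (zsol \<alpha>) t" "r \<le> t"
    using eventually_happens' trivial_limit_at_top_linorder by blast
  have "- e \<le> energy (usol \<alpha>) (zsol \<alpha>) r"
    by (rule energy_lower_bound[OF sol_usol[OF al, of "t + 1"] _ al r t(2)]) (use e t pos in auto)
  then show "0 \<le> energy (usol \<alpha>) (zsol \<alpha>) r + e" by simp
qed

text \<open>
  If the energies of two positive solutions vanish at infinity, then \<open>X\<close> is monotone and vanishes
  at both ends. So it is constant, hence \<open>E\<^sub>1\<close> vanishes identically, hence so does the derivative of
  \<open>G\<close>.
\<close>
lemma vanishing_energy_unique:
  assumes ab: "0 < \<alpha>" "\<alpha> < \<beta>"
    and pos1: "\<And>r. 0 \<le> r \<Longrightarrow> 0 < usol \<alpha> r" and pos2: "\<And>r. 0 \<le> r \<Longrightarrow> 0 < usol \<beta> r"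
    and lim1: "(energy (usol \<alpha>) (zsol \<alpha>) \<longlongrightarrow> 0) at_top"
    and lim2: "(energy (usol \<beta>) (zsol \<beta>) \<longlongrightarrow> 0) at_top"
  shows False
proof -
  have b: "0 < \<beta>" using ab by simp
  let ?E = "energy (usol \<alpha>) (zsol \<alpha>)"
  let ?m = "wronskian (usol \<alpha>) (zsol \<alpha>) (usol \<beta>) (zsol \<beta>)"
  let ?X = "excess (usol \<alpha>) (zsol \<alpha>) (usol \<beta>) (zsol \<beta>)"
  note E0 = energy_nonneg_of_vanishing[OF ab(1) pos1 lim1]
  note S = sol_usol[OF ab(1)] sol_usol[OF b] ab
  have m: "?m r < 0" if "0 < r" for r
    by (rule wronskian_neg[OF S, of "r + 1"]) (use that pos1 pos2 E0 in auto)
  have X0: "0 \<le> ?X r" if "0 < r" for r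
    by (rule excess_nonneg[OF S, of "r + 1"]) (use that pos1 pos2 E0 m in auto)
  define D where "D r = - 2 * (usol \<beta> r / usol \<alpha> r) *
      (\<psi> r powr (2 * \<delta> - real N) * ?m r / (scaled (usol \<alpha>) r)\<^sup>2) * ?E r" for r
  have dX: "(?X has_real_derivative D r) (at r)" if "0 < r" for r
    unfolding D_def
    by (rule excess_deriv[OF S, of "r + 1"]) (use that pos1 pos2 E0 in auto)
  have D0: "0 \<le> D r" if "0 < r" for r
  proof -
    have "0 \<le> 2 * (usol \<beta> r / usol \<alpha> r) *
      (\<psi> r powr (2 * \<delta> - real N) * (- ?m r) / (scaled (usol \<alpha>) r)\<^sup>2) * ?E r"
      by (intro mult_nonneg_nonneg divide_nonneg_nonneg)
         (use m[OF that] E0[of r] pos1[of r] pos2[of r] that in auto)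
    then show ?thesis by (simp add: D_def)
  qed
  have Xmono: "?X r \<le> ?X t" if "0 < r" "r \<le> t" for r t
    proof (rule DERIV_nonneg_imp_nondecreasing[OF that(2)])
    fix x assume "r \<le> x" "x \<le> t"
    then show "\<exists>y. (?X has_real_derivative y) (at x) \<and> 0 \<le> y" using dX[of x] D0[of x] that by auto
  qed
  have qb: "0 \<le> usol \<beta> r / usol \<alpha> r \<and> usol \<beta> r / usol \<alpha> r \<le> \<beta> / \<alpha>" if "0 < r" for r
  proof -
    have "usol \<beta> r \<le> \<beta> / \<alpha> * usol \<alpha> r"
      by (rule ratio_bound[OF S, of "r + 1"]) (use that pos1 pos2 E0 in auto)
    then show ?thesis using pos1[of r] pos2[of r] that by (simp add: pos_divide_le_eq)
  qed
  have "((\<lambda>r. (usol \<beta> r / usol \<alpha> r)\<^sup>2 * ?E r) \<longlongrightarrow> 0) at_top"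
  proof (rule Lim_null_comparison)
    show "\<forall>\<^sub>F r in at_top. norm ((usol \<beta> r / usol \<alpha> r)\<^sup>2 * ?E r) \<le> (\<beta> / \<alpha>)\<^sup>2 * \<bar>?E r\<bar>"
      using eventually_gt_at_top[of 0]
    proof eventually_elim
      case (elim r)
      then show ?case using qb[OF elim] by (simp add: abs_mult mult_right_mono power_mono del: power_divide)
    qed
    show "((\<lambda>r. (\<beta> / \<alpha>)\<^sup>2 * \<bar>?E r\<bar>) \<longlongrightarrow> 0) at_top"
      using tendsto_mult_right_zero[OF tendsto_rabs_zero[OF lim1]] .
  qed
  then have Xlim: "(?X \<longlongrightarrow> 0) at_top"
    using tendsto_diff[OF lim2] by (fastforce simp: excess_def[abs_def])
  have Xz: "?X r = 0" if "0 < r" for r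
  proof (rule antisym)
    have "\<forall>\<^sub>F t in at_top. ?X r \<le> ?X t"
      using eventually_ge_at_top[of r] by eventually_elim (rule Xmono[OF that])
    then show "?X r \<le> 0" by (rule tendsto_lowerbound[OF Xlim]) simp
  qed (rule X0[OF that])
  have deriv_zero: "F' = 0" if "\<And>r. 0 < r \<Longrightarrow> F r = 0" "(F has_real_derivative F') (at r)" "0 < r"
    for F :: "real \<Rightarrow> real" and F' r
  proof -
    have "((\<lambda>_. 0) has_real_derivative F') (at r)"
      by (rule has_field_derivative_transform_within_open[OF that(2), of "{0<..}"]) (use that in auto)
    then show ?thesis using DERIV_unique DERIV_const by blast
  qed
  have Ez: "?E r = 0" if "0 < r" for r
  proof -
    have "D r = 0" by (rule deriv_zero[OF Xz dX[OF that] that])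
    then show ?thesis
      using pos1[of r] pos2[of r] m[OF that] psi_pos[OF that] scaled_pos[OF that, of "usol \<alpha>"] that
      by (auto simp: D_def)
  qed
  have "deriv G r = 0" if "0 < r" for r
  proof -
    have "deriv G r * (scaled (usol \<alpha>) r)\<^sup>2 / 2 = 0"
      by (rule deriv_zero[OF Ez _ that], assumption)
         (rule sol_deriv_interior(3)[OF sol_usol[OF ab(1), of "r + 1"]]; use that pos1 in simp)
    then show ?thesis using scaled_pos[OF that, of "usol \<alpha>"] pos1[of r] that by simp
  qed
  then show False using Lambda by (auto simp: Lambda_property_def)
qed

end

section \<open>Solutions with large initial values\<close>

context subcritical_model
begin

lemma psi_bounds_near_0:
  "\<exists>d>0. \<forall>r. 0 < r \<and> r < d \<longrightarrow> r / 2 \<le> \<psi> r \<and> \<psi> r \<le> 2 * r"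
proof -
  have "((\<lambda>r. (\<psi> r - \<psi> 0) / (r - 0)) \<longlongrightarrow> 1) (at 0 within {0..})"
    using psi_deriv[of 0] psi_0 by (simp add: has_field_derivative_iff)
  then have lim: "((\<lambda>r. \<psi> r / r) \<longlongrightarrow> 1) (at_right 0)"
    using psi_0 by (auto intro: tendsto_within_subset)
  have "\<forall>\<^sub>F r in at_right 0. 1/2 < \<psi> r / r" "\<forall>\<^sub>F r in at_right 0. \<psi> r / r < 2"
    by (rule order_tendstoD[OF lim]; simp)+
  then have "\<forall>\<^sub>F r in at_right 0. 1/2 < \<psi> r / r \<and> \<psi> r / r < 2" by (rule eventually_conj)
  then obtain d where d: "d > 0" "\<And>r. 0 < r \<Longrightarrow> r < d \<Longrightarrow> 1/2 < \<psi> r / r \<and> \<psi> r / r < 2"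
    unfolding eventually_at by (auto simp: dist_real_def)
  have "r / 2 \<le> \<psi> r \<and> \<psi> r \<le> 2 * r" if "0 < r" "r < d" for r
    using d(2)[OF that] that by (simp add: field_simps)
  then show ?thesis using d(1) by blast
qed

lemma G_bounds_near_0:
  "\<exists>d>0. \<exists>a>0. \<exists>b\<ge>a. \<forall>r. 0 < r \<and> r < d \<longrightarrow>
     - b * r powr - (2 - \<delta> * (p - 1)) \<le> G r \<and> G r \<le> - a * r powr - (2 - \<delta> * (p - 1))
     \<and> r / 2 \<le> \<psi> r"
proof -
  define \<sigma> where "\<sigma> = 2 - \<delta> * (p - 1)"
  define m where "m = real N - 1 - \<delta>"
  have sg: "0 < \<sigma>" using sigma_pos by (simp add: \<sigma>_def)
  have m: "0 < m" using delta_bounds by (simp add: m_def)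
  define br where "br r = (\<delta> + 1 - real N) * (\<psi>' r)\<^sup>2 - \<psi>'' r * \<psi> r" for r
  have "(br \<longlongrightarrow> (\<delta> + 1 - real N) * 1\<^sup>2 - 0 * 0) (at_right 0)"
    unfolding br_def[abs_def] by (intro tendsto_intros psi_tendsto_0)
  moreover have "(\<delta> + 1 - real N) * 1\<^sup>2 - 0 * 0 = - m" by (simp add: m_def)
  ultimately have lim: "(br \<longlongrightarrow> - m) (at_right 0)" by metis
  have "\<forall>\<^sub>F r in at_right 0. - (2 * m) < br r" "\<forall>\<^sub>F r in at_right 0. br r < - (m / 2)"
    by (rule order_tendstoD[OF lim]; use m in simp)+
  then have "\<forall>\<^sub>F r in at_right 0. - (2 * m) < br r \<and> br r < - (m / 2)" by (rule eventually_conj)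
  then obtain d1 where d1: "d1 > 0" "\<And>r. 0 < r \<Longrightarrow> r < d1 \<Longrightarrow> - (2 * m) < br r \<and> br r < - (m / 2)"
    unfolding eventually_at by (auto simp: dist_real_def)
  obtain d2 where d2: "d2 > 0" "\<And>r. 0 < r \<and> r < d2 \<Longrightarrow> r / 2 \<le> \<psi> r \<and> \<psi> r \<le> 2 * r"
    using psi_bounds_near_0 by blast
  define a where "a = \<delta> * (m / 2) * 2 powr - \<sigma>"
  define b where "b = \<delta> * (2 * m) * (1/2) powr - \<sigma>"
  have a0: "0 < a" using delta_bounds(4) m by (simp add: a_def)
  have "2 powr - \<sigma> \<le> (1/2) powr - \<sigma>" using sg by (intro powr_mono2') auto
  then have ab: "a \<le> b"
    unfolding a_def b_def using delta_bounds(4) m by (intro mult_mono) auto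
  have "- b * r powr - \<sigma> \<le> G r \<and> G r \<le> - a * r powr - \<sigma> \<and> r / 2 \<le> \<psi> r"
    if r: "0 < r" "r < min d1 d2" for r
  proof -
    have P: "r / 2 \<le> \<psi> r" "\<psi> r \<le> 2 * r" using d2(2)[of r] r by auto
    have B: "- (2 * m) < br r" "br r < - (m / 2)" using d1(2)[of r] r by auto
    have G: "G r = \<delta> * \<psi> r powr - \<sigma> * br r" by (simp add: G_def \<sigma>_def br_def)
    have lo: "(2 * r) powr - \<sigma> \<le> \<psi> r powr - \<sigma>" and hi: "\<psi> r powr - \<sigma> \<le> (r / 2) powr - \<sigma>"
      using P r sg psi_pos[of r] by (auto intro!: powr_mono2')
    have "\<delta> * (\<psi> r powr - \<sigma>) * (m / 2) \<le> \<delta> * (\<psi> r powr - \<sigma>) * (- br r)"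
      using B delta_bounds(4) by (intro mult_left_mono) auto
    moreover have "\<delta> * ((2 * r) powr - \<sigma>) * (m / 2) \<le> \<delta> * (\<psi> r powr - \<sigma>) * (m / 2)"
      using lo m delta_bounds(4) by (intro mult_right_mono mult_left_mono) auto
    moreover have "a * r powr - \<sigma> = \<delta> * ((2 * r) powr - \<sigma>) * (m / 2)"
      using r by (simp add: a_def powr_mult)
    ultimately have 1: "G r \<le> - a * r powr - \<sigma>" using G by simp
    have "\<delta> * (\<psi> r powr - \<sigma>) * (- br r) \<le> \<delta> * ((r / 2) powr - \<sigma>) * (2 * m)"
      using B m hi delta_bounds(4) by (intro mult_mono mult_left_mono mult_nonneg_nonneg) auto
    moreover have "b * r powr - \<sigma> = \<delta> * ((r / 2) powr - \<sigma>) * (2 * m)"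
      using r powr_mult[of "1/2" r "- \<sigma>"] by (simp add: b_def)
    ultimately have "- b * r powr - \<sigma> \<le> G r" using G by simp
    then show ?thesis using 1 P by simp
  qed
  then have "\<forall>r. 0 < r \<and> r < min d1 d2 \<longrightarrow> - b * r powr - \<sigma> \<le> G r \<and> G r \<le> - a * r powr - \<sigma> \<and> r / 2 \<le> \<psi> r"
    by blast
  moreover have "0 < min d1 d2" using d1 d2 by simp
  ultimately show ?thesis using a0 ab unfolding \<sigma>_def by blast
qed

lemma small_power_exceeds:
  fixes e C d :: real
  assumes "0 < e" "0 < d"
  shows "\<exists>r. 0 < r \<and> r < d \<and> C < r powr - e"
proof -
  define X where "X = max 1 (C + 1)"
  define r where "r = min (d / 2) (X powr - (1 / e))"
  have X: "1 \<le> X" "C < X" by (auto simp: X_def)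
  have r: "0 < r" "r < d" "r \<le> X powr - (1 / e)" using assms X by (auto simp: r_def)
  have "(X powr - (1 / e)) powr - e \<le> r powr - e" using r assms by (intro powr_mono2') auto
  then have "X \<le> r powr - e" using X assms by (simp add: powr_powr)
  then show ?thesis using r X by auto
qed

text \<open>
  \<open>G\<close> tends to \<open>- \<infinity>\<close> at the pole, because the exponent of \<open>\<psi>\<close> in it is negative for subcritical
  \<open>p\<close>; so it cannot start by decreasing.
\<close>
lemma G_increasing_near_0: "\<exists>d>0. \<forall>r. 0 < r \<and> r < d \<longrightarrow> 0 \<le> deriv G r"
proof (rule ccontr)
  assume no: "\<not> ?thesis"
  have down: "deriv G s \<le> 0" if s: "0 < s" for s
  proof -
    from no s obtain r where "0 < r" "r < s / 2" "\<not> 0 \<le> deriv G r"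
      by (meson half_gt_zero)
    then have "\<forall>x>s / 2. deriv G x \<le> 0" using Lambda_split[of "s / 2"] s by auto
    then show ?thesis using s by simp
  qed
  obtain d a b where d: "d > 0" and a: "a > 0"
    and G: "\<And>r. 0 < r \<and> r < d \<Longrightarrow> G r \<le> - a * r powr - (2 - \<delta> * (p - 1))"
    using G_bounds_near_0 by blast
  obtain r where r: "0 < r" "r < min d 1" "- G 1 / a < r powr - (2 - \<delta> * (p - 1))"
    using small_power_exceeds[OF sigma_pos, of "min d 1" "- G 1 / a"] d by auto
  have "G 1 \<le> G r"
  proof (rule DERIV_nonpos_imp_nonincreasing[of r 1 G])
    show "r \<le> 1" using r by simp
    show "\<exists>y. (G has_real_derivative y) (at x) \<and> y \<le> 0" if "r \<le> x" "x \<le> 1" for x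
      using G_deriv[of x] down[of x] that r by auto
  qed
  also have "\<dots> \<le> - a * r powr - (2 - \<delta> * (p - 1))" using G[of r] r by simp
  also have "\<dots> < G 1"
  proof -
    have "- G 1 < r powr - (2 - \<delta> * (p - 1)) * a" using r(3) a by (simp only: pos_divide_less_eq)
    then show ?thesis by (simp add: mult.commute)
  qed
  finally show False by simp
qed

text \<open>
  On \<open>[t, 2 t]\<close> the slope \<open>- u'\<close> dominates a multiple of \<open>u\<^sup>p\<close>, and such a superlinear inequality
  forgets its data: it bounds \<open>u(2 t)\<close> independently of \<open>\<alpha>\<close>. A large flux at \<open>2 t\<close> would then make
  \<open>u\<close> vanish before \<open>3 t\<close>.
\<close>
lemma interior_bound:
  assumes t: "0 < t"
  shows "\<exists>C. \<forall>\<alpha>>0. (\<forall>r. 0 \<le> r \<and> r \<le> 3 * t \<longrightarrow> 0 < usol \<alpha> r) \<longrightarrow>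
    usol \<alpha> (2 * t) \<le> C \<and> zsol \<alpha> (2 * t) \<le> C"
proof -
  \<comment> \<open>a lower bound for \<open>\<integral>\<^sub>0\<^sup>t \<psi>\<^sup>N\<close>, from the second half of the interval\<close>
  define w where "w = t / 2 * \<psi> (t / 2) ^ N"
  define k where "k = w / \<psi> (2 * t) ^ N"
  define U1 where "U1 = ((p - 1) * k * t) powr (1 / (1 - p))"
  define Z1 where "Z1 = U1 * \<psi> (3 * t) ^ N / t"
  have w0: "0 < w" using t psi_pos[of "t / 2"] by (simp add: w_def)
  have k0: "0 < k" using w0 psi_pos[of "2 * t"] t by (simp add: k_def)
  have "usol \<alpha> (2 * t) \<le> max U1 Z1 \<and> zsol \<alpha> (2 * t) \<le> max U1 Z1"
    if al: "0 < \<alpha>" and pos: "\<forall>r. 0 \<le> r \<and> r \<le> 3 * t \<longrightarrow> 0 < usol \<alpha> r" for \<alpha>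
  proof -
    define u z where "u = usol \<alpha>" and "z = zsol \<alpha>"
    have u0: "0 < u r" if "0 \<le> r" "r \<le> 3 * t" for r using pos that by (simp add: u_def)
    have anti: "u r \<le> u s" if "0 \<le> s" "s \<le> r" for r s using usol_antimono[OF al that] by (simp add: u_def)
    have zmono: "z s \<le> z r" if "0 \<le> s" "s \<le> r" for r s
      using sol_monotone(2)[OF sol_usol[OF al] that, of r] by (simp add: z_def)
    have du: "(u has_real_derivative - (z r / \<psi> r ^ N)) (at r)" if "0 < r" for r
      using usol_has_derivative(1)[OF al that] by (simp add: u_def z_def)
    have dz: "(z has_real_derivative \<psi> r ^ N * nonlin (u r)) (at r)" if "0 < r" for r
      using usol_has_derivative(2)[OF al that] by (simp add: u_def z_def)
    have "z (t / 2) - u t powr p * \<psi> (t / 2) ^ N * (t / 2) \<le> z t - u t powr p * \<psi> (t / 2) ^ N * t"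
    proof (rule DERIV_nonneg_imp_nondecreasing[of "t / 2" t "\<lambda>x. z x - u t powr p * \<psi> (t / 2) ^ N * x"])
      show "t / 2 \<le> t" using t by simp
      fix x assume x: "t / 2 \<le> x" "x \<le> t"
      have "u t powr p * \<psi> (t / 2) ^ N \<le> nonlin (u x) * \<psi> x ^ N"
        using nonlin_mono[OF anti[of x t]] nonlin_pos[OF u0[of t]] psi_power_mono[of "t / 2" x] x t
          psi_nonneg[of "t / 2"]
        by (intro mult_mono) auto
      then show "\<exists>y. ((\<lambda>x. z x - u t powr p * \<psi> (t / 2) ^ N * x) has_real_derivative y) (at x) \<and> 0 \<le> y"
        using x t by (intro exI[of _ "\<psi> x ^ N * nonlin (u x) - u t powr p * \<psi> (t / 2) ^ N"])
          (auto intro!: derivative_eq_intros dz simp: mult.commute)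
    qed
    moreover have "0 \<le> z (t / 2)" using sol_monotone(3)[OF sol_usol[OF al], of "t/2" "t/2" "t/2"] t by (simp add: z_def)
    ultimately have zt: "u t powr p * w \<le> z t" by (simp add: w_def algebra_simps)
    have slope: "u x powr p * k \<le> z x / \<psi> x ^ N" if x: "t \<le> x" "x \<le> 2 * t" for x
    proof -
      have "u x powr p * w \<le> u t powr p * w"
        using anti[of t x] u0[of x] x t w0 p1 by (intro mult_right_mono powr_mono2) auto
      also have "\<dots> \<le> z x" using zt zmono[of t x] x t by simp
      finally have "u x powr p * w / \<psi> (2 * t) ^ N \<le> z x / \<psi> (2 * t) ^ N"
        using psi_pos[of "2 * t"] t by (simp add: divide_right_mono)
      also have "\<dots> \<le> z x / \<psi> x ^ N"
        using psi_power_mono[of x "2 * t"] psi_pos[of x] psi_pos[of "2 * t"] x t zmono[of 0 x] solD(2)[OF sol_usol[OF al]]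
        by (intro divide_left_mono) (auto simp: z_def)
      finally show ?thesis by (simp add: k_def)
    qed
    have "u t powr (1 - p) - (p - 1) * k * t \<le> u (2 * t) powr (1 - p) - (p - 1) * k * (2 * t)"
    proof (rule DERIV_nonneg_imp_nondecreasing[of t "2 * t" "\<lambda>x. u x powr (1 - p) - (p - 1) * k * x"])
      show "t \<le> 2 * t" using t by simp
      fix x assume x: "t \<le> x" "x \<le> 2 * t"
      have x0: "0 < x" and ux: "0 < u x" using x t u0[of x] by auto
      have D: "((\<lambda>x. u x powr (1 - p)) has_real_derivative (1 - p) * u x powr (- p) * - (z x / \<psi> x ^ N)) (at x)"
        using DERIV_fun_powr[OF du[OF x0] ux, of "1 - p"] by simp
      have D': "((\<lambda>x. u x powr (1 - p) - (p - 1) * k * x) has_real_derivative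
          (1 - p) * u x powr (- p) * - (z x / \<psi> x ^ N) - (p - 1) * k) (at x)"
        by (rule DERIV_diff[OF D]) (auto intro!: derivative_eq_intros)
      have "k \<le> u x powr (- p) * (z x / \<psi> x ^ N)"
      proof -
        have "u x powr (- p) * (u x powr p * k) \<le> u x powr (- p) * (z x / \<psi> x ^ N)"
          using slope[OF x] by (intro mult_left_mono) auto
        then show ?thesis using ux by (simp add: powr_minus mult.assoc[symmetric])
      qed
      then have "(p - 1) * k \<le> (p - 1) * (u x powr (- p) * (z x / \<psi> x ^ N))"
        using p1 by (intro mult_left_mono) auto
      moreover have e: "(1 - p) * A * - B = (p - 1) * (A * B)" for A B :: real
        by (simp add: algebra_simps)
      ultimately have "0 \<le> (1 - p) * u x powr (- p) * - (z x / \<psi> x ^ N) - (p - 1) * k"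
        unfolding e by linarith
      with D' show "\<exists>y. ((\<lambda>x. u x powr (1 - p) - (p - 1) * k * x) has_real_derivative y) (at x) \<and> 0 \<le> y"
        by blast
    qed
    then have lower: "(p - 1) * k * t \<le> u (2 * t) powr (1 - p)"
      using powr_ge_zero[of "u t" "1 - p"] by (simp add: algebra_simps del: powr_ge_zero)
    have "(u (2 * t) powr (1 - p)) powr (1 / (1 - p)) \<le> U1"
      unfolding U1_def using lower p1 k0 t by (intro powr_mono2') auto
    then have U: "u (2 * t) \<le> U1" using p1 u0[of "2 * t"] t by (simp add: powr_powr)
    \<comment> \<open>a lower bound for \<open>- u'\<close> on \<open>[2 t, 3 t]\<close>: the flux increases, and so does \<open>\<psi>\<close>\<close>
    define m where "m = z (2 * t) / \<psi> (3 * t) ^ N"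
    have "u (3 * t) + m * (3 * t) \<le> u (2 * t) + m * (2 * t)"
    proof (rule DERIV_nonpos_imp_nonincreasing[of "2 * t" "3 * t" "\<lambda>x. u x + m * x"])
      show "2 * t \<le> 3 * t" using t by simp
      fix x assume x: "2 * t \<le> x" "x \<le> 3 * t"
      have "m \<le> z x / \<psi> x ^ N"
        unfolding m_def using zmono[of "2 * t" x] psi_power_mono[of x "3 * t"] psi_pos[of x] psi_pos[of "3 * t"] x t
          zmono[of 0 "2 * t"] solD(2)[OF sol_usol[OF al]]
        by (intro frac_le) (auto simp: z_def)
      then show "\<exists>y. ((\<lambda>x. u x + m * x) has_real_derivative y) (at x) \<and> y \<le> 0"
        using x t by (intro exI[of _ "- (z x / \<psi> x ^ N) + m"])
          (auto intro!: derivative_eq_intros du)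
    qed
    then have "m * t \<le> U1"
      using U u0[of "3 * t"] t by (simp add: algebra_simps)
    then have "z (2 * t) \<le> Z1"
      using psi_pos[of "3 * t"] t by (simp add: Z1_def m_def field_simps)
    then show ?thesis using U by (auto simp: u_def z_def)
  qed
  then show ?thesis by blast
qed

text \<open>
  For large initial values the energy built up near the pole is too large for a solution that
  stays positive up to a fixed radius. The length \<open>\<rho>\<close> is the scale of the concentrated solution,
  \<open>\<alpha>\<^sup>p\<^sup>-\<^sup>1 \<rho>\<^sup>2 = 1\<close>; on \<open>[\<rho> / K, \<rho>]\<close> the solution is at least \<open>\<alpha> / 2\<close>, and \<open>G\<close> grows by
  at least \<open>\<rho>\<^sup>-\<^sup>\<sigma>\<close>.
\<close>
theorem large_data_vanish: "\<exists>\<alpha>>0. \<exists>r\<ge>0. usol \<alpha> r \<le> 0"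
proof (rule ccontr)
  assume "\<not> ?thesis"
  then have pos: "0 < usol \<alpha> r" if "0 < \<alpha>" "0 \<le> r" for \<alpha> r
    using that by (meson not_le)
  define \<sigma> where "\<sigma> = 2 - \<delta> * (p - 1)"
  have sg: "0 < \<sigma>" using sigma_pos by (simp add: \<sigma>_def)
  obtain d1 a b where d1: "d1 > 0" and a: "a > 0" and ab: "a \<le> b"
    and G: "\<And>r. 0 < r \<and> r < d1 \<Longrightarrow> - b * r powr - \<sigma> \<le> G r \<and> G r \<le> - a * r powr - \<sigma> \<and> r / 2 \<le> \<psi> r"
    using G_bounds_near_0 unfolding \<sigma>_def by metis
  obtain d2 where d2: "d2 > 0" and up: "\<And>r. 0 < r \<and> r < d2 \<Longrightarrow> 0 \<le> deriv G r"
    using G_increasing_near_0 by blast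
  define t where "t = min d1 d2 / 4"
  have t: "0 < t" "2 * t < d1" "2 * t < d2" using d1 d2 by (auto simp: t_def)
  obtain C where C: "\<And>\<alpha>. 0 < \<alpha> \<Longrightarrow> usol \<alpha> (2 * t) \<le> C \<and> zsol \<alpha> (2 * t) \<le> C"
    using interior_bound[OF t(1)] pos by auto
  define B where "B = (\<delta> * \<psi> (2 * t) powr (real N - \<delta> - 1) * \<psi>' (2 * t) * C + \<psi> (2 * t) powr (- \<delta>) * C)\<^sup>2 / 2
     + (\<psi> (2 * t) powr \<delta> * C) powr (p + 1) / (p + 1) + \<bar>G (2 * t)\<bar> * (\<psi> (2 * t) powr \<delta> * C)\<^sup>2 / 2"
  have upper: "energy (usol \<alpha>) (zsol \<alpha>) (2 * t) \<le> B" if al: "0 < \<alpha>" for \<alpha>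
  proof -
    have u: "0 < usol \<alpha> (2 * t)" "usol \<alpha> (2 * t) \<le> C" using pos[OF al] C[OF al] t by auto
    have z: "0 \<le> zsol \<alpha> (2 * t)" "zsol \<alpha> (2 * t) \<le> C"
      using sol_monotone(3)[OF sol_usol[OF al], of "2 * t" "2 * t" "2 * t"] C[OF al] t by auto
    have v: "0 < scaled (usol \<alpha>) (2 * t)" "scaled (usol \<alpha>) (2 * t) \<le> \<psi> (2 * t) powr \<delta> * C"
      using scaled_pos[of "2 * t" "usol \<alpha>"] u t by (auto simp: scaled_def mult_left_mono)
    define A where "A = \<delta> * \<psi> (2 * t) powr (real N - \<delta> - 1) * \<psi>' (2 * t)"
    have A: "0 \<le> A" using delta_bounds(4) psi'_nonneg[of "2 * t"] t by (simp add: A_def)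
    have "A * usol \<alpha> (2 * t) \<le> A * C" "0 \<le> A * usol \<alpha> (2 * t)"
      "\<psi> (2 * t) powr (- \<delta>) * zsol \<alpha> (2 * t) \<le> \<psi> (2 * t) powr (- \<delta>) * C"
      "0 \<le> \<psi> (2 * t) powr (- \<delta>) * zsol \<alpha> (2 * t)"
      using A u z by (auto intro!: mult_left_mono)
    then have "\<bar>momentum (usol \<alpha>) (zsol \<alpha>) (2 * t)\<bar> \<le> A * C + \<psi> (2 * t) powr (- \<delta>) * C"
      unfolding momentum_def A_def[symmetric] by linarith
    then have 1: "(momentum (usol \<alpha>) (zsol \<alpha>) (2 * t))\<^sup>2 \<le> (A * C + \<psi> (2 * t) powr (- \<delta>) * C)\<^sup>2"
      by (metis abs_ge_zero power2_abs power_mono)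
    have 2: "scaled (usol \<alpha>) (2 * t) powr (p + 1) / (p + 1) \<le> (\<psi> (2 * t) powr \<delta> * C) powr (p + 1) / (p + 1)"
      using v p1 by (intro divide_right_mono powr_mono2) auto
    have 3: "G (2 * t) * (scaled (usol \<alpha>) (2 * t))\<^sup>2 \<le> \<bar>G (2 * t)\<bar> * (\<psi> (2 * t) powr \<delta> * C)\<^sup>2"
      using v by (intro mult_mono power_mono) auto
    show ?thesis
      unfolding energy_def B_def A_def[symmetric] using 1 2 3 by linarith
  qed
  \<comment> \<open>chosen so that \<open>G \<rho> - G (\<rho> / K) \<ge> (a K\<^sup>\<sigma> - b) \<rho>\<^sup>-\<^sup>\<sigma> = \<rho>\<^sup>-\<^sup>\<sigma>\<close>\<close>
  define K where "K = ((b + 1) / a) powr (1 / \<sigma>)"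
  have K: "1 < K" unfolding K_def using a ab sg by (intro gr_one_powr) auto
  have Ks: "K powr \<sigma> = (b + 1) / a" unfolding K_def using a ab sg by (simp add: powr_powr)
  \<comment> \<open>the lower bound for the energy is \<open>c \<rho>\<^sup>-\<^sup>e\<close>, collected from \<open>\<rho>\<^sup>-\<^sup>\<sigma>\<close>, \<open>\<psi>\<^sup>2\<^sup>\<delta>\<close> and \<open>\<alpha>\<^sup>2\<close>\<close>
  define e where "e = \<sigma> + 4 / (p - 1) - 2 * \<delta>"
  have e: "0 < e"
  proof -
    have "\<delta> * (p - 1) < 2" using sigma_pos by simp
    then have "\<delta> < 2 / (p - 1)" using p1 by (simp add: pos_less_divide_eq)
    then have "2 * \<delta> < 4 / (p - 1)" by simp
    then show ?thesis using sg by (simp add: e_def)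
  qed
  define c where "c = (1 / (2 * K)) powr (2 * \<delta>) / 8"
  have c: "0 < c" using K by (simp add: c_def)
  obtain \<rho> where rho: "0 < \<rho>" "\<rho> < 2 * t" "B / c < \<rho> powr - e"
    using small_power_exceeds[OF e, of "2 * t" "B / c"] t by auto
  define \<alpha> where "\<alpha> = \<rho> powr (- 2 / (p - 1))"
  have al: "0 < \<alpha>" using rho by (simp add: \<alpha>_def)
  have scale: "\<alpha> powr p * \<rho>\<^sup>2 = \<alpha>"
  proof -
    have "\<alpha> powr p * \<rho>\<^sup>2 = \<rho> powr (- 2 / (p - 1) * p) * \<rho> powr 2"
      using rho by (simp add: \<alpha>_def powr_powr powr_numeral)
    also have "\<dots> = \<rho> powr (- 2 / (p - 1) * p + 2)" by (rule powr_add[symmetric])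
    also have "- 2 / (p - 1) * p + 2 = - 2 / (p - 1)" using p1 by (simp add: field_simps)
    finally show ?thesis by (simp add: \<alpha>_def)
  qed
  let ?E = "energy (usol \<alpha>) (zsol \<alpha>)"
  define \<rho>1 where "\<rho>1 = \<rho> / K"
  have rho1: "0 < \<rho>1" "\<rho>1 < \<rho>" using rho K by (auto simp: \<rho>1_def pos_divide_less_eq)
  have dE: "(?E has_real_derivative deriv G r * (scaled (usol \<alpha>) r)\<^sup>2 / 2) (at r)" if "0 < r" for r
    using sol_deriv_interior(3)[OF sol_usol[OF al, of "r + 1"], of r] pos[OF al] that by simp
  have Emono: "?E r \<le> ?E s" if "0 < r" "r \<le> s" "s < d2" for r s
  proof (rule DERIV_nonneg_imp_nondecreasing[OF that(2)])
    fix x assume "r \<le> x" "x \<le> s"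
    then show "\<exists>y. (?E has_real_derivative y) (at x) \<and> 0 \<le> y"
      using dE[of x] up[of x] that by (intro exI[of _ "deriv G x * (scaled (usol \<alpha>) x)\<^sup>2 / 2"]) auto
  qed
  have E1: "0 \<le> ?E \<rho>1"
  proof (rule limit_le_of_deriv_nonneg[OF energy_terms_tendsto_0(4)[OF sol_usol[OF al, of 1] _ al] rho1(1)])
    show "\<exists>y. (?E has_real_derivative y) (at x) \<and> 0 \<le> y" if "0 < x" "x < \<rho>1" for x
      using dE[of x] up[of x] that rho1 rho t by (intro exI[of _ "deriv G x * (scaled (usol \<alpha>) x)\<^sup>2 / 2"]) auto
    show "continuous_on {0<..\<rho>1} ?E"
      using DERIV_isCont[OF dE] by (intro continuous_at_imp_continuous_on) auto
  qed simp
  define M where "M = (\<rho>1 / 2) powr (2 * \<delta>) * (\<alpha>\<^sup>2 / 4)"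
  have vM: "M \<le> (scaled (usol \<alpha>) x)\<^sup>2" if x: "\<rho>1 \<le> x" "x \<le> \<rho>" for x
  proof -
    have "\<alpha> powr p * x\<^sup>2 \<le> \<alpha> powr p * \<rho>\<^sup>2" using x rho1 by (intro mult_left_mono power_mono) auto
    then have "\<alpha> / 2 \<le> usol \<alpha> x"
      using u_lower[OF sol_usol[OF al] al, of x x] x rho1 scale by simp
    moreover have "\<rho>1 / 2 \<le> \<psi> x" using G[of x] x rho1 rho t by force
    ultimately have "(\<rho>1 / 2) powr \<delta> * (\<alpha> / 2) \<le> scaled (usol \<alpha>) x"
      unfolding scaled_def using al rho1 delta_bounds(4) by (intro mult_mono powr_mono2) auto
    then have "((\<rho>1 / 2) powr \<delta> * (\<alpha> / 2))\<^sup>2 \<le> (scaled (usol \<alpha>) x)\<^sup>2"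
      using al by (intro power_mono) auto
    moreover have "((\<rho>1 / 2) powr \<delta>)\<^sup>2 = (\<rho>1 / 2) powr (2 * \<delta>)"
      by (simp add: power2_eq_square powr_add[symmetric])
    ultimately show ?thesis by (simp add: M_def power_mult_distrib power_divide)
  qed
  have "?E \<rho>1 - M / 2 * G \<rho>1 \<le> ?E \<rho> - M / 2 * G \<rho>"
  proof (rule DERIV_nonneg_imp_nondecreasing[of \<rho>1 \<rho> "\<lambda>x. ?E x - M / 2 * G x"])
    show "\<rho>1 \<le> \<rho>" using rho1 by simp
    fix x assume x: "\<rho>1 \<le> x" "x \<le> \<rho>"
    have "deriv G x * M \<le> deriv G x * (scaled (usol \<alpha>) x)\<^sup>2"
      using vM[OF x] up[of x] x rho1 rho t by (intro mult_left_mono) auto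
    then show "\<exists>y. ((\<lambda>x. ?E x - M / 2 * G x) has_real_derivative y) (at x) \<and> 0 \<le> y"
      using x rho1
      by (intro exI[of _ "deriv G x * (scaled (usol \<alpha>) x)\<^sup>2 / 2 - M / 2 * deriv G x"] conjI)
         (auto intro!: derivative_eq_intros dE G_deriv simp: mult.commute)
  qed
  then have "M / 2 * (G \<rho> - G \<rho>1) \<le> ?E \<rho>" using E1 by (simp add: algebra_simps)
  moreover have "\<rho> powr - \<sigma> \<le> G \<rho> - G \<rho>1"
  proof -
    have "\<rho>1 powr - \<sigma> = \<rho> powr - \<sigma> * K powr \<sigma>"
      using rho K by (simp add: \<rho>1_def powr_divide powr_minus_divide)
    then have "a * \<rho>1 powr - \<sigma> = (b + 1) * \<rho> powr - \<sigma>" using Ks a by simp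
    then show ?thesis using G[of \<rho>] G[of \<rho>1] rho rho1 t by (auto simp: algebra_simps)
  qed
  moreover have "0 \<le> M" by (simp add: M_def)
  ultimately have "M / 2 * \<rho> powr - \<sigma> \<le> ?E \<rho>"
    by (meson mult_left_mono order_trans divide_nonneg_nonneg zero_le_numeral)
  also have "M / 2 * \<rho> powr - \<sigma> = c * \<rho> powr - e"
  proof -
    have al2: "\<alpha>\<^sup>2 = \<rho> powr (- 4 / (p - 1))" using p1 by (simp add: \<alpha>_def power2_eq_square powr_add[symmetric])
    have r2: "(\<rho>1 / 2) powr (2 * \<delta>) = (1 / (2 * K)) powr (2 * \<delta>) * \<rho> powr (2 * \<delta>)"
      using rho K by (simp add: \<rho>1_def powr_mult[symmetric] mult.commute)
    have "\<rho> powr - e = \<rho> powr (2 * \<delta>) * \<rho> powr (- 4 / (p - 1)) * \<rho> powr - \<sigma>"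
      by (simp add: e_def powr_add[symmetric] algebra_simps)
    then show ?thesis by (simp add: M_def c_def al2 r2)
  qed
  also have "?E \<rho> \<le> ?E (2 * t)" using Emono[of \<rho> "2 * t"] rho t by simp
  also have "\<dots> \<le> B" by (rule upper[OF al])
  finally have "\<rho> powr - e \<le> B / c" using c by (simp add: pos_le_divide_eq mult.commute)
  then show False using rho(3) by simp
qed

end

section \<open>Decay at infinity\<close>

locale expanding_model = subcritical_model N p \<psi> \<psi>' \<psi>'' \<delta> G for N p \<psi> \<psi>' \<psi>'' \<delta> G +
  fixes l :: ereal
  assumes l_pos: "0 < l"
    and lim_h: "((\<lambda>r. ereal (\<psi>' r / \<psi> r)) \<longlongrightarrow> l) at_top"
    and lim_k: "((\<lambda>r. ereal (\<psi>'' r / \<psi>' r)) \<longlongrightarrow> l) at_top"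
    and small_h: "l = \<infinity> \<Longrightarrow> (\<lambda>r. \<psi>' r / \<psi> r) \<in> o[at_top](\<lambda>r. \<psi> r powr \<delta>)"
    and small_k: "l = \<infinity> \<Longrightarrow> (\<lambda>r. \<psi>'' r / \<psi>' r) \<in> o[at_top](\<lambda>r. \<psi> r powr \<delta>)"
begin

text \<open>
  A constant below \<open>l\<close> bounds both logarithmic rates from below. In particular \<open>\<psi>\<close> is eventually
  convex and grows at least exponentially.
\<close>
lemma exponential_growth:
  obtains c r0 where "0 < c" "0 < r0"
    "\<And>r. r0 \<le> r \<Longrightarrow> c * \<psi> r \<le> \<psi>' r" "\<And>r. r0 \<le> r \<Longrightarrow> 0 \<le> \<psi>'' r"
    "\<And>r. r0 \<le> r \<Longrightarrow> 1 \<le> \<psi> r" "filterlim \<psi> at_top at_top"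
proof -
  obtain c :: real where c: "0 < ereal c" "ereal c < l"
    using l_pos ereal_dense2[of 0 l] by auto
  then have c0: "0 < c" by simp
  have "\<forall>\<^sub>F r in at_top. ereal c < ereal (\<psi>' r / \<psi> r)" by (rule order_tendstoD(1)[OF lim_h c(2)])
  moreover have "\<forall>\<^sub>F r in at_top. ereal c < ereal (\<psi>'' r / \<psi>' r)" by (rule order_tendstoD(1)[OF lim_k c(2)])
  moreover have "\<forall>\<^sub>F r::real in at_top. 0 < r" by (rule eventually_gt_at_top)
  ultimately have "\<forall>\<^sub>F r in at_top. c * \<psi> r \<le> \<psi>' r \<and> 0 \<le> \<psi>'' r"
  proof eventually_elim
    case (elim r)
    have "0 < \<psi> r" using psi_pos elim by simp
    then have 1: "c * \<psi> r < \<psi>' r" using elim by (simp add: pos_less_divide_eq)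
    then have "0 < \<psi>' r" using c0 \<open>0 < \<psi> r\<close> by (meson less_trans mult_pos_pos)
    moreover have "0 < \<psi>'' r / \<psi>' r" using elim c0 by (auto intro: less_trans)
    ultimately show ?case using 1 by (simp add: zero_less_divide_iff)
  qed
  then obtain r1 where r1: "\<And>r. r1 \<le> r \<Longrightarrow> c * \<psi> r \<le> \<psi>' r \<and> 0 \<le> \<psi>'' r"
    by (auto simp: eventually_at_top_linorder)
  define r2 where "r2 = max r1 1"
  have r2: "0 < r2" "r1 \<le> r2" by (auto simp: r2_def)
  have grow: "\<psi> r2 + c * \<psi> r2 * (r - r2) \<le> \<psi> r" if "r2 \<le> r" for r
  proof -
    have "\<psi> r2 - c * \<psi> r2 * r2 \<le> \<psi> r - c * \<psi> r2 * r"
    proof (rule DERIV_nonneg_imp_nondecreasing[of r2 r "\<lambda>x. \<psi> x - c * \<psi> r2 * x", OF that])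
      fix x assume x: "r2 \<le> x" "x \<le> r"
      have "c * \<psi> r2 \<le> c * \<psi> x" using psi_mono[of r2 x] x r2 c0 by simp
      also have "\<dots> \<le> \<psi>' x" using r1[of x] x r2 by simp
      finally show "\<exists>y. ((\<lambda>x. \<psi> x - c * \<psi> r2 * x) has_real_derivative y) (at x) \<and> 0 \<le> y"
        using x r2 by (intro exI[of _ "\<psi>' x - c * \<psi> r2"]) (auto intro!: derivative_eq_intros psi_has_derivative)
    qed
    then show ?thesis by (simp add: algebra_simps)
  qed
  have slope: "0 < c * \<psi> r2" using c0 psi_pos[OF r2(1)] by simp
  have "filterlim (\<lambda>r. \<psi> r2 + c * \<psi> r2 * (r - r2)) at_top at_top"
  proof -
    have "filterlim (\<lambda>r::real. - r2 + r) at_top at_top"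
      by (rule filterlim_tendsto_add_at_top[OF tendsto_const filterlim_ident])
    then have "filterlim (\<lambda>r. c * \<psi> r2 * (- r2 + r)) at_top at_top"
      using slope by (rule filterlim_tendsto_pos_mult_at_top[OF tendsto_const, rotated])
    then have "filterlim (\<lambda>r. \<psi> r2 + c * \<psi> r2 * (- r2 + r)) at_top at_top"
      by (rule filterlim_tendsto_add_at_top[OF tendsto_const])
    then show ?thesis by simp
  qed
  then have top: "filterlim \<psi> at_top at_top"
    by (rule filterlim_at_top_mono[OF _ eventually_mono[OF eventually_ge_at_top[of r2] grow]])
  then have "\<forall>\<^sub>F r in at_top. 1 \<le> \<psi> r" by (simp add: filterlim_at_top)
  then obtain r3 where r3: "\<And>r. r3 \<le> r \<Longrightarrow> 1 \<le> \<psi> r" by (auto simp: eventually_at_top_linorder)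
  show thesis
    by (rule that[of c "max r2 r3"]) (use c0 r1 r2 r3 top in auto)
qed

lemma psi_at_top: "filterlim \<psi> at_top at_top"
  by (rule exponential_growth)

lemma psi_powr_neg_tendsto: "c < 0 \<Longrightarrow> ((\<lambda>r. \<psi> r powr c) \<longlongrightarrow> 0) at_top"
  by (rule tendsto_neg_powr[OF _ psi_at_top])

text \<open>
  For finite \<open>l\<close> these two limits follow from the growth of \<open>\<psi>\<close>; for infinite \<open>l\<close> they are the
  growth conditions on \<open>\<psi>'\<close> and \<open>\<psi>''\<close>. The two cases are the same from here on.
\<close>
lemma rates_negligible:
  "((\<lambda>r. \<psi>' r / \<psi> r * \<psi> r powr (- \<delta>)) \<longlongrightarrow> 0) at_top"
  "((\<lambda>r. \<psi>'' r / \<psi>' r * \<psi> r powr (- \<delta>)) \<longlongrightarrow> 0) at_top"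
proof -
  have "((\<lambda>r. f r * \<psi> r powr (- \<delta>)) \<longlongrightarrow> 0) at_top"
    if lim: "((\<lambda>r. ereal (f r)) \<longlongrightarrow> l) at_top"
      and small: "l = \<infinity> \<Longrightarrow> f \<in> o[at_top](\<lambda>r. \<psi> r powr \<delta>)" for f :: "real \<Rightarrow> real"
  proof (cases "l = \<infinity>")
    case True
    have "((\<lambda>r. f r / \<psi> r powr \<delta>) \<longlongrightarrow> 0) at_top" by (rule smalloD_tendsto[OF small[OF True]])
    then show ?thesis by (simp add: powr_minus divide_inverse)
  next
    case False
    then obtain L where L: "l = ereal L" using l_pos by (cases l) auto
    then have "(f \<longlongrightarrow> L) at_top" using lim by simp
    from tendsto_mult[OF this psi_powr_neg_tendsto[of "- \<delta>"]] show ?thesis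
      using delta_bounds(4) by simp
  qed
  from this[OF lim_h small_h] this[OF lim_k small_k]
  show "((\<lambda>r. \<psi>' r / \<psi> r * \<psi> r powr (- \<delta>)) \<longlongrightarrow> 0) at_top"
    "((\<lambda>r. \<psi>'' r / \<psi>' r * \<psi> r powr (- \<delta>)) \<longlongrightarrow> 0) at_top" by auto
qed

text \<open>
  The convexity condition \<open>\<psi> \<psi>'' \<ge> (1 - \<epsilon>) \<psi>'\<^sup>2\<close> need not hold eventually if \<open>l = \<infinity>\<close>, but it
  holds at arbitrarily large radii, since otherwise \<open>\<psi> / \<psi>'\<close> would grow linearly.
\<close>
lemma convex_radii:
  assumes e: "0 < \<epsilon>"
  shows "\<exists>r>s. (1 - \<epsilon>) * (\<psi>' r)\<^sup>2 \<le> \<psi>'' r * \<psi> r"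
proof (rule ccontr)
  assume no: "\<not> ?thesis"
  obtain c r0 where c: "0 < c" "0 < r0" "\<And>r. r0 \<le> r \<Longrightarrow> c * \<psi> r \<le> \<psi>' r"
    using exponential_growth by metis
  define a where "a = max s r0 + 1"
  have a: "0 < a" "s < a" "r0 \<le> a" using c by (auto simp: a_def)
  have p': "0 < \<psi>' r" if "a \<le> r" for r
    using c(3)[of r] psi_pos[of r] that a c(1) by (meson less_le_trans mult_pos_pos order_trans)
  have "\<psi> a / \<psi>' a - \<epsilon> * a \<le> \<psi> r / \<psi>' r - \<epsilon> * r" if r: "a \<le> r" for r
  proof (rule DERIV_nonneg_imp_nondecreasing[of a r "\<lambda>x. \<psi> x / \<psi>' x - \<epsilon> * x", OF r])
    fix x assume x: "a \<le> x" "x \<le> r"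
    have x0: "0 < x" using x a by simp
    have "\<psi>'' x * \<psi> x < (1 - \<epsilon>) * (\<psi>' x)\<^sup>2"
      using no x a by (meson less_le_trans not_le)
    then have "\<epsilon> * (\<psi>' x)\<^sup>2 \<le> \<psi>' x * \<psi>' x - \<psi> x * \<psi>'' x" by (simp add: power2_eq_square algebra_simps)
    then have "\<epsilon> \<le> (\<psi>' x * \<psi>' x - \<psi> x * \<psi>'' x) / (\<psi>' x)\<^sup>2"
      using p'[OF x(1)] by (simp add: pos_le_divide_eq)
    moreover have "((\<lambda>x. \<psi> x / \<psi>' x - \<epsilon> * x) has_real_derivative
        (\<psi>' x * \<psi>' x - \<psi> x * \<psi>'' x) / (\<psi>' x)\<^sup>2 - \<epsilon>) (at x)"
      using p'[OF x(1)]
        DERIV_diff[OF DERIV_divide[OF psi_has_derivative(1)[OF x0] psi_has_derivative(2)[OF x0]] DERIV_cmult_Id[of \<epsilon>]]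
      by (simp add: power2_eq_square)
    ultimately show "\<exists>y. ((\<lambda>x. \<psi> x / \<psi>' x - \<epsilon> * x) has_real_derivative y) (at x) \<and> 0 \<le> y"
      by (intro exI[of _ "(\<psi>' x * \<psi>' x - \<psi> x * \<psi>'' x) / (\<psi>' x)\<^sup>2 - \<epsilon>"]) auto
  qed
  moreover have "\<psi> r / \<psi>' r \<le> 1 / c" if "a \<le> r" for r
    using c(3)[of r] p'[OF that] that a c(1) by (simp add: field_simps)
  moreover have "0 \<le> \<psi> a / \<psi>' a" using psi_nonneg[of a] p'[of a] a by simp
  ultimately have bound: "\<epsilon> * (r - a) \<le> 1 / c" if "a \<le> r" for r
    using that by (smt (verit) right_diff_distrib)
  \<comment> \<open>twice the length at which linear growth exceeds the bound \<open>1 / c\<close>\<close>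
  have "\<epsilon> * ((a + 2 / (c * \<epsilon>)) - a) \<le> 1 / c" by (rule bound) (use e c in simp)
  then show False using e c(1) by (simp add: field_simps)
qed

text \<open>
  Since \<open>\<psi>' / \<psi>\<close> stays away from 0, a power of \<open>\<psi>\<close> is bounded by a multiple of its own
  derivative. So decay rates measured in powers of \<open>\<psi>\<close> can be integrated without knowing more
  about \<open>\<psi>\<close>. For \<open>g < 0\<close> the inequality bounds the increase of \<open>f\<close> on the whole half-line.
\<close>
lemma integrate_psi_power:
  assumes c: "0 < c" "0 < r0" "\<And>x. r0 \<le> x \<Longrightarrow> c * \<psi> x \<le> \<psi>' x"
    and r: "r0 \<le> r" "r \<le> t" and A: "0 \<le> A" and g: "g \<noteq> 0"
    and f: "\<And>x. r0 \<le> x \<Longrightarrow> (f has_real_derivative f' x) (at x)"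
    and bound: "\<And>x. r0 \<le> x \<Longrightarrow> f' x \<le> A * \<psi> x powr g"
  shows "f t - A / (c * g) * \<psi> t powr g \<le> f r - A / (c * g) * \<psi> r powr g"
proof (rule DERIV_nonpos_imp_nonincreasing[of r t "\<lambda>x. f x - A / (c * g) * \<psi> x powr g", OF r(2)])
  fix x assume x: "r \<le> x" "x \<le> t"
  then have x0: "0 < x" "r0 \<le> x" using r c by auto
  have P: "0 < \<psi> x" using psi_pos x0 by simp
  have D: "((\<lambda>x. f x - A / (c * g) * \<psi> x powr g) has_real_derivative
      f' x - A / (c * g) * (g * \<psi> x powr (g - 1) * \<psi>' x)) (at x)"
    by (intro DERIV_diff f DERIV_cmult psi_powr_deriv x0)
  have "f' x \<le> A * (\<psi> x powr (g - 1) * \<psi> x)"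
    using bound[OF x0(2)] P powr_add[of "\<psi> x" "g - 1" 1] by simp
  also have "\<dots> \<le> A * (\<psi> x powr (g - 1) * (\<psi>' x / c))"
    using A c(1) c(3)[OF x0(2)] by (intro mult_left_mono) (auto simp: pos_le_divide_eq mult.commute)
  also have "\<dots> = A / (c * g) * (g * \<psi> x powr (g - 1) * \<psi>' x)" using g by simp
  finally show "\<exists>y. ((\<lambda>x. f x - A / (c * g) * \<psi> x powr g) has_real_derivative y) (at x) \<and> y \<le> 0"
    using D by auto
qed

definition decays :: "real \<Rightarrow> real \<Rightarrow> bool" where
  "decays \<alpha> \<beta> \<longleftrightarrow> (\<exists>C. \<forall>\<^sub>F r in at_top. usol \<alpha> r \<le> C * \<psi> r powr (- \<beta>))"

text \<open>
  Without the nonlinear term the flux is constant, and a solution that vanishes at infinity is a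
  multiple of \<open>\<integral>\<^sub>r\<^sup>\<infinity> \<psi>\<^sup>-\<^sup>N\<close>; this is the decay that a bounded flux allows.
\<close>
definition fast :: "real \<Rightarrow> bool" where
  "fast \<alpha> \<longleftrightarrow> (\<exists>C. \<forall>\<^sub>F r in at_top. usol \<alpha> r \<le> C * \<psi> r powr (- real N) \<and> zsol \<alpha> r \<le> C)"

context
  fixes \<alpha>
  assumes al: "0 < \<alpha>" and pos: "\<And>r. 0 \<le> r \<Longrightarrow> 0 < usol \<alpha> r"
begin

lemma zsol_nonneg: "0 \<le> r \<Longrightarrow> 0 \<le> zsol \<alpha> r"
  using sol_monotone(3)[OF sol_usol[OF al], of r r r] by simp

lemma decays_tendsto:
  assumes "decays \<alpha> \<beta>" "0 < \<beta>"
  shows "(usol \<alpha> \<longlongrightarrow> 0) at_top"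
proof -
  obtain C where C: "\<forall>\<^sub>F r in at_top. usol \<alpha> r \<le> C * \<psi> r powr (- \<beta>)"
    using assms(1) unfolding decays_def by blast
  show ?thesis
  proof (rule tendsto_sandwich[OF _ C tendsto_const])
    show "\<forall>\<^sub>F r in at_top. 0 \<le> usol \<alpha> r"
      using eventually_ge_at_top[of 0] by eventually_elim (use pos in \<open>auto intro: less_imp_le\<close>)
    show "((\<lambda>r. C * \<psi> r powr (- \<beta>)) \<longlongrightarrow> 0) at_top"
      using psi_powr_neg_tendsto[of "- \<beta>"] assms(2) by (intro tendsto_mult_right_zero) auto
  qed
qed

text \<open>
  Integration of \<open>- u' = z / \<psi>\<^sup>N\<close> from infinity, where \<open>u\<close> vanishes.
\<close>
lemma decay_from_flux:
  assumes u0: "(usol \<alpha> \<longlongrightarrow> 0) at_top" and b: "0 < \<beta>" and A: "0 \<le> A"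
    and z: "\<forall>\<^sub>F r in at_top. zsol \<alpha> r \<le> A * \<psi> r powr (real N - \<beta>)"
  shows "decays \<alpha> \<beta>"
proof -
  obtain c r0 where c: "0 < c" "0 < r0" "\<And>r. r0 \<le> r \<Longrightarrow> c * \<psi> r \<le> \<psi>' r"
    using exponential_growth by metis
  from z obtain r1 where r1: "\<And>r. r1 \<le> r \<Longrightarrow> zsol \<alpha> r \<le> A * \<psi> r powr (real N - \<beta>)"
    by (auto simp: eventually_at_top_linorder)
  define a where "a = max r0 r1"
  have a: "0 < a" "r0 \<le> a" "r1 \<le> a" using c by (auto simp: a_def)
  have "usol \<alpha> r \<le> A / (c * \<beta>) * \<psi> r powr (- \<beta>)" if r: "a \<le> r" for r
  proof -
    have le: "- usol \<alpha> t - A / (c * - \<beta>) * \<psi> t powr (- \<beta>) \<le> - usol \<alpha> r - A / (c * - \<beta>) * \<psi> r powr (- \<beta>)"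
      if t: "r \<le> t" for t
    proof (rule integrate_psi_power[OF c(1) a(1) _ r t A, where f' = "\<lambda>x. zsol \<alpha> x / \<psi> x ^ N"])
      fix x assume x: "a \<le> x"
      then have x0: "0 < x" using a by simp
      show "c * \<psi> x \<le> \<psi>' x" using c(3)[of x] x a by simp
      show "((\<lambda>x. - usol \<alpha> x) has_real_derivative zsol \<alpha> x / \<psi> x ^ N) (at x)"
        using DERIV_minus[OF usol_has_derivative(1)[OF al x0]] by simp
      have "zsol \<alpha> x / \<psi> x ^ N \<le> A * \<psi> x powr (real N - \<beta>) / \<psi> x ^ N"
        using r1[of x] x a psi_nonneg[of x] x0 by (intro divide_right_mono) auto
      also have "\<dots> = A * \<psi> x powr (- \<beta>)"
        using psi_power_powr[OF x0] psi_pos[OF x0] by (simp add: powr_diff powr_minus field_simps)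
      finally show "zsol \<alpha> x / \<psi> x ^ N \<le> A * \<psi> x powr (- \<beta>)" .
    qed (use b in auto)
    have "((\<lambda>t. - usol \<alpha> t - A / (c * - \<beta>) * \<psi> t powr (- \<beta>)) \<longlongrightarrow> - 0 - A / (c * - \<beta>) * 0) at_top"
      using b by (intro tendsto_intros u0 psi_powr_neg_tendsto) auto
    then have "- 0 - A / (c * - \<beta>) * 0 \<le> - usol \<alpha> r - A / (c * - \<beta>) * \<psi> r powr (- \<beta>)"
    proof (rule tendsto_upperbound)
      show "\<forall>\<^sub>F t in at_top. - usol \<alpha> t - A / (c * - \<beta>) * \<psi> t powr (- \<beta>)
          \<le> - usol \<alpha> r - A / (c * - \<beta>) * \<psi> r powr (- \<beta>)"
        using eventually_ge_at_top[of r] by eventually_elim (rule le)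
    qed simp
    then show ?thesis by simp
  qed
  then show ?thesis unfolding decays_def eventually_at_top_linorder by blast
qed

text \<open>
  Integration of \<open>z' = \<psi>\<^sup>N u\<^sup>p\<close> from a fixed radius; for a negative exponent \<open>g\<close> the flux stays
  bounded.
\<close>
lemma flux_from_decay:
  assumes "decays \<alpha> \<beta>" and g: "real N - \<beta> * p \<le> g" "g \<noteq> 0"
  shows "\<exists>A\<ge>0. \<forall>\<^sub>F r in at_top. zsol \<alpha> r \<le> A * \<psi> r powr (max 0 g)"
proof -
  obtain c r0 where c: "0 < c" "0 < r0" "\<And>r. r0 \<le> r \<Longrightarrow> c * \<psi> r \<le> \<psi>' r" "\<And>r. r0 \<le> r \<Longrightarrow> 1 \<le> \<psi> r"
    using exponential_growth by metis
  obtain C where "\<forall>\<^sub>F r in at_top. usol \<alpha> r \<le> C * \<psi> r powr (- \<beta>)"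
    using assms(1) unfolding decays_def by blast
  then obtain r1 where r1: "\<And>r. r1 \<le> r \<Longrightarrow> usol \<alpha> r \<le> C * \<psi> r powr (- \<beta>)"
    by (auto simp: eventually_at_top_linorder)
  define a where "a = max r0 r1"
  have a: "0 < a" "r0 \<le> a" "r1 \<le> a" using c by (auto simp: a_def)
  have C: "0 \<le> C"
  proof -
    have "0 < C * \<psi> a powr (- \<beta>)" using r1[of a] pos[of a] a by simp
    then show ?thesis by (simp add: zero_less_mult_iff)
  qed
  define D where "D = C powr p / (c * g)"
  have zb: "zsol \<alpha> r \<le> zsol \<alpha> a + D * \<psi> r powr g - D * \<psi> a powr g" if r: "a \<le> r" for r
  proof -
    have "zsol \<alpha> r - C powr p / (c * g) * \<psi> r powr g \<le> zsol \<alpha> a - C powr p / (c * g) * \<psi> a powr g"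
    proof (rule integrate_psi_power[OF c(1) a(1) _ order_refl r _ g(2), where f' = "\<lambda>x. \<psi> x ^ N * nonlin (usol \<alpha> x)"])
      fix x assume x: "a \<le> x"
      then have x0: "0 < x" and x1: "1 \<le> \<psi> x" using a c(4)[of x] by auto
      show "c * \<psi> x \<le> \<psi>' x" using c(3)[of x] x a by simp
      show "(zsol \<alpha> has_real_derivative \<psi> x ^ N * nonlin (usol \<alpha> x)) (at x)"
        by (rule usol_has_derivative(2)[OF al x0])
      have "nonlin (usol \<alpha> x) \<le> (C * \<psi> x powr (- \<beta>)) powr p"
        using r1[of x] x a pos[of x] x0 p1 by (simp add: nonlin_pos powr_mono2)
      also have "\<dots> = C powr p * \<psi> x powr (- \<beta> * p)"
        using C psi_nonneg[of x] x0 by (simp add: powr_mult powr_powr)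
      finally have "\<psi> x ^ N * nonlin (usol \<alpha> x) \<le> \<psi> x powr N * (C powr p * \<psi> x powr (- \<beta> * p))"
        by (simp add: psi_power_powr[OF x0] mult_left_mono)
      also have "\<dots> = C powr p * \<psi> x powr (real N - \<beta> * p)"
        by (simp add: powr_add[symmetric])
      also have "\<dots> \<le> C powr p * \<psi> x powr g"
        using g(1) x1 by (intro mult_left_mono powr_mono) auto
      finally show "\<psi> x ^ N * nonlin (usol \<alpha> x) \<le> C powr p * \<psi> x powr g" .
    qed simp
    then show ?thesis by (simp add: D_def)
  qed
  define A where "A = zsol \<alpha> a + \<bar>D\<bar> * (1 + \<psi> a powr g)"
  have za: "0 \<le> zsol \<alpha> a" using zsol_nonneg a by simp
  have "zsol \<alpha> r \<le> A * \<psi> r powr (max 0 g)" if r: "a \<le> r" for r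
  proof -
    have P: "1 \<le> \<psi> r" using c(4)[of r] r a by simp
    have one: "1 \<le> \<psi> r powr (max 0 g)" using P by (simp add: ge_one_powr_ge_zero)
    have "D * \<psi> r powr g \<le> \<bar>D\<bar> * \<psi> r powr (max 0 g)"
      using P by (intro mult_mono powr_mono) auto
    moreover have "- D * \<psi> a powr g \<le> \<bar>D\<bar> * \<psi> a powr g"
      by (intro mult_right_mono) auto
    then have "- (D * \<psi> a powr g) \<le> \<bar>D\<bar> * \<psi> a powr g * 1" by simp
    moreover have "\<bar>D\<bar> * \<psi> a powr g * 1 \<le> \<bar>D\<bar> * \<psi> a powr g * \<psi> r powr (max 0 g)"
      using one by (intro mult_left_mono) auto
    moreover have "zsol \<alpha> a * 1 \<le> zsol \<alpha> a * \<psi> r powr (max 0 g)"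
      using one za by (intro mult_left_mono) auto
    ultimately have "zsol \<alpha> a + D * \<psi> r powr g - D * \<psi> a powr g \<le>
      zsol \<alpha> a * \<psi> r powr (max 0 g) + \<bar>D\<bar> * \<psi> r powr (max 0 g) + \<bar>D\<bar> * \<psi> a powr g * \<psi> r powr (max 0 g)"
      by linarith
    also have "\<dots> = A * \<psi> r powr (max 0 g)" by (simp add: A_def algebra_simps)
    finally show ?thesis using zb[OF r] by simp
  qed
  moreover have "0 \<le> A" using za by (simp add: A_def)
  ultimately show ?thesis unfolding eventually_at_top_linorder by blast
qed

text \<open>
  Each step of the bootstrap multiplies the decay exponent by more than 1, as long as the flux \<open>z\<close> is not
  yet known to be bounded. The factor \<open>(1 + p) / 2 < p\<close> avoids the logarithmic borderline case.
\<close>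
lemma decay_imp_fast:
  assumes "decays \<alpha> \<beta>" "0 < \<beta>"
  shows "fast \<alpha>"
proof -
  define q where "q = (1 + p) / 2"
  have q: "1 < q" "q < p" using p1 by (auto simp: q_def)
  have final: "fast \<alpha>" if b: "decays \<alpha> \<beta>" "0 < \<beta>" "real N < \<beta> * p" for \<beta>
  proof -
    have m: "max 0 (real N - \<beta> * p) = 0" using b by simp
    obtain A where A: "0 \<le> A" "\<forall>\<^sub>F r in at_top. zsol \<alpha> r \<le> A * \<psi> r powr 0"
      using flux_from_decay[OF b(1), of "real N - \<beta> * p"] b(3) unfolding m by auto
    have zb: "\<forall>\<^sub>F r in at_top. zsol \<alpha> r \<le> A"
      using A(2) eventually_gt_at_top[of 0]
    proof eventually_elim
      case (elim r)
      then show ?case using psi_pos[of r] by simp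
    qed
    have "decays \<alpha> (real N)"
      by (rule decay_from_flux[OF decays_tendsto[OF b(1,2)] _ A(1)]) (use N2 A(2) in auto)
    then obtain C where C: "\<forall>\<^sub>F r in at_top. usol \<alpha> r \<le> C * \<psi> r powr (- real N)"
      unfolding decays_def by blast
    have "\<forall>\<^sub>F r in at_top. usol \<alpha> r \<le> max A C * \<psi> r powr (- real N) \<and> zsol \<alpha> r \<le> max A C"
      using C zb
    proof eventually_elim
      case (elim r)
      have "C * \<psi> r powr (- real N) \<le> max A C * \<psi> r powr (- real N)"
        by (intro mult_right_mono) auto
      then show ?case using elim by auto
    qed
    then show ?thesis unfolding fast_def by blast
  qed
  have "fast \<alpha>" if "decays \<alpha> \<beta>" "0 < \<beta>" "real N < \<beta> * q ^ n * p" for n \<beta>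
    using that
  proof (induction n arbitrary: \<beta>)
    case 0
    then show ?case using final by simp
  next
    case (Suc n)
    show ?case
    proof (cases "real N < \<beta> * p")
      case True
      then show ?thesis using final Suc.prems by blast
    next
      case False
      then have le: "\<beta> * p \<le> real N" by simp
      have lt: "\<beta> * q < real N" using Suc.prems(2) q le by (smt (verit) mult_strict_left_mono)
      have "real N - \<beta> * p \<le> real N - \<beta> * q" using Suc.prems(2) q by simp
      then obtain A where A: "0 \<le> A" "\<forall>\<^sub>F r in at_top. zsol \<alpha> r \<le> A * \<psi> r powr (max 0 (real N - \<beta> * q))"
        using flux_from_decay[OF Suc.prems(1), of "real N - \<beta> * q"] lt by auto
      have "decays \<alpha> (\<beta> * q)"
        by (rule decay_from_flux[OF decays_tendsto[OF Suc.prems(1,2)] _ A(1)])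
           (use A(2) lt Suc.prems(2) q in \<open>auto simp: max_def split: if_splits\<close>)
      then show ?thesis
        by (rule Suc.IH) (use Suc.prems q in \<open>auto simp: mult_ac\<close>)
    qed
  qed
  moreover obtain n where "real N / (\<beta> * p) < q ^ n" using real_arch_pow[OF q(1)] by blast
  then have "real N < \<beta> * q ^ n * p" using assms(2) p1 by (simp add: field_simps)
  ultimately show ?thesis using assms by blast
qed

text \<open>
  For a decreasing \<open>u\<close>, square integrability bounds \<open>u(r)\<^sup>2\<close> by a multiple of the inverse of
  \<open>\<integral>\<^sub>0\<^sup>r \<psi>\<^sup>N\<close>. As \<open>\<psi>' \<le> \<psi>\<^sup>1\<^sup>+\<^sup>\<delta>\<close> eventually, this integral is at least of the order
  \<open>\<psi>\<^sup>N\<^sup>-\<^sup>\<delta>\<close>, which gives a first positive decay exponent for the bootstrap.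
\<close>
lemma square_integrable_imp_fast:
  assumes K: "\<And>R. 0 \<le> R \<Longrightarrow> integral {0..R} (\<lambda>r. (usol \<alpha> r)\<^sup>2 * \<psi> r ^ N) \<le> K"
  shows "fast \<alpha>"
proof -
  obtain c r0 where c: "0 < r0" "\<And>r. r0 \<le> r \<Longrightarrow> 1 \<le> \<psi> r"
    using exponential_growth by metis
  have "\<forall>\<^sub>F r in at_top. \<psi>' r / \<psi> r * \<psi> r powr (- \<delta>) < 1"
    by (rule order_tendstoD(2)[OF rates_negligible(1)]) simp
  then obtain r1 where r1: "\<And>r. r1 \<le> r \<Longrightarrow> \<psi>' r / \<psi> r * \<psi> r powr (- \<delta>) < 1"
    by (auto simp: eventually_at_top_linorder)
  define a where "a = max r0 r1"
  have a: "0 < a" "r0 \<le> a" "r1 \<le> a" using c by (auto simp: a_def)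
  define b where "b = real N - \<delta>"
  have b: "0 < b" using delta_bounds by (simp add: b_def)
  have rate: "\<psi> x powr (b - 1) * \<psi>' x \<le> \<psi> x ^ N" if x: "a \<le> x" for x
  proof -
    have x0: "0 < x" and P: "0 < \<psi> x" using x a psi_pos[of x] by auto
    have "\<psi> x powr real N * (\<psi>' x / \<psi> x * \<psi> x powr (- \<delta>)) \<le> \<psi> x powr real N * 1"
      using r1[of x] x a by (intro mult_left_mono) auto
    moreover have "\<psi> x powr real N * (\<psi>' x / \<psi> x * \<psi> x powr (- \<delta>)) = \<psi> x powr (b - 1) * \<psi>' x"
    proof -
      have "\<psi> x powr (b - 1) = \<psi> x powr real N * \<psi> x powr (- \<delta>) / \<psi> x"
        using P by (simp add: b_def powr_diff powr_minus_divide)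
      then show ?thesis by simp
    qed
    ultimately show ?thesis by (simp add: psi_power_powr[OF x0])
  qed
  define J where "J r = integral {0..r} (\<lambda>r. (usol \<alpha> r)\<^sup>2 * \<psi> r ^ N)" for r
  have cont: "continuous_on {0..r} (\<lambda>r. (usol \<alpha> r)\<^sup>2 * \<psi> r ^ N)" for r
    by (intro continuous_intros continuous_on_subset[OF usol_cont[OF al]] continuous_on_subset[OF psi_cont(1)]) auto
  have J0: "0 \<le> J r" for r
    unfolding J_def using psi_nonneg by (intro integral_nonneg integrable_continuous_interval cont) auto
  have dJ: "(J has_real_derivative (usol \<alpha> x)\<^sup>2 * \<psi> x ^ N) (at x)" if "0 < x" for x
    using integral_has_real_derivative[OF cont[of "x + 1"], of x] that
    unfolding J_def by (simp add: at_within_Icc_at)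
  define C where "C = b * K + \<alpha>\<^sup>2 * \<psi> a powr b"
  have main: "(usol \<alpha> r)\<^sup>2 * \<psi> r powr b \<le> C" if r: "a \<le> r" for r
  proof -
    have "J a - (usol \<alpha> r)\<^sup>2 / b * \<psi> a powr b \<le> J r - (usol \<alpha> r)\<^sup>2 / b * \<psi> r powr b"
    proof (rule DERIV_nonneg_imp_nondecreasing[of a r "\<lambda>x. J x - (usol \<alpha> r)\<^sup>2 / b * \<psi> x powr b", OF r])
      fix x assume x: "a \<le> x" "x \<le> r"
      have x0: "0 < x" using x a by simp
      have D: "((\<lambda>x. J x - (usol \<alpha> r)\<^sup>2 / b * \<psi> x powr b) has_real_derivative
          (usol \<alpha> x)\<^sup>2 * \<psi> x ^ N - (usol \<alpha> r)\<^sup>2 / b * (b * \<psi> x powr (b - 1) * \<psi>' x)) (at x)"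
        by (intro DERIV_diff dJ DERIV_cmult psi_powr_deriv x0)
      have "(usol \<alpha> r)\<^sup>2 / b * (b * \<psi> x powr (b - 1) * \<psi>' x) = (usol \<alpha> r)\<^sup>2 * (\<psi> x powr (b - 1) * \<psi>' x)"
        using b by simp
      also have "\<dots> \<le> (usol \<alpha> x)\<^sup>2 * \<psi> x ^ N"
        using rate[OF x(1)] usol_antimono[OF al, of x r] pos[of r] x x0 psi'_nonneg[OF x0]
        by (intro mult_mono power_mono) auto
      finally show "\<exists>y. ((\<lambda>x. J x - (usol \<alpha> r)\<^sup>2 / b * \<psi> x powr b) has_real_derivative y) (at x) \<and> 0 \<le> y"
        using D by auto
    qed
    then have "(usol \<alpha> r)\<^sup>2 / b * \<psi> r powr b \<le> K + (usol \<alpha> r)\<^sup>2 / b * \<psi> a powr b"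
      using J0[of a] K[of r] r a by (simp add: J_def)
    then have "b * ((usol \<alpha> r)\<^sup>2 / b * \<psi> r powr b) \<le> b * (K + (usol \<alpha> r)\<^sup>2 / b * \<psi> a powr b)"
      by (rule mult_left_mono) (use b in simp)
    then have "(usol \<alpha> r)\<^sup>2 * \<psi> r powr b \<le> b * K + (usol \<alpha> r)\<^sup>2 * \<psi> a powr b"
      using b by (simp add: distrib_left)
    also have "(usol \<alpha> r)\<^sup>2 * \<psi> a powr b \<le> \<alpha>\<^sup>2 * \<psi> a powr b"
      using usol_antimono[OF al, of 0 r] usol_0[OF al] pos[of r] r a
      by (intro mult_right_mono power_mono) auto
    finally show ?thesis by (simp add: C_def)
  qed
  have "usol \<alpha> r \<le> sqrt C * \<psi> r powr (- (b / 2))" if r: "a \<le> r" for r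
  proof -
    have P: "0 < \<psi> r" using psi_pos r a by simp
    have "(usol \<alpha> r * \<psi> r powr (b / 2))\<^sup>2 \<le> C"
      using main[OF r] by (simp add: power_mult_distrib power2_eq_square[of "_ powr _"] powr_add[symmetric])
    then have "usol \<alpha> r * \<psi> r powr (b / 2) \<le> sqrt C" by (rule real_le_rsqrt)
    then have "usol \<alpha> r * \<psi> r powr (b / 2) * \<psi> r powr (- (b / 2)) \<le> sqrt C * \<psi> r powr (- (b / 2))"
      by (intro mult_right_mono) auto
    then show ?thesis using P by (simp add: mult.assoc powr_add[symmetric])
  qed
  then have "decays \<alpha> (b / 2)" unfolding decays_def eventually_at_top_linorder by blast
  then show ?thesis by (rule decay_imp_fast) (use b in simp)
qed

text \<open>
  With \<open>u \<le> C \<psi>\<^sup>-\<^sup>N\<close> and a bounded flux, every term of the energy is bounded by squares and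
  products of \<open>\<psi>\<^sup>-\<^sup>\<delta>\<close>, \<open>\<psi>\<^sup>-\<^sup>\<delta> \<psi>' / \<psi>\<close> and \<open>\<psi>\<^sup>-\<^sup>\<delta> \<psi>'' / \<psi>'\<close>, or by a negative power of
  \<open>\<psi>\<close>. This is exactly what the growth conditions for \<open>l = \<infinity>\<close> control.
\<close>
lemma fast_imp_energy_vanishes:
  assumes "fast \<alpha>"
  shows "(energy (usol \<alpha>) (zsol \<alpha>) \<longlongrightarrow> 0) at_top"
proof -
  obtain c r0 where c: "0 < c" "0 < r0" "\<And>r. r0 \<le> r \<Longrightarrow> c * \<psi> r \<le> \<psi>' r" "\<And>r. r0 \<le> r \<Longrightarrow> 0 \<le> \<psi>'' r"
    using exponential_growth by metis
  obtain C where C: "\<forall>\<^sub>F r in at_top. usol \<alpha> r \<le> C * \<psi> r powr (- real N) \<and> zsol \<alpha> r \<le> C"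
    using assms unfolding fast_def by blast
  define h where "h r = \<psi>' r / \<psi> r * \<psi> r powr (- \<delta>)" for r
  define k where "k r = \<psi>'' r / \<psi>' r * \<psi> r powr (- \<delta>)" for r
  have hk: "(h \<longlongrightarrow> 0) at_top" "(k \<longlongrightarrow> 0) at_top"
    using rates_negligible unfolding h_def k_def by auto
  have ev: "\<forall>\<^sub>F r in at_top. 0 < r \<and> 0 < usol \<alpha> r \<and> 0 \<le> zsol \<alpha> r \<and> 0 < \<psi> r \<and> 0 < \<psi>' r \<and> 0 \<le> \<psi>'' r \<and>
      usol \<alpha> r \<le> C * \<psi> r powr (- real N) \<and> zsol \<alpha> r \<le> C"
    using C eventually_ge_at_top[of r0]
  proof eventually_elim
    case (elim r)
    have r: "0 < r" using elim c by simp
    then have P: "0 < \<psi> r" by (rule psi_pos)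
    have "0 < c * \<psi> r" using c P by simp
    also have "\<dots> \<le> \<psi>' r" using c elim by simp
    finally show ?case using elim r P pos[of r] zsol_nonneg[of r] c(4)[of r] by auto
  qed
  have v0: "(scaled (usol \<alpha>) \<longlongrightarrow> 0) at_top"
  proof (rule Lim_null_comparison)
    show "((\<lambda>r. C * \<psi> r powr (\<delta> - real N)) \<longlongrightarrow> 0) at_top"
      using psi_powr_neg_tendsto[of "\<delta> - real N"] delta_bounds by (intro tendsto_mult_right_zero) auto
    show "\<forall>\<^sub>F r in at_top. norm (scaled (usol \<alpha>) r) \<le> C * \<psi> r powr (\<delta> - real N)"
      using ev
    proof eventually_elim
      case (elim r)
      then have "scaled (usol \<alpha>) r \<le> \<psi> r powr \<delta> * (C * \<psi> r powr (- real N))"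
        by (simp add: scaled_def mult_left_mono)
      also have "\<dots> = C * (\<psi> r powr \<delta> * \<psi> r powr (- real N))" by simp
      also have "\<psi> r powr \<delta> * \<psi> r powr (- real N) = \<psi> r powr (\<delta> - real N)" by (simp add: powr_add[symmetric])
      finally show ?case using scaled_pos[of r "usol \<alpha>"] elim by simp
    qed
  qed
  have y0: "(momentum (usol \<alpha>) (zsol \<alpha>) \<longlongrightarrow> 0) at_top"
  proof (rule Lim_null_comparison)
    have "((\<lambda>r. \<delta> * C * h r + C * \<psi> r powr (- \<delta>)) \<longlongrightarrow> \<delta> * C * 0 + C * 0) at_top"
      using delta_bounds(4) by (intro tendsto_intros hk psi_powr_neg_tendsto) auto
    then show "((\<lambda>r. \<delta> * C * h r + C * \<psi> r powr (- \<delta>)) \<longlongrightarrow> 0) at_top" by simp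
    show "\<forall>\<^sub>F r in at_top. norm (momentum (usol \<alpha>) (zsol \<alpha>) r) \<le> \<delta> * C * h r + C * \<psi> r powr (- \<delta>)"
      using ev
    proof eventually_elim
      case (elim r)
      let ?A = "\<delta> * \<psi> r powr (real N - \<delta> - 1) * \<psi>' r"
      have A: "0 \<le> ?A" using elim delta_bounds(4) by simp
      have "?A * usol \<alpha> r \<le> ?A * (C * \<psi> r powr (- real N))"
        using A elim by (intro mult_left_mono) auto
      also have "\<dots> = \<delta> * C * \<psi>' r * (\<psi> r powr (real N - \<delta> - 1) * \<psi> r powr (- real N))" by simp
      also have "\<psi> r powr (real N - \<delta> - 1) * \<psi> r powr (- real N) = \<psi> r powr (- \<delta>) / \<psi> r"
        using elim by (simp add: powr_diff powr_minus_divide)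
      also have "\<delta> * C * \<psi>' r * (\<psi> r powr (- \<delta>) / \<psi> r) = \<delta> * C * h r"
        by (simp add: h_def)
      finally have 1: "?A * usol \<alpha> r \<le> \<delta> * C * h r" .
      have 2: "\<psi> r powr (- \<delta>) * zsol \<alpha> r \<le> C * \<psi> r powr (- \<delta>)"
        using elim mult_left_mono[of "zsol \<alpha> r" C "\<psi> r powr (- \<delta>)"] by (simp add: mult.commute)
      have "0 \<le> ?A * usol \<alpha> r" "0 \<le> \<psi> r powr (- \<delta>) * zsol \<alpha> r" using A elim by simp_all
      then show ?case unfolding momentum_def using 1 2 by simp
    qed
  qed
  have g0: "((\<lambda>r. G r * (scaled (usol \<alpha>) r)\<^sup>2) \<longlongrightarrow> 0) at_top"
  proof (rule Lim_null_comparison)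
    have "((\<lambda>r. \<delta> * C\<^sup>2 * ((real N - 1 - \<delta>) * (h r)\<^sup>2 + k r * h r)) \<longlongrightarrow>
        \<delta> * C\<^sup>2 * ((real N - 1 - \<delta>) * 0\<^sup>2 + 0 * 0)) at_top"
      by (intro tendsto_intros hk)
    then show "((\<lambda>r. \<delta> * C\<^sup>2 * ((real N - 1 - \<delta>) * (h r)\<^sup>2 + k r * h r)) \<longlongrightarrow> 0) at_top" by simp
    show "\<forall>\<^sub>F r in at_top. norm (G r * (scaled (usol \<alpha>) r)\<^sup>2)
        \<le> \<delta> * C\<^sup>2 * ((real N - 1 - \<delta>) * (h r)\<^sup>2 + k r * h r)"
      using ev
    proof eventually_elim
      case (elim r)
      let ?b = "(\<delta> + 1 - real N) * (\<psi>' r)\<^sup>2 - \<psi>'' r * \<psi> r"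
      let ?B = "(real N - 1 - \<delta>) * (\<psi>' r)\<^sup>2 + \<psi>'' r * \<psi> r"
      have B: "0 \<le> ?B" using delta_bounds(3) elim by simp
      have "?b = - ?B" by (simp add: algebra_simps)
      then have b: "\<bar>?b\<bar> = ?B" using B by simp
      have u2: "(usol \<alpha> r)\<^sup>2 \<le> (C * \<psi> r powr (- real N))\<^sup>2" using elim by (intro power_mono) auto
      have "norm (G r * (scaled (usol \<alpha>) r)\<^sup>2) = \<delta> * \<psi> r powr (2 * (real N - \<delta> - 1)) * ?B * (usol \<alpha> r)\<^sup>2"
        unfolding G_scaled using delta_bounds(4) b by (simp add: abs_mult)
      also have "\<dots> \<le> \<delta> * \<psi> r powr (2 * (real N - \<delta> - 1)) * ?B * (C * \<psi> r powr (- real N))\<^sup>2"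
        using u2 B delta_bounds(4) by (intro mult_left_mono) auto
      also have "\<dots> = \<delta> * C\<^sup>2 * ?B * (\<psi> r powr (2 * (real N - \<delta> - 1)) * (\<psi> r powr (- real N))\<^sup>2)"
        by (simp add: power_mult_distrib)
      also have "\<psi> r powr (2 * (real N - \<delta> - 1)) * (\<psi> r powr (- real N))\<^sup>2
          = (\<psi> r powr (- \<delta>) / \<psi> r)\<^sup>2"
      proof -
        have "2 * (real N - \<delta> - 1) + (- real N + - real N) = (- \<delta> - 1) + (- \<delta> - 1)" by simp
        then have "\<psi> r powr (2 * (real N - \<delta> - 1)) * (\<psi> r powr (- real N))\<^sup>2 = (\<psi> r powr (- \<delta> - 1))\<^sup>2"
          unfolding power2_eq_square by (simp only: powr_add[symmetric])
        moreover have "\<psi> r powr (- \<delta> - 1) = \<psi> r powr (- \<delta>) / \<psi> r" using elim by (simp add: powr_diff)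
        ultimately show ?thesis by simp
      qed
      also have "\<delta> * C\<^sup>2 * ?B * (\<psi> r powr (- \<delta>) / \<psi> r)\<^sup>2
          = \<delta> * C\<^sup>2 * ((real N - 1 - \<delta>) * (h r)\<^sup>2 + k r * h r)"
        using elim by (simp add: h_def k_def field_simps power2_eq_square)
      finally show ?case .
    qed
  qed
  have "((\<lambda>r. scaled (usol \<alpha>) r powr (p + 1)) \<longlongrightarrow> 0) at_top"
  proof (rule tendsto_zero_powrI[OF v0 tendsto_const])
    show "\<forall>\<^sub>F r in at_top. 0 \<le> scaled (usol \<alpha>) r"
      using ev by eventually_elim (simp add: scaled_def)
  qed (use p1 in auto)
  then have "((\<lambda>r. (momentum (usol \<alpha>) (zsol \<alpha>) r)\<^sup>2 / 2 + scaled (usol \<alpha>) r powr (p + 1) / (p + 1)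
      + G r * (scaled (usol \<alpha>) r)\<^sup>2 / 2) \<longlongrightarrow> 0\<^sup>2 / 2 + 0 / (p + 1) + 0 / 2) at_top"
    using p1 by (intro tendsto_intros y0 g0) auto
  then show ?thesis unfolding energy_def[abs_def] by simp
qed

end

end

section \<open>Nonnegative energy, small initial values and the threshold\<close>

context subcritical_model
begin

lemma energy_bracket:
  assumes r: "0 < r" and u: "0 < u r"
  shows "energy u z r = (momentum u z r)\<^sup>2 / 2 + \<psi> r powr (2 * (real N - \<delta> - 1)) * (u r)\<^sup>2 / 2 *
    (\<delta> * ((\<delta> + 1 - real N) * (\<psi>' r)\<^sup>2 - \<psi>'' r * \<psi> r) + 2 / (p + 1) * u r powr (p - 1) * (\<psi> r)\<^sup>2)"
proof -
  have P: "0 < \<psi> r" using psi_pos r by simp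
  have e: "\<delta> * (p + 1) = 2 * (real N - \<delta> - 1) + 2" using delta_eq by (simp add: algebra_simps)
  have "scaled u r powr (p + 1) = \<psi> r powr (\<delta> * (p + 1)) * u r powr (p + 1)"
    using P u by (simp add: scaled_def powr_mult powr_powr)
  also have "\<psi> r powr (\<delta> * (p + 1)) = \<psi> r powr (2 * (real N - \<delta> - 1)) * (\<psi> r)\<^sup>2"
    unfolding e powr_add using P by (simp add: powr_numeral)
  also have "u r powr (p + 1) = u r powr (p - 1) * (u r)\<^sup>2"
    using u powr_add[of "u r" "p - 1" 2] by (simp add: powr_numeral add.commute)
  finally have "scaled u r powr (p + 1) =
    \<psi> r powr (2 * (real N - \<delta> - 1)) * (u r)\<^sup>2 * (u r powr (p - 1) * (\<psi> r)\<^sup>2)" by simp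
  then show ?thesis
    unfolding energy_def G_scaled using p1 by (simp add: field_simps)
qed

text \<open>
  A nonnegative momentum means \<open>- u' / u \<le> \<delta> \<psi>' / \<psi>\<close>, and then the momentum contributes at most
  \<open>\<delta>\<^sup>2 \<psi>'\<^sup>2\<close>, up to the common factor of all terms. Near convexity of \<open>\<psi>\<close> lets \<open>G\<close> contribute
  about \<open>\<delta> (\<delta> - N) \<psi>'\<^sup>2\<close>. The sum is negative because \<open>2 \<delta> < N\<close>, with room for two errors of
  size \<open>\<epsilon>\<close>, from convexity and from the nonlinear term.
\<close>
lemma negative_energy:
  assumes r: "0 < r" and u: "0 < u r" and z: "0 \<le> z r" and y: "0 \<le> momentum u z r"
    and p': "0 < \<psi>' r" and convex: "(1 - \<epsilon>) * (\<psi>' r)\<^sup>2 \<le> \<psi>'' r * \<psi> r"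
    and small: "2 / (p + 1) * u r powr (p - 1) * (\<psi> r)\<^sup>2 \<le> \<delta> * \<epsilon> * (\<psi>' r)\<^sup>2"
    and eps: "2 * \<epsilon> < real N - 2 * \<delta>"
  shows "energy u z r < 0"
proof -
  have P: "0 < \<psi> r" using psi_pos r by simp
  have d: "0 < \<delta>" by (rule delta_bounds)
  let ?W = "\<psi> r powr (2 * (real N - \<delta> - 1)) * (u r)\<^sup>2 / 2"
  have W: "0 < ?W" using P u by simp
  have "0 \<le> \<psi> r powr (- \<delta>) * z r" using z by simp
  then have "momentum u z r \<le> \<delta> * \<psi> r powr (real N - \<delta> - 1) * \<psi>' r * u r"
    unfolding momentum_def by linarith
  then have "(momentum u z r)\<^sup>2 \<le> (\<delta> * \<psi> r powr (real N - \<delta> - 1) * \<psi>' r * u r)\<^sup>2"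
    using y by (rule power_mono)
  also have "\<dots> = 2 * ?W * (\<delta>\<^sup>2 * (\<psi>' r)\<^sup>2)"
  proof -
    have "(\<psi> r powr (real N - \<delta> - 1))\<^sup>2 = \<psi> r powr (2 * (real N - \<delta> - 1))"
      by (simp only: power2_eq_square powr_add[symmetric] mult_2)
    then show ?thesis by (simp add: power_mult_distrib)
  qed
  finally have 1: "(momentum u z r)\<^sup>2 / 2 \<le> ?W * (\<delta>\<^sup>2 * (\<psi>' r)\<^sup>2)" by simp
  have "\<delta> * ((\<delta> + 1 - real N) * (\<psi>' r)\<^sup>2 - \<psi>'' r * \<psi> r) \<le>
      \<delta> * ((\<delta> + 1 - real N) * (\<psi>' r)\<^sup>2 - (1 - \<epsilon>) * (\<psi>' r)\<^sup>2)"
    using convex d by (intro mult_left_mono) auto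
  then have "\<delta>\<^sup>2 * (\<psi>' r)\<^sup>2 + (\<delta> * ((\<delta> + 1 - real N) * (\<psi>' r)\<^sup>2 - \<psi>'' r * \<psi> r)
      + 2 / (p + 1) * u r powr (p - 1) * (\<psi> r)\<^sup>2)
    \<le> \<delta> * (2 * \<delta> + 2 * \<epsilon> - real N) * (\<psi>' r)\<^sup>2"
    using small by (simp add: algebra_simps power2_eq_square)
  also have "\<dots> < 0" using d eps p' by (intro mult_neg_pos mult_pos_neg) auto
  finally have 2: "\<delta>\<^sup>2 * (\<psi>' r)\<^sup>2 + (\<delta> * ((\<delta> + 1 - real N) * (\<psi>' r)\<^sup>2 - \<psi>'' r * \<psi> r)
      + 2 / (p + 1) * u r powr (p - 1) * (\<psi> r)\<^sup>2) < 0" .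
  have "energy u z r \<le> ?W * (\<delta>\<^sup>2 * (\<psi>' r)\<^sup>2 + (\<delta> * ((\<delta> + 1 - real N) * (\<psi>' r)\<^sup>2 - \<psi>'' r * \<psi> r)
      + 2 / (p + 1) * u r powr (p - 1) * (\<psi> r)\<^sup>2))"
    unfolding energy_bracket[where u = u and z = z, OF r u] distrib_left using 1 by (simp add: distrib_left)
  also have "\<dots> < 0" using W 2 by (rule mult_pos_neg)
  finally show ?thesis .
qed

text \<open>
  Where \<open>\<psi>\<close> is convex and \<open>u\<close> small, the part of the energy without the momentum is negative,
  because \<open>\<delta> < N - 1\<close>.
\<close>
lemma momentum_nonzero:
  assumes r: "0 < r" and u: "0 < u r" and E: "0 \<le> energy u z r"
    and p': "0 < \<psi>' r" and convex: "0 \<le> \<psi>'' r"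
    and small: "2 / (p + 1) * u r powr (p - 1) * (\<psi> r)\<^sup>2 \<le> \<delta> * \<epsilon> * (\<psi>' r)\<^sup>2"
    and eps: "\<epsilon> < real N - 1 - \<delta>"
  shows "momentum u z r \<noteq> 0"
proof
  assume "momentum u z r = 0"
  have P: "0 < \<psi> r" using psi_pos r by simp
  have d: "0 < \<delta>" by (rule delta_bounds)
  have "\<delta> * ((\<delta> + 1 - real N) * (\<psi>' r)\<^sup>2 - \<psi>'' r * \<psi> r) \<le> \<delta> * ((\<delta> + 1 - real N) * (\<psi>' r)\<^sup>2)"
    using convex P d by (intro mult_left_mono) auto
  then have "\<delta> * ((\<delta> + 1 - real N) * (\<psi>' r)\<^sup>2 - \<psi>'' r * \<psi> r)
      + 2 / (p + 1) * u r powr (p - 1) * (\<psi> r)\<^sup>2 \<le> \<delta> * (\<epsilon> + \<delta> + 1 - real N) * (\<psi>' r)\<^sup>2"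
    using small by (simp add: algebra_simps)
  also have "\<dots> < 0" using d eps p' by (intro mult_neg_pos mult_pos_neg) auto
  finally have "\<delta> * ((\<delta> + 1 - real N) * (\<psi>' r)\<^sup>2 - \<psi>'' r * \<psi> r)
      + 2 / (p + 1) * u r powr (p - 1) * (\<psi> r)\<^sup>2 < 0" .
  then have "energy u z r < 0"
    unfolding energy_bracket[where u = u and z = z, OF r u] \<open>momentum u z r = 0\<close>
    using P u by (simp add: mult_pos_neg)
  then show False using E by simp
qed

end

context expanding_model
begin

text \<open>
  If \<open>u\<close> stayed above a positive constant, the flux would grow like \<open>\<psi>\<^sup>N\<close>, because the bounded
  rate \<open>\<psi>' / \<psi>\<close> makes \<open>\<integral>\<psi>\<^sup>N\<close> comparable to \<open>\<psi>\<^sup>N\<close>. Then the slope of \<open>u\<close> would stay away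
  from 0 and \<open>u\<close> would become negative.
\<close>
lemma usol_tendsto_0_if_bounded_rate:
  assumes al: "0 < \<alpha>" and pos: "\<And>r. 0 \<le> r \<Longrightarrow> 0 < usol \<alpha> r"
    and rate: "\<forall>\<^sub>F r in at_top. \<psi>' r / \<psi> r \<le> C"
  shows "(usol \<alpha> \<longlongrightarrow> 0) at_top"
proof -
  obtain r0 where r0: "0 < r0" "\<And>r. r0 \<le> r \<Longrightarrow> 1 \<le> \<psi> r"
    using exponential_growth by metis
  from rate obtain r1 where r1: "\<And>r. r1 \<le> r \<Longrightarrow> \<psi>' r / \<psi> r \<le> C"
    by (auto simp: eventually_at_top_linorder)
  define D where "D = max C 1"
  define a where "a = max r0 r1"
  have a: "0 < a" "r0 \<le> a" "r1 \<le> a" using r0 by (auto simp: a_def)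
  have D: "0 < D" by (simp add: D_def)
  have ND: "0 < real N * D" using N2 D by simp
  have p'le: "\<psi>' r \<le> D * \<psi> r" if "a \<le> r" for r
  proof -
    have "\<psi>' r / \<psi> r \<le> D" using r1[of r] that a by (simp add: D_def)
    then show ?thesis using psi_pos[of r] that a by (simp add: pos_divide_le_eq)
  qed
  have small: "\<exists>r>0. usol \<alpha> r < e" if e: "0 < e" for e
  proof (rule ccontr)
    assume "\<not> ?thesis"
    then have low: "\<And>r. 0 < r \<Longrightarrow> e \<le> usol \<alpha> r" by (meson not_less)
    define m where "m = e powr p / (real N * D)"
    have m: "0 < m" using e ND by (simp add: m_def)
    have zlow: "m * \<psi> r ^ N - m * \<psi> a ^ N \<le> zsol \<alpha> r" if r: "a \<le> r" for r
    proof -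
      have "zsol \<alpha> a - m * \<psi> a ^ N \<le> zsol \<alpha> r - m * \<psi> r ^ N"
      proof (rule DERIV_nonneg_imp_nondecreasing[of a r "\<lambda>x. zsol \<alpha> x - m * \<psi> x ^ N", OF r])
        fix x assume x: "a \<le> x" "x \<le> r"
        have x0: "0 < x" using x a by simp
        have D': "((\<lambda>x. zsol \<alpha> x - m * \<psi> x ^ N) has_real_derivative
            \<psi> x ^ N * nonlin (usol \<alpha> x) - m * (real N * \<psi> x ^ (N - 1) * \<psi>' x)) (at x)"
          using DERIV_diff[OF usol_has_derivative(2)[OF al x0] DERIV_cmult[OF DERIV_power[OF psi_has_derivative(1)[OF x0], of N], of m]]
          by (simp add: mult_ac)
        have "m * (real N * \<psi> x ^ (N - 1) * \<psi>' x) \<le> m * (real N * \<psi> x ^ (N - 1) * (D * \<psi> x))"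
          using p'le[OF x(1)] m psi_nonneg[of x] x0 by (intro mult_left_mono) auto
        also have "\<dots> = m * (real N * D) * (\<psi> x * \<psi> x ^ (N - 1))" by simp
        also have "\<dots> = e powr p * \<psi> x ^ N"
        proof -
          have "\<psi> x * \<psi> x ^ (N - 1) = \<psi> x ^ N" using N2 by (cases N) auto
          moreover have "m * (real N * D) = e powr p" using D N2 by (simp add: m_def)
          ultimately show ?thesis by simp
        qed
        also have "\<dots> \<le> nonlin (usol \<alpha> x) * \<psi> x ^ N"
          using nonlin_mono[OF low[OF x0]] nonlin_pos[OF e] psi_nonneg[of x] x0
          by (intro mult_right_mono) auto
        finally show "\<exists>y. ((\<lambda>x. zsol \<alpha> x - m * \<psi> x ^ N) has_real_derivative y) (at x) \<and> 0 \<le> y"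
          using D' by (intro exI[of _ "\<psi> x ^ N * nonlin (usol \<alpha> x) - m * (real N * \<psi> x ^ (N - 1) * \<psi>' x)"])
            (simp add: mult.commute)
      qed
      then show ?thesis using zsol_nonneg[OF al pos, of a] a by simp
    qed
    have "filterlim (\<lambda>r. \<psi> r) at_top at_top" by (rule psi_at_top)
    then have "\<forall>\<^sub>F r in at_top. 2 * \<psi> a ^ N \<le> \<psi> r" by (simp add: filterlim_at_top)
    then obtain b0 where b0: "\<And>r. b0 \<le> r \<Longrightarrow> 2 * \<psi> a ^ N \<le> \<psi> r" by (auto simp: eventually_at_top_linorder)
    define b where "b = max a b0"
    have b: "0 < b" "a \<le> b" "b0 \<le> b" using a by (auto simp: b_def)
    have slope: "m / 2 \<le> zsol \<alpha> r / \<psi> r ^ N" if r: "b \<le> r" for r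
    proof -
      have P: "1 \<le> \<psi> r" using r0(2)[of r] r b a by simp
      have "\<psi> r ^ 1 \<le> \<psi> r ^ N" using P N2 by (intro power_increasing) auto
      then have "2 * \<psi> a ^ N \<le> \<psi> r ^ N" using b0[of r] r b by simp
      then have "m * (2 * \<psi> a ^ N) \<le> m * \<psi> r ^ N" using m by (intro mult_left_mono) auto
      then have "m / 2 * \<psi> r ^ N \<le> zsol \<alpha> r" using zlow[of r] r b by simp
      then show ?thesis using P by (simp add: pos_le_divide_eq)
    qed
    define r where "r = b + 2 * \<alpha> / m"
    have r: "b \<le> r" using al m by (simp add: r_def)
    have "usol \<alpha> b + m / 2 * b \<ge> usol \<alpha> r + m / 2 * r"
    proof (rule DERIV_nonpos_imp_nonincreasing[of b r "\<lambda>x. usol \<alpha> x + m / 2 * x", OF r])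
      fix x assume x: "b \<le> x" "x \<le> r"
      then show "\<exists>y. ((\<lambda>x. usol \<alpha> x + m / 2 * x) has_real_derivative y) (at x) \<and> y \<le> 0"
        using slope[of x] DERIV_add[OF usol_has_derivative(1)[OF al, of x] DERIV_cmult_Id[of "m / 2"]] b
        by (intro exI[of _ "- (zsol \<alpha> x / \<psi> x ^ N) + m / 2"]) auto
    qed
    moreover have "m / 2 * r = m / 2 * b + \<alpha>" using m by (simp add: r_def field_simps)
    moreover have "usol \<alpha> b \<le> \<alpha>" using usol_antimono[OF al, of 0 b] usol_0[OF al] b by simp
    ultimately have "usol \<alpha> r \<le> 0" by linarith
    then show False using pos[of r] r b by simp
  qed
  show ?thesis
  proof (rule order_tendstoI)
    fix e :: real assume "e < 0"
    show "\<forall>\<^sub>F r in at_top. e < usol \<alpha> r"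
      using eventually_ge_at_top[of 0]
    proof eventually_elim
      case (elim r)
      then show ?case using pos[of r] \<open>e < 0\<close> by simp
    qed
  next
    fix e :: real assume "0 < e"
    then obtain r where r: "0 < r" "usol \<alpha> r < e" using small by blast
    show "\<forall>\<^sub>F s in at_top. usol \<alpha> s < e"
      using eventually_ge_at_top[of r]
    proof eventually_elim
      case (elim s)
      then show ?case using usol_antimono[OF al, of r s] r by simp
    qed
  qed
qed

text \<open>
  For \<open>l = \<infinity>\<close> because \<open>\<psi>' / \<psi>\<close> tends to infinity while \<open>u\<close> is bounded; for finite \<open>l\<close>
  because \<open>u\<close> tends to 0.
\<close>
lemma nonlinearity_negligible:
  assumes al: "0 < \<alpha>" and pos: "\<And>r. 0 \<le> r \<Longrightarrow> 0 < usol \<alpha> r" and e: "0 < \<eta>"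
  shows "\<forall>\<^sub>F r in at_top. 2 / (p + 1) * usol \<alpha> r powr (p - 1) * (\<psi> r)\<^sup>2 \<le> \<eta> * (\<psi>' r)\<^sup>2"
proof -
  obtain c r0 where c: "0 < c" "0 < r0" "\<And>r. r0 \<le> r \<Longrightarrow> c * \<psi> r \<le> \<psi>' r"
    using exponential_growth by metis
  have ev0: "\<forall>\<^sub>F r in at_top. 0 < \<psi> r \<and> c \<le> \<psi>' r / \<psi> r"
    using eventually_ge_at_top[of r0]
  proof eventually_elim
    case (elim r)
    then have "0 < \<psi> r" using psi_pos c by simp
    then show ?case using c(3)[OF elim] by (simp add: pos_le_divide_eq)
  qed
  have "\<forall>\<^sub>F r in at_top. 2 / (p + 1) * usol \<alpha> r powr (p - 1) \<le> \<eta> * (\<psi>' r / \<psi> r)\<^sup>2"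
  proof (cases "l = \<infinity>")
    case True
    define B where "B = sqrt (2 / (p + 1) * \<alpha> powr (p - 1) / \<eta>)"
    have "\<forall>\<^sub>F r in at_top. ereal B < ereal (\<psi>' r / \<psi> r)"
      by (rule order_tendstoD(1)[OF lim_h]) (simp add: True)
    then show ?thesis
      using eventually_ge_at_top[of 0]
    proof eventually_elim
      case (elim r)
      have B: "0 \<le> B" using p1 e by (simp add: B_def)
      have "usol \<alpha> r powr (p - 1) \<le> \<alpha> powr (p - 1)"
        using usol_antimono[OF al, of 0 r] usol_0[OF al] pos[of r] elim p1 by (intro powr_mono2) auto
      then have "2 / (p + 1) * usol \<alpha> r powr (p - 1) \<le> 2 / (p + 1) * \<alpha> powr (p - 1)"
        using p1 by (intro mult_left_mono) auto
      also have "\<dots> = \<eta> * B\<^sup>2" using e p1 by (simp add: B_def)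
      also have "\<dots> \<le> \<eta> * (\<psi>' r / \<psi> r)\<^sup>2"
        using elim B e by (intro mult_left_mono power_mono) auto
      finally show ?case .
    qed
  next
    case False
    then obtain L where L: "l = ereal L" using l_pos by (cases l) auto
    have "((\<lambda>r. \<psi>' r / \<psi> r) \<longlongrightarrow> L) at_top" using lim_h L by simp
    then have "\<forall>\<^sub>F r in at_top. \<psi>' r / \<psi> r < L + 1" by (rule order_tendstoD) simp
    then have "\<forall>\<^sub>F r in at_top. \<psi>' r / \<psi> r \<le> L + 1" by (rule eventually_mono) simp
    then have u0: "(usol \<alpha> \<longlongrightarrow> 0) at_top"
      using usol_tendsto_0_if_bounded_rate[OF al pos] by blast
    have "((\<lambda>r. usol \<alpha> r powr (p - 1)) \<longlongrightarrow> 0) at_top"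
    proof (rule tendsto_zero_powrI[OF u0 tendsto_const])
      show "\<forall>\<^sub>F r in at_top. 0 \<le> usol \<alpha> r"
        using eventually_ge_at_top[of 0] by eventually_elim (use pos in \<open>auto intro: less_imp_le\<close>)
    qed (use p1 in auto)
    then have lim: "((\<lambda>r. 2 / (p + 1) * usol \<alpha> r powr (p - 1)) \<longlongrightarrow> 0) at_top"
      by (rule tendsto_mult_right_zero)
    have "\<forall>\<^sub>F r in at_top. 2 / (p + 1) * usol \<alpha> r powr (p - 1) < \<eta> * c\<^sup>2"
      by (rule order_tendstoD(2)[OF lim]) (use e c in simp)
    then show ?thesis
      using ev0
    proof eventually_elim
      case (elim r)
      have "\<eta> * c\<^sup>2 \<le> \<eta> * (\<psi>' r / \<psi> r)\<^sup>2" using elim c e by (intro mult_left_mono power_mono) auto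
      then show ?case using elim by simp
    qed
  qed
  then show ?thesis
    using ev0
  proof eventually_elim
    case (elim r)
    then have "2 / (p + 1) * usol \<alpha> r powr (p - 1) * (\<psi> r)\<^sup>2 \<le> \<eta> * (\<psi>' r / \<psi> r)\<^sup>2 * (\<psi> r)\<^sup>2"
      by (intro mult_right_mono) auto
    then show ?case using elim by (simp add: power_divide)
  qed
qed

text \<open>
  Eventually the potential part of the
  energy is negative, so that the momentum has no zeros; at a large radius of near convexity it
  cannot be positive. So it stays negative, and \<open>\<psi>\<^sup>\<delta> u\<close> decreases.
\<close>
lemma energy_nonneg_imp_fast:
  assumes al: "0 < \<alpha>" and pos: "\<And>r. 0 \<le> r \<Longrightarrow> 0 < usol \<alpha> r"
    and E: "\<And>r. 0 < r \<Longrightarrow> 0 \<le> energy (usol \<alpha>) (zsol \<alpha>) r"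
  shows "fast \<alpha>"
proof -
  obtain c r0 where c: "0 < c" "0 < r0" "\<And>r. r0 \<le> r \<Longrightarrow> c * \<psi> r \<le> \<psi>' r" "\<And>r. r0 \<le> r \<Longrightarrow> 0 \<le> \<psi>'' r"
    using exponential_growth by metis
  define \<epsilon> where "\<epsilon> = min (real N - 2 * \<delta>) (real N - 1 - \<delta>) / 4"
  have eps: "0 < \<epsilon>" "2 * \<epsilon> < real N - 2 * \<delta>" "\<epsilon> < real N - 1 - \<delta>"
    using delta_bounds by (auto simp: \<epsilon>_def)
  have "\<forall>\<^sub>F r in at_top. 2 / (p + 1) * usol \<alpha> r powr (p - 1) * (\<psi> r)\<^sup>2 \<le> (\<delta> * \<epsilon>) * (\<psi>' r)\<^sup>2"
    by (rule nonlinearity_negligible[OF al pos]) (use eps delta_bounds(4) in simp_all)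
  then obtain r1 where r1: "\<And>r. r1 \<le> r \<Longrightarrow>
      2 / (p + 1) * usol \<alpha> r powr (p - 1) * (\<psi> r)\<^sup>2 \<le> (\<delta> * \<epsilon>) * (\<psi>' r)\<^sup>2"
    by (auto simp: eventually_at_top_linorder)
  define a where "a = max r0 r1"
  have a: "0 < a" "r0 \<le> a" "r1 \<le> a" using c by (auto simp: a_def)
  let ?y = "momentum (usol \<alpha>) (zsol \<alpha>)"
  have p': "0 < \<psi>' r" if "a \<le> r" for r
    using c(3)[of r] psi_pos[of r] that a c(1) by (meson less_le_trans mult_pos_pos order_trans)
  have y0: "?y r \<noteq> 0" if r: "a \<le> r" for r
    by (rule momentum_nonzero[where \<epsilon> = \<epsilon>]) (use r a c(4)[of r] p'[OF r] E[of r] pos[of r] r1[of r] eps in auto)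
  obtain s where s: "a < s" "(1 - \<epsilon>) * (\<psi>' s)\<^sup>2 \<le> \<psi>'' s * \<psi> s"
    using convex_radii[OF eps(1)] by blast
  have s0: "0 < s" using s a by simp
  have ys: "?y s < 0"
  proof (rule ccontr)
    assume "\<not> ?y s < 0"
    then have "energy (usol \<alpha>) (zsol \<alpha>) s < 0"
      by (intro negative_energy[where \<epsilon> = \<epsilon>])
         (use s s0 a p'[of s] pos[of s] zsol_nonneg[OF al pos, of s] r1[of s] eps in auto)
    then show False using E[OF s0] by simp
  qed
  have y: "?y r < 0" if r: "s \<le> r" for r
  proof (rule ccontr)
    assume "\<not> ?y r < 0"
    moreover have "continuous_on {s..r} ?y"
    proof (rule continuous_at_imp_continuous_on, rule ballI)
      fix x assume "x \<in> {s..r}"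
      then show "isCont ?y x"
        using sol_deriv_interior(2)[OF sol_usol[OF al, of "x + 1"], of x] pos s0 by (auto intro: DERIV_isCont)
    qed
    ultimately obtain x where "s \<le> x" "x \<le> r" "?y x = 0"
      using IVT'[of ?y s 0 r] ys r by auto
    then show False using y0[of x] s by simp
  qed
  have "usol \<alpha> r \<le> scaled (usol \<alpha>) s * \<psi> r powr (- \<delta>)" if r: "s \<le> r" for r
  proof -
    have "scaled (usol \<alpha>) r \<le> scaled (usol \<alpha>) s"
    proof (rule DERIV_nonpos_imp_nonincreasing[OF r])
      fix x assume x: "s \<le> x" "x \<le> r"
      then have "(scaled (usol \<alpha>) has_real_derivative \<psi> x powr (2 * \<delta> - real N) * ?y x) (at x)"
        using sol_deriv_interior(1)[OF sol_usol[OF al, of "x + 1"], of x] pos s0 by simp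
      then show "\<exists>y. (scaled (usol \<alpha>) has_real_derivative y) (at x) \<and> y \<le> 0"
        using y[OF x(1)] by (intro exI[of _ "\<psi> x powr (2 * \<delta> - real N) * ?y x"]) (simp add: mult_nonneg_nonpos)
    qed
    then have "\<psi> r powr \<delta> * usol \<alpha> r * \<psi> r powr (- \<delta>) \<le> scaled (usol \<alpha>) s * \<psi> r powr (- \<delta>)"
      unfolding scaled_def[of _ r] by (intro mult_right_mono) auto
    then show ?thesis using psi_pos[of r] r s0 by (simp add: powr_minus field_simps)
  qed
  then have "decays \<alpha> \<delta>" unfolding decays_def eventually_at_top_linorder by blast
  then show ?thesis using decay_imp_fast[OF al] pos delta_bounds(4) by blast
qed

text \<open>
  Small solutions are almost constant up to a fixed radius of near convexity, so their energy is
  negative there; a zero at any later radius would require nonnegative energy before it.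
\<close>
lemma small_data_positive: "\<exists>\<alpha>>0. \<forall>r\<ge>0. 0 < usol \<alpha> r"
proof -
  obtain c r0 where c: "0 < c" "0 < r0" "\<And>r. r0 \<le> r \<Longrightarrow> c * \<psi> r \<le> \<psi>' r"
    using exponential_growth by metis
  define \<epsilon> where "\<epsilon> = (real N - 2 * \<delta>) / 4"
  have eps: "0 < \<epsilon>" "2 * \<epsilon> < real N - 2 * \<delta>" using delta_bounds by (auto simp: \<epsilon>_def)
  obtain s where s: "r0 < s" "(1 - \<epsilon>) * (\<psi>' s)\<^sup>2 \<le> \<psi>'' s * \<psi> s"
    using convex_radii[OF eps(1)] by blast
  have s0: "0 < s" using s c by simp
  have P: "0 < \<psi> s" using psi_pos s0 by simp
  have "0 < c * \<psi> s" using c P by simp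
  then have p': "0 < \<psi>' s" using c(3)[of s] s by linarith
  \<comment> \<open>the three bounds make \<open>u \<ge> \<alpha> / 2\<close>, the momentum nonnegative, and the nonlinear term small at \<open>s\<close>\<close>
  define \<tau> where "\<tau> = min (1 / s\<^sup>2) (min (\<delta> * \<psi>' s / (2 * s * \<psi> s)) (\<delta> * \<epsilon> * (\<psi>' s)\<^sup>2 / (\<psi> s)\<^sup>2))"
  have tau: "0 < \<tau>" using s0 P p' eps delta_bounds(4) by (simp add: \<tau>_def)
  define \<alpha> where "\<alpha> = \<tau> powr (1 / (p - 1))"
  have al: "0 < \<alpha>" using tau by (simp add: \<alpha>_def)
  have alp: "\<alpha> powr (p - 1) = \<tau>" using tau p1 by (simp add: \<alpha>_def powr_powr)
  have alp': "\<alpha> powr p = \<alpha> * \<tau>" using al alp powr_add[of \<alpha> "p - 1" 1] by simp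
  let ?u = "usol \<alpha>" let ?z = "zsol \<alpha>"
  have u: "\<alpha> / 2 \<le> ?u s" "?u s \<le> \<alpha>"
  proof -
    have "\<tau> * s\<^sup>2 \<le> 1 / s\<^sup>2 * s\<^sup>2" by (intro mult_right_mono) (auto simp: \<tau>_def)
    then have "\<tau> * s\<^sup>2 \<le> 1" using s0 by simp
    then have "\<alpha> * (\<tau> * s\<^sup>2) \<le> \<alpha> * 1" using al by (intro mult_left_mono) auto
    then show "\<alpha> / 2 \<le> ?u s"
      using u_lower[OF sol_usol[OF al] al, of s s] s0 unfolding alp' by (simp add: mult.assoc)
    show "?u s \<le> \<alpha>" using usol_antimono[OF al, of 0 s] usol_0[OF al] s0 by simp
  qed
  have y: "0 \<le> momentum ?u ?z s"
  proof -
    have "\<psi> s powr (- \<delta>) * ?z s \<le> \<psi> s powr (- \<delta>) * (\<psi> s ^ N * (\<alpha> powr p * s))"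
      using z_upper[OF sol_usol[OF al] al, of s s] s0 by (intro mult_left_mono) auto
    also have "\<dots> = \<psi> s powr (real N - \<delta> - 1) * (\<alpha> * (\<tau> * (s * \<psi> s)))"
      using P unfolding psi_power_powr[OF s0] alp' by (simp add: powr_diff powr_minus_divide)
    also have "\<dots> \<le> \<psi> s powr (real N - \<delta> - 1) * (\<alpha> * (\<delta> * \<psi>' s / 2))"
    proof -
      have "\<tau> * (s * \<psi> s) \<le> \<delta> * \<psi>' s / (2 * s * \<psi> s) * (s * \<psi> s)"
        using s0 P by (intro mult_right_mono) (auto simp: \<tau>_def)
      also have "\<dots> = \<delta> * \<psi>' s / 2" using s0 P by simp
      finally show ?thesis using al by (intro mult_left_mono) auto
    qed
    also have "\<dots> = \<delta> * \<psi> s powr (real N - \<delta> - 1) * \<psi>' s * (\<alpha> / 2)" by simp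
    also have "\<dots> \<le> \<delta> * \<psi> s powr (real N - \<delta> - 1) * \<psi>' s * ?u s"
      using u p' delta_bounds(4) by (intro mult_left_mono) auto
    finally show ?thesis by (simp add: momentum_def)
  qed
  have neg: "energy ?u ?z s < 0"
  proof (rule negative_energy[OF s0 _ _ y p' s(2) _ eps(2)])
    show "0 < ?u s" using u al by simp
    show "0 \<le> ?z s" using sol_monotone(3)[OF sol_usol[OF al], of s s s] s0 by simp
    have "2 / (p + 1) * ?u s powr (p - 1) \<le> 1 * \<alpha> powr (p - 1)"
      using u al p1 by (intro mult_mono powr_mono2) auto
    also have "\<dots> \<le> \<delta> * \<epsilon> * (\<psi>' s)\<^sup>2 / (\<psi> s)\<^sup>2" unfolding alp by (simp add: \<tau>_def)
    finally have "2 / (p + 1) * ?u s powr (p - 1) * (\<psi> s)\<^sup>2 \<le> \<delta> * \<epsilon> * (\<psi>' s)\<^sup>2 / (\<psi> s)\<^sup>2 * (\<psi> s)\<^sup>2"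
      by (rule mult_right_mono) simp
    then show "2 / (p + 1) * ?u s powr (p - 1) * (\<psi> s)\<^sup>2 \<le> \<delta> * \<epsilon> * (\<psi>' s)\<^sup>2" using P by simp
  qed
  have "0 < ?u r" if r: "0 \<le> r" for r
  proof (rule ccontr)
    assume "\<not> 0 < ?u r"
    then obtain R where R: "0 < R" "?u R = 0" "\<And>x. 0 \<le> x \<Longrightarrow> x < R \<Longrightarrow> 0 < ?u x"
      using first_zero[of 0 r ?u] continuous_on_subset[OF usol_cont[OF al], of "{0..r}"] usol_0[OF al] al r
      by auto
    have "s < R"
    proof (rule ccontr)
      assume "\<not> s < R"
      then have "?u s \<le> ?u R" using usol_antimono[OF al, of R s] R by simp
      then show False using R(2) u al by simp
    qed
    then have "0 \<le> energy ?u ?z s"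
      by (intro energy_nonneg_before_zero[OF sol_usol[OF al] _ al R(2) s0]) (use R in auto)
    then show False using neg by simp
  qed
  then show ?thesis using al by blast
qed

lemma usol_tendsto_data:
  assumes al: "0 < \<alpha>" and r: "0 \<le> r"
  shows "((\<lambda>\<beta>. usol \<beta> r) \<longlongrightarrow> usol \<alpha> r) (at \<alpha>)" "((\<lambda>\<beta>. zsol \<beta> r) \<longlongrightarrow> zsol \<alpha> r) (at \<alpha>)"
proof -
  define \<mu> where "\<mu> = sqrt (2 * (p * (\<alpha> + 1) powr (p - 1)))"
  have near: "\<forall>\<^sub>F \<beta> in at \<alpha>. 0 < \<beta> \<and> \<beta> \<le> \<alpha> + 1"
    unfolding eventually_at using al by (intro exI[of _ "min \<alpha> 1"]) (auto simp: dist_real_def)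
  have lim: "((\<lambda>\<beta>. \<bar>\<beta> - \<alpha>\<bar>) \<longlongrightarrow> 0) (at \<alpha>)"
    by (intro tendsto_rabs_zero LIM_zero) (rule tendsto_ident_at)
  have est: "\<bar>usol \<beta> r - usol \<alpha> r\<bar> \<le> 2 * \<bar>\<beta> - \<alpha>\<bar> * exp (\<mu> * r)"
    "\<bar>zsol \<beta> r - zsol \<alpha> r\<bar> \<le> \<psi> r ^ N * (\<mu> * \<bar>\<beta> - \<alpha>\<bar> * exp (\<mu> * r))"
    if "0 < \<beta>" "\<beta> \<le> \<alpha> + 1" for \<beta>
    by (rule continuous_dependence[OF sol_usol[OF that(1), of r] sol_usol[OF al, of r] that(2) _ _ refl \<mu>_def r]; use al in simp)+
  show "((\<lambda>\<beta>. usol \<beta> r) \<longlongrightarrow> usol \<alpha> r) (at \<alpha>)"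
  proof (rule LIM_zero_cancel, rule Lim_null_comparison)
    show "\<forall>\<^sub>F \<beta> in at \<alpha>. norm (usol \<beta> r - usol \<alpha> r) \<le> 2 * \<bar>\<beta> - \<alpha>\<bar> * exp (\<mu> * r)"
      using near by eventually_elim (simp add: est)
    show "((\<lambda>\<beta>. 2 * \<bar>\<beta> - \<alpha>\<bar> * exp (\<mu> * r)) \<longlongrightarrow> 0) (at \<alpha>)"
      by (intro tendsto_mult_left_zero tendsto_mult_right_zero lim)
  qed
  show "((\<lambda>\<beta>. zsol \<beta> r) \<longlongrightarrow> zsol \<alpha> r) (at \<alpha>)"
  proof (rule LIM_zero_cancel, rule Lim_null_comparison)
    show "\<forall>\<^sub>F \<beta> in at \<alpha>. norm (zsol \<beta> r - zsol \<alpha> r) \<le> \<psi> r ^ N * (\<mu> * \<bar>\<beta> - \<alpha>\<bar> * exp (\<mu> * r))"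
      using near by eventually_elim (simp add: est)
    show "((\<lambda>\<beta>. \<psi> r ^ N * (\<mu> * \<bar>\<beta> - \<alpha>\<bar> * exp (\<mu> * r))) \<longlongrightarrow> 0) (at \<alpha>)"
      by (intro tendsto_mult_left_zero tendsto_mult_right_zero lim)
  qed
qed

text \<open>
  The threshold is the supremum of the initial values of positive solutions. It is attained, since a
  solution that vanishes becomes negative afterwards, and so do its neighbours; and its solution
  has nonnegative energy, being the limit of solutions with a zero, whose energy is nonnegative
  before it.
\<close>
theorem classification:
  obtains \<alpha>\<^sub>0 where "0 < \<alpha>\<^sub>0" "\<And>r. 0 \<le> r \<Longrightarrow> 0 < usol \<alpha>\<^sub>0 r" "fast \<alpha>\<^sub>0"
    "\<And>\<beta> r. 0 < \<beta> \<Longrightarrow> \<beta> < \<alpha>\<^sub>0 \<Longrightarrow> 0 \<le> r \<Longrightarrow> 0 < usol \<beta> r"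
    "\<And>\<beta>. \<alpha>\<^sub>0 < \<beta> \<Longrightarrow> \<exists>r\<ge>0. usol \<beta> r \<le> 0"
    "\<And>\<beta>. 0 < \<beta> \<Longrightarrow> (\<And>r. 0 \<le> r \<Longrightarrow> 0 < usol \<beta> r) \<Longrightarrow> fast \<beta> \<Longrightarrow> \<beta> = \<alpha>\<^sub>0"
proof -
  define S where "S = {\<alpha>. 0 < \<alpha> \<and> (\<forall>r\<ge>0. 0 < usol \<alpha> r)}"
  obtain a where a: "a \<in> S" using small_data_positive by (auto simp: S_def)
  obtain b Rb where b: "0 < b" "0 \<le> Rb" "usol b Rb \<le> 0" using large_data_vanish by blast
  have ub: "\<alpha> \<le> b" if "\<alpha> \<in> S" for \<alpha>
  proof (rule ccontr)
    assume "\<not> \<alpha> \<le> b"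
    then show False using zero_propagates[OF b(1) _ b(2,3), of \<alpha>] that unfolding S_def by force
  qed
  have bdd: "bdd_above S" using ub by (auto simp: bdd_above_def)
  define \<alpha>\<^sub>0 where "\<alpha>\<^sub>0 = Sup S"
  have le0: "\<alpha> \<le> \<alpha>\<^sub>0" if "\<alpha> \<in> S" for \<alpha> unfolding \<alpha>\<^sub>0_def by (rule cSup_upper[OF that bdd])
  have al0: "0 < \<alpha>\<^sub>0" using le0[OF a] a by (simp add: S_def)
  have below: "0 < usol \<beta> r" if "0 < \<beta>" "\<beta> < \<alpha>\<^sub>0" "0 \<le> r" for \<beta> r
  proof (rule ccontr)
    assume neg: "\<not> 0 < usol \<beta> r"
    have "\<beta> < Sup S" using that(2) by (simp add: \<alpha>\<^sub>0_def)
    then obtain \<gamma> where "\<gamma> \<in> S" "\<beta> < \<gamma>" using less_cSupD[of S \<beta>] a by blast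
    then show False using zero_propagates[OF that(1) \<open>\<beta> < \<gamma>\<close> that(3)] neg unfolding S_def by force
  qed
  have above: "\<exists>r\<ge>0. usol \<beta> r \<le> 0" if "\<alpha>\<^sub>0 < \<beta>" for \<beta>
    using le0[of \<beta>] that al0 by (force simp: S_def not_less)
  have pos: "0 < usol \<alpha>\<^sub>0 r" if r: "0 \<le> r" for r
  proof (rule ccontr)
    assume "\<not> 0 < usol \<alpha>\<^sub>0 r"
    moreover have "usol \<alpha>\<^sub>0 (r + 1) < usol \<alpha>\<^sub>0 r"
      using u_strict_antimono[OF sol_usol[OF al0] al0 r, of "r + 1" "r + 1"] by simp
    ultimately have neg: "usol \<alpha>\<^sub>0 (r + 1) < 0" by simp
    have "((\<lambda>\<beta>. usol \<beta> (r + 1)) \<longlongrightarrow> usol \<alpha>\<^sub>0 (r + 1)) (at_left \<alpha>\<^sub>0)"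
      using usol_tendsto_data(1)[OF al0, of "r + 1"] r by (auto intro: tendsto_within_subset)
    then have "\<forall>\<^sub>F \<beta> in at_left \<alpha>\<^sub>0. usol \<beta> (r + 1) < 0" using neg by (rule order_tendstoD)
    moreover have "\<forall>\<^sub>F \<beta> in at_left \<alpha>\<^sub>0. 0 < \<beta> \<and> \<beta> < \<alpha>\<^sub>0"
      unfolding eventually_at_left[OF al0] using al0 by (intro exI[of _ 0]) auto
    ultimately have "\<forall>\<^sub>F \<beta> in at_left \<alpha>\<^sub>0. False"
    proof eventually_elim
      case (elim \<beta>)
      then show ?case using below[of \<beta> "r + 1"] r by simp
    qed
    then show False by (simp add: trivial_limit_at_left_real)
  qed
  have E: "0 \<le> energy (usol \<alpha>\<^sub>0) (zsol \<alpha>\<^sub>0) r" if r: "0 < r" for r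
  proof -
    have lim: "((\<lambda>\<beta>. usol \<beta> r) \<longlongrightarrow> usol \<alpha>\<^sub>0 r) (at_right \<alpha>\<^sub>0)" "((\<lambda>\<beta>. zsol \<beta> r) \<longlongrightarrow> zsol \<alpha>\<^sub>0 r) (at_right \<alpha>\<^sub>0)"
      using usol_tendsto_data[OF al0, of r] r by (auto intro: tendsto_within_subset)
    have nz: "\<psi> r powr \<delta> * usol \<alpha>\<^sub>0 r \<noteq> 0" using pos[of r] psi_pos[OF r] r by simp
    have limE: "((\<lambda>\<beta>. energy (usol \<beta>) (zsol \<beta>) r) \<longlongrightarrow> energy (usol \<alpha>\<^sub>0) (zsol \<alpha>\<^sub>0) r) (at_right \<alpha>\<^sub>0)"
      unfolding energy_def momentum_def scaled_def
      using p1 nz by (intro tendsto_intros lim) auto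
    have "\<forall>\<^sub>F \<beta> in at_right \<alpha>\<^sub>0. 0 < usol \<beta> r"
      using lim(1) pos[of r] r by (intro order_tendstoD) auto
    moreover have "\<forall>\<^sub>F \<beta> in at_right \<alpha>\<^sub>0. \<alpha>\<^sub>0 < \<beta>" by (simp add: eventually_at_filter)
    ultimately have "\<forall>\<^sub>F \<beta> in at_right \<alpha>\<^sub>0. 0 \<le> energy (usol \<beta>) (zsol \<beta>) r"
    proof eventually_elim
      case (elim \<beta>)
      have be: "0 < \<beta>" using elim al0 by simp
      obtain t where t: "0 \<le> t" "usol \<beta> t \<le> 0" using above[OF elim(2)] by blast
      obtain R where R: "0 < R" "usol \<beta> R = 0" "\<And>x. 0 \<le> x \<Longrightarrow> x < R \<Longrightarrow> 0 < usol \<beta> x"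
        using first_zero[of 0 t "usol \<beta>"] continuous_on_subset[OF usol_cont[OF be], of "{0..t}"] usol_0[OF be] be t
        by auto
      have "r < R"
      proof (rule ccontr)
        assume "\<not> r < R"
        then have "usol \<beta> r \<le> usol \<beta> R" using usol_antimono[OF be, of R r] R by simp
        then show False using R(2) elim by simp
      qed
      then show ?case
        by (intro energy_nonneg_before_zero[OF sol_usol[OF be] _ be R(2) r]) (use R in auto)
    qed
    then show ?thesis by (rule tendsto_lowerbound[OF limE]) simp
  qed
  have f0: "fast \<alpha>\<^sub>0" by (rule energy_nonneg_imp_fast[OF al0]) (use pos E in auto)
  have uniq: "\<beta> = \<alpha>\<^sub>0" if be: "0 < \<beta>" and pb: "\<And>r. 0 \<le> r \<Longrightarrow> 0 < usol \<beta> r" and fb: "fast \<beta>" for \<beta>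
  proof -
    have lims: "(energy (usol \<alpha>\<^sub>0) (zsol \<alpha>\<^sub>0) \<longlongrightarrow> 0) at_top" "(energy (usol \<beta>) (zsol \<beta>) \<longlongrightarrow> 0) at_top"
      using fast_imp_energy_vanishes[OF al0 _ f0] fast_imp_energy_vanishes[OF be _ fb] pos pb by blast+
    have "\<not> \<beta> < \<alpha>\<^sub>0" using vanishing_energy_unique[OF be _ _ _ lims(2,1)] pos pb by blast
    moreover have "\<not> \<alpha>\<^sub>0 < \<beta>" using vanishing_energy_unique[OF al0 _ _ _ lims] pos pb by blast
    ultimately show ?thesis by simp
  qed
  show thesis by (rule that[of \<alpha>\<^sub>0]) (use al0 pos f0 below above uniq in blast)+
qed

end

section \<open>The Riemannian volume and weak gradients\<close>

text \<open>
  In an orthonormal basis that contains \<open>\<theta>\<close> this matrix is diagonal, with the entry 1 for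
  \<open>\<theta>\<close> and \<open>c\<close> otherwise.
\<close>
lemma det_rank_one_perturbation:
  fixes \<theta> :: "real^'n"
  assumes th: "norm \<theta> = 1"
  shows "det (\<chi> i j. c * (if i = j then 1 else 0) + (1 - c) * (\<theta> $ i * \<theta> $ j)) = c ^ (CARD('n) - 1)"
proof -
  fix k :: 'n
  obtain Q where Q: "orthogonal_matrix Q" and Qk: "Q *v axis k 1 = \<theta>"
    using orthogonal_matrix_exists_basis[OF th] by blast
  have col: "Q $ i $ k = \<theta> $ i" for i
  proof -
    have "(Q *v axis k 1) $ i = Q $ i $ k"
      by (simp add: matrix_vector_mult_def axis_def if_distrib sum.delta' cong: if_cong)
    then show ?thesis using Qk by simp
  qed
  define D :: "real^'n^'n" where "D = (\<chi> i j. if i = j then (if i = k then 1 else c) else 0)"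
  have QQ: "(\<Sum>m\<in>UNIV. Q $ i $ m * Q $ j $ m) = (if i = j then 1 else 0)" for i j
  proof -
    have "Q ** transpose Q = mat 1" using Q by (simp add: orthogonal_matrix_def)
    then have "(Q ** transpose Q) $ i $ j = mat 1 $ i $ j" by simp
    then show ?thesis by (simp add: matrix_matrix_mult_def transpose_def mat_def)
  qed
  have entry: "(Q ** D ** transpose Q) $ i $ j = c * (if i = j then 1 else 0) + (1 - c) * (\<theta> $ i * \<theta> $ j)" for i j
  proof -
    have "(Q ** D) $ i $ m = Q $ i $ m * (if m = k then 1 else c)" for m
      by (simp add: matrix_matrix_mult_def D_def if_distrib sum.delta cong: if_cong)
    then have "(Q ** D ** transpose Q) $ i $ j = (\<Sum>m\<in>UNIV. Q $ i $ m * (if m = k then 1 else c) * Q $ j $ m)"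
      by (simp add: matrix_matrix_mult_def[of "Q ** D"] transpose_def)
    also have "\<dots> = (\<Sum>m\<in>UNIV. c * (Q $ i $ m * Q $ j $ m) + (if m = k then (1 - c) * (Q $ i $ m * Q $ j $ m) else 0))"
      by (rule sum.cong) (auto simp: algebra_simps)
    also have "\<dots> = c * (if i = j then 1 else 0) + (1 - c) * (\<theta> $ i * \<theta> $ j)"
      by (simp only: sum.distrib sum_distrib_left[symmetric] QQ) (simp add: col)
    finally show ?thesis .
  qed
  then have "(\<chi> i j. c * (if i = j then 1 else 0) + (1 - c) * (\<theta> $ i * \<theta> $ j)) = Q ** D ** transpose Q"
    by (simp add: vec_eq_iff)
  then have "det (\<chi> i j. c * (if i = j then 1 else 0) + (1 - c) * (\<theta> $ i * \<theta> $ j)) = det Q * det D * det Q"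
    by (simp add: det_mul)
  also have "\<dots> = det D" using det_orthogonal_matrix[OF Q] by auto
  also have "\<dots> = (\<Prod>i\<in>UNIV. if i = k then 1 else c)"
    by (subst det_diagonal) (auto simp: D_def)
  also have "\<dots> = (\<Prod>i\<in>UNIV - {k}. c)"
    by (subst prod.remove[of UNIV k]) auto
  also have "\<dots> = c ^ (CARD('n) - 1)" by simp
  finally show ?thesis .
qed

lemma model_volume_density:
  fixes x :: "real^'n"
  assumes x: "x \<noteq> 0" and nonneg: "0 \<le> \<psi> (norm x)"
  shows "sqrt (det (\<chi> i j. model_metric \<psi> x (axis i 1) (axis j 1))) = (\<psi> (norm x) / norm x) ^ (CARD('n) - 1)"
proof -
  define \<theta> where "\<theta> = x /\<^sub>R norm x"
  define c where "c = (\<psi> (norm x) / norm x)\<^sup>2"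
  have th: "norm \<theta> = 1" using x by (simp add: \<theta>_def)
  then have tt: "\<theta> \<bullet> \<theta> = 1" by (simp add: dot_square_norm)
  have ax: "axis i 1 \<bullet> \<theta> = \<theta> $ i" "\<theta> \<bullet> axis i 1 = \<theta> $ i" for i
    by (simp_all add: inner_axis inner_axis')
  have "model_metric \<psi> x (axis i 1) (axis j 1) = c * (if i = j then 1 else 0) + (1 - c) * (\<theta> $ i * \<theta> $ j)" for i j
  proof -
    have "(axis i 1 - (axis i 1 \<bullet> \<theta>) *\<^sub>R \<theta>) \<bullet> (axis j 1 - (axis j 1 \<bullet> \<theta>) *\<^sub>R \<theta>) = (if i = j then 1 else 0) - \<theta> $ i * \<theta> $ j"
      by (simp add: inner_diff_left inner_diff_right ax tt inner_axis_axis)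
    then show ?thesis
      using x unfolding model_metric_def Let_def \<theta>_def[symmetric] c_def[symmetric]
      by (simp add: ax algebra_simps)
  qed
  then have "det (\<chi> i j. model_metric \<psi> x (axis i 1) (axis j 1)) = c ^ (CARD('n) - 1)"
    using det_rank_one_perturbation[OF th, of c] by simp
  also have "\<dots> = ((\<psi> (norm x) / norm x) ^ (CARD('n) - 1))\<^sup>2"
    by (simp add: c_def power_mult[symmetric] mult.commute)
  finally show ?thesis using nonneg by simp
qed

text \<open>
  Polar coordinates for radial functions: it suffices to compare both measures on the half-lines
  \<open>{..a}\<close>, whose preimages under the norm are balls of known volume.
\<close>
lemma distr_norm_lborel:
  "distr (lborel :: 'a::euclidean_space measure) borel norm =
   density lborel (\<lambda>r. ennreal (real DIM('a) * unit_ball_vol DIM('a) * r ^ (DIM('a) - 1)) * indicator {0..} r)"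
proof (rule measure_eqI_generator_eq[where E = "range (\<lambda>a. {..a::real})" and \<Omega> = UNIV and A = "\<lambda>i. {..real i}"])
  let ?d = "DIM('a)" and ?w = "unit_ball_vol DIM('a)"
  have d: "0 < ?d" by simp
  have em: "emeasure (distr (lborel :: 'a measure) borel norm) {..a} = (if a < 0 then 0 else ennreal (?w * a ^ ?d))" for a
  proof -
    have "emeasure (distr (lborel :: 'a measure) borel norm) {..a} = emeasure lborel (cball (0::'a) a)"
    proof -
      have "norm -` {..a} = cball (0::'a) a" by (auto simp: dist_norm)
      then show ?thesis by (simp add: emeasure_distr)
    qed
    then show ?thesis using emeasure_cball[of a "0::'a"] by (simp add: not_less)
  qed
  show "Int_stable (range (\<lambda>a. {..a::real}))" by (auto simp: Int_stable_def)
  show "sets (distr (lborel :: 'a measure) borel norm) = sigma_sets UNIV (range (\<lambda>a. {..a::real}))"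
    by (subst sets_distr, subst borel_eq_atMost) simp
  show "sets (density lborel (\<lambda>r. ennreal (real ?d * ?w * r ^ (?d - 1)) * indicator {0..} r)) = sigma_sets UNIV (range (\<lambda>a. {..a::real}))"
    by (subst sets_density, subst sets_lborel, subst borel_eq_atMost) simp
  show "(\<Union>i. {..real i}) = UNIV" using real_arch_simple by auto
  show "emeasure (distr (lborel :: 'a measure) borel norm) {..real i} \<noteq> \<infinity>" for i
    unfolding em by simp
  fix X assume "X \<in> range (\<lambda>a. {..a::real})"
  then obtain a where X: "X = {..a}" by auto
  have "emeasure (density lborel (\<lambda>r. ennreal (real ?d * ?w * r ^ (?d - 1)) * indicator {0..} r)) {..a}
      = (\<integral>\<^sup>+r. ennreal (real ?d * ?w * r ^ (?d - 1)) * indicator {0..a} r \<partial>lborel)"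
    by (subst emeasure_density) (auto intro!: nn_integral_cong simp: indicator_def)
  also have "\<dots> = (if a < 0 then 0 else ennreal (?w * a ^ ?d))"
  proof (cases "a < 0")
    case True
    then show ?thesis by simp
  next
    case False
    have "(\<integral>\<^sup>+r. ennreal (real ?d * ?w * r ^ (?d - 1)) * indicator {0..a} r \<partial>lborel) = ennreal (?w * a ^ ?d - ?w * 0 ^ ?d)"
    proof (rule nn_integral_FTC_Icc[where F = "\<lambda>r. ?w * r ^ ?d"])
      show "((\<lambda>r. ?w * r ^ ?d) has_real_derivative real ?d * ?w * x ^ (?d - 1)) (at x)" for x
        by (auto intro!: derivative_eq_intros)
    qed (use False in auto)
    then show ?thesis using False d by (simp add: power_0_left)
  qed
  finally show "emeasure (distr (lborel :: 'a measure) borel norm) X =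
      emeasure (density lborel (\<lambda>r. ennreal (real ?d * ?w * r ^ (?d - 1)) * indicator {0..} r)) X"
    by (simp add: X em)
qed auto

lemma nn_integral_radial:
  fixes f :: "real \<Rightarrow> ennreal"
  assumes [measurable]: "f \<in> borel_measurable borel"
  shows "(\<integral>\<^sup>+x. f (norm (x::'a::euclidean_space)) \<partial>lborel) =
    (\<integral>\<^sup>+r. ennreal (real DIM('a) * unit_ball_vol DIM('a) * r ^ (DIM('a) - 1)) * indicator {0..} r * f r \<partial>lborel)"
proof -
  have "(\<integral>\<^sup>+x. f (norm (x::'a)) \<partial>lborel) = (\<integral>\<^sup>+r. f r \<partial>distr (lborel :: 'a measure) borel norm)"
    by (subst nn_integral_distr) auto
  then show ?thesis unfolding distr_norm_lborel by (simp add: nn_integral_density)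
qed

text \<open>
  The density of the Riemannian volume is \<open>(\<psi>(r) / r)\<^sup>N\<close>, so that the factor \<open>r\<^sup>N\<close> of polar
  coordinates is replaced by \<open>\<psi>\<^sup>N\<close>.
\<close>
lemma nn_integral_model_volume:
  fixes F :: "real^'n \<Rightarrow> real" and f \<psi> :: "real \<Rightarrow> real"
  assumes F: "\<And>x. F x = f (norm x)" and f: "continuous_on {0..} f" "\<And>r. 0 \<le> r \<Longrightarrow> 0 \<le> f r"
    and psi: "continuous_on {0..} \<psi>" "\<And>r. 0 < r \<Longrightarrow> 0 < \<psi> r" and dim: "CARD('n) = Suc N"
  shows "(\<integral>\<^sup>+x. ennreal (F x) \<partial>riemannian_volume (model_metric \<psi> :: real^'n \<Rightarrow> _)) =
    ennreal (real (Suc N) * unit_ball_vol (real (Suc N))) * (\<integral>\<^sup>+r. ennreal (f r * \<psi> r ^ N) * indicator {0<..} r \<partial>lborel)"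
    and "(\<lambda>x. ennreal (sqrt (det (\<chi> i j. model_metric \<psi> x (axis i 1) (axis j 1))))) \<in> borel_measurable (borel :: (real^'n) measure)"
    and "F \<in> borel_measurable borel"
proof -
  let ?d = "\<lambda>x::real^'n. ennreal (sqrt (det (\<chi> i j. model_metric \<psi> x (axis i 1) (axis j 1))))"
  define f0 where "f0 r = indicator {0..} r *\<^sub>R f r" for r
  define w where "w r = indicator {0<..} r *\<^sub>R (\<psi> r / r) ^ N" for r
  have [measurable]: "f0 \<in> borel_measurable borel"
    unfolding f0_def by (rule borel_measurable_continuous_on_indicator[OF _ f(1)]) simp
  have wc: "continuous_on {0<..} (\<lambda>r. (\<psi> r / r) ^ N)"
    by (intro continuous_intros continuous_on_subset[OF psi(1)]) auto
  have [measurable]: "w \<in> borel_measurable borel"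
    unfolding w_def by (rule borel_measurable_continuous_on_indicator[OF _ wc]) simp
  have Ff: "F = (\<lambda>x. f0 (norm x))" by (rule ext) (simp add: F f0_def)
  show Fm: "F \<in> borel_measurable borel" unfolding Ff by measurable
  have dens: "?d x = (if x = 0 then ?d 0 else ennreal (w (norm x)))" for x
    using model_volume_density[of x \<psi>] psi(2)[of "norm x"] by (auto simp: w_def dim)
  have dens': "?d = (\<lambda>x. if x = 0 then ?d 0 else ennreal (w (norm x)))" by (rule ext) (rule dens)
  show dm: "?d \<in> borel_measurable (borel :: (real^'n) measure)"
    unfolding dens' by measurable
  have "(\<integral>\<^sup>+x. ennreal (F x) \<partial>riemannian_volume (model_metric \<psi> :: real^'n \<Rightarrow> _)) =
      (\<integral>\<^sup>+x. ?d x * ennreal (F x) \<partial>lborel)"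
    unfolding riemannian_volume_def using dm Fm by (subst nn_integral_density) auto
  also have "\<dots> = (\<integral>\<^sup>+x. ennreal (w (norm (x::real^'n))) * ennreal (f0 (norm x)) \<partial>lborel)"
  proof (rule nn_integral_cong_AE)
    have "AE x in (lborel :: (real^'n) measure). x \<noteq> 0" by (rule AE_lborel_singleton)
    then show "AE x in lborel. ?d x * ennreal (F x) = ennreal (w (norm x)) * ennreal (f0 (norm x))"
      by eventually_elim (subst dens, simp add: Ff)
  qed
  also have "\<dots> = (\<integral>\<^sup>+r. ennreal (real (Suc N) * unit_ball_vol (real (Suc N)) * r ^ N) * indicator {0..} r *
      (ennreal (w r) * ennreal (f0 r)) \<partial>lborel)"
    using nn_integral_radial[where 'a = "real^'n" and f = "\<lambda>r. ennreal (w r) * ennreal (f0 r)"]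
    by (simp add: dim)
  also have "\<dots> = (\<integral>\<^sup>+r. ennreal (real (Suc N) * unit_ball_vol (real (Suc N))) *
      (ennreal (f r * \<psi> r ^ N) * indicator {0<..} r) \<partial>lborel)"
  proof (rule nn_integral_cong)
    fix r :: real
    show "ennreal (real (Suc N) * unit_ball_vol (real (Suc N)) * r ^ N) * indicator {0..} r *
      (ennreal (w r) * ennreal (f0 r)) = ennreal (real (Suc N) * unit_ball_vol (real (Suc N))) *
      (ennreal (f r * \<psi> r ^ N) * indicator {0<..} r)"
    proof (cases "0 < r")
      case True
      have "real (Suc N) * unit_ball_vol (real (Suc N)) * r ^ N * ((\<psi> r / r) ^ N * f r) =
          real (Suc N) * unit_ball_vol (real (Suc N)) * (f r * \<psi> r ^ N)"
        using True by (simp add: power_divide)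
      then show ?thesis
        using True psi(2)[OF True] f(2)[of r]
        by (simp add: w_def f0_def ennreal_mult[symmetric] del: of_nat_Suc)
    qed (simp add: w_def)
  qed
  also have "\<dots> = ennreal (real (Suc N) * unit_ball_vol (real (Suc N))) *
      (\<integral>\<^sup>+r. ennreal (f r * \<psi> r ^ N) * indicator {0<..} r \<partial>lborel)"
  proof (rule nn_integral_cmult)
    have "continuous_on {0<..} (\<lambda>r. f r * \<psi> r ^ N)"
      by (intro continuous_intros continuous_on_subset[OF psi(1)] continuous_on_subset[OF f(1)]) auto
    then have "(\<lambda>r. indicator {0<..} r *\<^sub>R (f r * \<psi> r ^ N)) \<in> borel_measurable borel"
      by (rule borel_measurable_continuous_on_indicator[rotated]) simp
    then have "(\<lambda>r. ennreal (indicator {0<..} r *\<^sub>R (f r * \<psi> r ^ N))) \<in> borel_measurable borel" by measurable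
    moreover have "ennreal (indicator {0<..} r *\<^sub>R (f r * \<psi> r ^ N)) = ennreal (f r * \<psi> r ^ N) * indicator {0<..} r" for r
      by (simp add: indicator_def)
    ultimately show "(\<lambda>r. ennreal (f r * \<psi> r ^ N) * indicator {0<..} r) \<in> borel_measurable lborel" by simp
  qed
  finally show "(\<integral>\<^sup>+x. ennreal (F x) \<partial>riemannian_volume (model_metric \<psi> :: real^'n \<Rightarrow> _)) =
    ennreal (real (Suc N) * unit_ball_vol (real (Suc N))) * (\<integral>\<^sup>+r. ennreal (f r * \<psi> r ^ N) * indicator {0<..} r \<partial>lborel)" .
qed

text \<open>
  Lebesgue measure is translation invariant, so every difference quotient of \<open>h\<close> has integral 0.
\<close>
lemma integral_directional_derivative_eq_0:
  fixes h :: "'a::euclidean_space \<Rightarrow> real" and h' :: "'a \<Rightarrow> 'a \<Rightarrow> real"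
  assumes der: "\<And>x. (h has_derivative h' x) (at x)"
    and cont: "continuous_on UNIV (\<lambda>x. h' x e)"
    and supp: "\<And>x. norm x > R \<Longrightarrow> h x = 0"
  shows "(\<integral>x. h' x e \<partial>lborel) = 0"
proof -
  have hc: "continuous_on UNIV h"
    using has_derivative_continuous[OF der] by (intro continuous_at_imp_continuous_on) simp
  have [measurable]: "h \<in> borel_measurable borel" by (rule borel_measurable_continuous_onI[OF hc])
  have [measurable]: "(\<lambda>x. h' x e) \<in> borel_measurable borel" by (rule borel_measurable_continuous_onI[OF cont])
  have ih: "integrable lborel h"
  proof -
    have "integrable lborel (\<lambda>x. indicator (cball 0 R) x *\<^sub>R h x)"
      by (rule borel_integrable_compact) (auto intro: continuous_on_subset[OF hc])
    moreover have "(\<lambda>x. indicator (cball 0 R) x *\<^sub>R h x) = h"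
      by (rule ext) (use supp in \<open>auto simp: indicator_def\<close>)
    ultimately show ?thesis by (simp only:)
  qed
  have trans: "integrable lborel (\<lambda>x. h (c + x))" "(\<integral>x. h (c + x) \<partial>lborel) = (\<integral>x. h x \<partial>lborel)" for c
  proof -
    have "integrable (distr lborel borel ((+) c)) h" using ih by (simp add: lborel_distr_plus)
    then show "integrable lborel (\<lambda>x. h (c + x))" by (simp add: integrable_distr_eq)
    have "(\<integral>x. h x \<partial>distr lborel borel ((+) c)) = (\<integral>x. h (c + x) \<partial>lborel)"
      by (rule integral_distr) auto
    then show "(\<integral>x. h (c + x) \<partial>lborel) = (\<integral>x. h x \<partial>lborel)" by (simp add: lborel_distr_plus)
  qed
  define t where "t k = inverse (real (Suc k))" for k
  have t: "0 < t k" "t k \<le> 1" for k by (auto simp: t_def field_simps)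
  have t0: "t \<longlonglongrightarrow> 0" unfolding t_def by (rule LIMSEQ_inverse_real_of_nat)
  define q where "q k x = (h (t k *\<^sub>R e + x) - h x) / t k" for k x
  have line: "((\<lambda>s. h (s *\<^sub>R e + x)) has_real_derivative h' (s *\<^sub>R e + x) e) (at s)" for s x
  proof -
    have "((\<lambda>s. h (s *\<^sub>R e + x)) has_derivative (\<lambda>v. h' (s *\<^sub>R e + x) (v *\<^sub>R e))) (at s)"
      by (rule has_derivative_compose[OF _ der]) (auto intro!: derivative_eq_intros)
    moreover have "h' (s *\<^sub>R e + x) (v *\<^sub>R e) = v * h' (s *\<^sub>R e + x) e" for v
      using linear_scale[OF has_derivative_linear[OF der]] by simp
    ultimately show ?thesis by (simp add: has_field_derivative_def mult_commute_abs)
  qed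
  define S where "S = cball (0::'a) (R + 2 * norm e)"
  have "compact ((\<lambda>x. h' x e) ` S)"
    unfolding S_def by (intro compact_continuous_image continuous_on_subset[OF cont]) auto
  then have "bounded ((\<lambda>x. h' x e) ` S)" by (rule compact_imp_bounded)
  then obtain B where "0 < B" and B0: "\<forall>y\<in>(\<lambda>x. h' x e) ` S. norm y \<le> B" unfolding bounded_pos by blast
  then have B: "\<And>x. x \<in> S \<Longrightarrow> \<bar>h' x e\<bar> \<le> B" "0 < B" by auto
  define S1 where "S1 = cball (0::'a) (R + norm e)"
  have bound: "norm (q k x) \<le> B * indicator S1 x" for k x
  proof (cases "x \<in> S1")
    case True
    obtain s where s: "0 < s" "s < t k" "h (t k *\<^sub>R e + x) - h (0 *\<^sub>R e + x) = (t k - 0) * h' (s *\<^sub>R e + x) e"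
      using MVT2[OF t(1)[of k], of "\<lambda>s. h (s *\<^sub>R e + x)" "\<lambda>s. h' (s *\<^sub>R e + x) e"] line by blast
    have "norm (s *\<^sub>R e + x) \<le> norm (s *\<^sub>R e) + norm x" by (rule norm_triangle_ineq)
    also have "\<dots> \<le> norm e + (R + norm e)"
      using True s t(2)[of k] by (intro add_mono) (auto simp: S1_def intro: mult_left_le_one_le)
    finally have "s *\<^sub>R e + x \<in> S" by (simp add: S_def)
    moreover have "q k x = h' (s *\<^sub>R e + x) e" using s t(1)[of k] by (simp add: q_def)
    ultimately show ?thesis using B(1) True by simp
  next
    case False
    have "R + norm e < norm x" using False by (simp add: S1_def)
    moreover have "norm x - norm (t k *\<^sub>R e) \<le> norm (t k *\<^sub>R e + x)"
      by (metis add.commute norm_diff_ineq)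
    moreover have "norm (t k *\<^sub>R e) \<le> norm e" using t[of k] by (auto intro: mult_left_le_one_le)
    ultimately have "R < norm (t k *\<^sub>R e + x)" "R < norm x" using norm_ge_zero[of e] by linarith+
    then show ?thesis using supp False by (simp add: q_def)
  qed
  have lim: "(\<lambda>k. q k x) \<longlonglongrightarrow> h' x e" for x
  proof -
    have "((\<lambda>s. (h (s *\<^sub>R e + x) - h (0 *\<^sub>R e + x)) / (s - 0)) \<longlongrightarrow> h' (0 *\<^sub>R e + x) e) (at 0)"
      using line[of x 0] by (simp only: has_field_derivative_iff)
    then have "((\<lambda>s. (h (s *\<^sub>R e + x) - h x) / s) \<longlongrightarrow> h' x e) (at 0)" by simp
    moreover have "filterlim t (at 0) sequentially"
      using t0 t(1) by (auto simp: filterlim_at less_imp_neq[symmetric])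
    ultimately have "((\<lambda>k. (h (t k *\<^sub>R e + x) - h x) / t k) \<longlonglongrightarrow> h' x e)"
      by (rule filterlim_compose)
    then show ?thesis by (simp add: q_def)
  qed
  have "(\<lambda>k. \<integral>x. q k x \<partial>lborel) \<longlonglongrightarrow> (\<integral>x. h' x e \<partial>lborel)"
  proof (rule integral_dominated_convergence[where w = "\<lambda>x. B * indicator S1 x"])
    show "integrable lborel (\<lambda>x. B * indicator S1 x)"
      using borel_integrable_compact[of S1 "\<lambda>_. B"] by (simp add: S1_def mult.commute)
    show "q k \<in> borel_measurable lborel" for k unfolding q_def[abs_def] by measurable
  qed (use lim bound in auto)
  moreover have "(\<integral>x. q k x \<partial>lborel) = 0" for k
    unfolding q_def using trans ih by simp
  ultimately show ?thesis by (simp add: LIMSEQ_const_iff)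
qed

text \<open>
  For a test function \<open>\<phi>\<close>, integration by parts amounts to the vanishing of the integral of a
  partial derivative of \<open>w \<phi>\<close>, which is of class \<open>C\<^sup>1\<close> with bounded support.
\<close>
lemma weak_gradient_of_C1:
  fixes w :: "real^'n \<Rightarrow> real" and X :: "real^'n \<Rightarrow> real^'n"
  assumes der: "\<And>x. (w has_derivative (\<lambda>v. X x \<bullet> v)) (at x)" and X: "continuous_on UNIV X"
    and g: "\<And>x i. g x (X x) (axis i 1) = X x $ i"
  shows "weak_riemannian_gradient g w X"
  unfolding weak_riemannian_gradient_def
proof (intro conjI allI impI)
  have wc: "continuous_on UNIV w"
    using has_derivative_continuous[OF der] by (intro continuous_at_imp_continuous_on) simp
  have Xc: "continuous_on UNIV (\<lambda>x. X x $ i)" for i by (intro continuous_intros X)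
  show "set_integrable lborel K w" if "compact K" for K
    unfolding set_integrable_def by (rule borel_integrable_compact[OF that continuous_on_subset[OF wc]]) simp
  show "set_integrable lborel K (\<lambda>x. g x (X x) (axis i 1))" if "compact K" for K i
    unfolding set_integrable_def g by (rule borel_integrable_compact[OF that continuous_on_subset[OF Xc]]) simp
  fix \<phi> :: "real^'n \<Rightarrow> real" and i
  assume "C1_test_function \<phi>"
  then have dphi: "\<And>x. (\<phi> has_derivative frechet_derivative \<phi> (at x)) (at x)"
    and cphi: "\<And>v. continuous_on UNIV (\<lambda>x. frechet_derivative \<phi> (at x) v)"
    and bphi: "bounded {x. \<phi> x \<noteq> 0}"
    by (auto simp: C1_test_function_def frechet_derivative_works)
  let ?e = "axis i 1 :: real^'n"
  let ?d = "\<lambda>x. frechet_derivative \<phi> (at x) ?e"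
  have pc: "continuous_on UNIV \<phi>"
    using has_derivative_continuous[OF dphi] by (intro continuous_at_imp_continuous_on) simp
  obtain R where R: "\<And>x. \<phi> x \<noteq> 0 \<Longrightarrow> norm x \<le> R"
    using bphi unfolding bounded_iff by blast
  have supp: "\<phi> x = 0" if "norm x > R" for x using R[of x] that by force
  have dsupp: "?d x = 0" if x: "norm x > R" for x
  proof -
    have "((\<lambda>_. 0) has_derivative frechet_derivative \<phi> (at x)) (at x)"
    proof (rule has_derivative_transform_within_open[OF dphi])
      show "open {y::real^'n. norm y > R}" by (intro open_Collect_less continuous_intros)
    qed (use x supp in auto)
    then have "frechet_derivative \<phi> (at x) = (\<lambda>_. 0)"
      using has_derivative_unique has_derivative_const by blast
    then show ?thesis by simp
  qed
  have int: "integrable lborel f" if "continuous_on UNIV f" "\<And>x. norm x > R \<Longrightarrow> f x = 0" for f :: "real^'n \<Rightarrow> real"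
  proof -
    have "integrable lborel (\<lambda>x. indicator (cball 0 R) x *\<^sub>R f x)"
      by (rule borel_integrable_compact) (auto intro: continuous_on_subset[OF that(1)])
    moreover have "(\<lambda>x. indicator (cball 0 R) x *\<^sub>R f x) = f"
      by (rule ext) (use that(2) in \<open>auto simp: indicator_def\<close>)
    ultimately show ?thesis by (simp only:)
  qed
  have i1: "integrable lborel (\<lambda>x. w x * ?d x)"
    by (rule int) (use dsupp in \<open>auto intro!: continuous_intros wc cphi\<close>)
  have i2: "integrable lborel (\<lambda>x. X x $ i * \<phi> x)"
    by (rule int) (use supp in \<open>auto intro!: continuous_intros Xc pc\<close>)
  have "(\<integral>x. w x * ?d x + X x \<bullet> ?e * \<phi> x \<partial>lborel) = 0"
  proof (rule integral_directional_derivative_eq_0[where h = "\<lambda>x. w x * \<phi> x"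
        and h' = "\<lambda>x v. w x * frechet_derivative \<phi> (at x) v + X x \<bullet> v * \<phi> x" and R = R])
    show "((\<lambda>x. w x * \<phi> x) has_derivative (\<lambda>v. w x * frechet_derivative \<phi> (at x) v + X x \<bullet> v * \<phi> x)) (at x)" for x
      by (rule has_derivative_mult[OF der dphi])
    show "continuous_on UNIV (\<lambda>x. w x * ?d x + X x \<bullet> ?e * \<phi> x)"
      by (intro continuous_intros wc cphi X pc)
  qed (simp add: supp)
  then have "(\<integral>x. w x * ?d x \<partial>lborel) + (\<integral>x. X x $ i * \<phi> x \<partial>lborel) = 0"
    using i1 i2 by (simp add: inner_axis)
  then show "(\<integral>x. w x * ?d x \<partial>lborel) = - (\<integral>x. g x (X x) ?e * \<phi> x \<partial>lborel)"
    unfolding g by simp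
qed

section \<open>Membership in the Sobolev space, and the classification\<close>

text \<open>
  On radial vectors the metric is the Euclidean inner product. So the radial vector field with
  component \<open>u'\<close> is at once the Euclidean and the Riemannian gradient.
\<close>
lemma model_metric_radial:
  "model_metric \<psi> x (c *\<^sub>R sgn x) w = (c *\<^sub>R sgn x) \<bullet> w"
proof (cases "x = 0")
  case True
  then show ?thesis by (simp add: model_metric_def)
next
  case False
  then have unit: "sgn x \<bullet> sgn x = 1" by (simp add: dot_square_norm norm_sgn)
  have dir: "x /\<^sub>R norm x = sgn x" by (simp add: sgn_div_norm)
  have along: "(c *\<^sub>R sgn x) \<bullet> sgn x = c" by (simp add: unit)
  have "model_metric \<psi> x (c *\<^sub>R sgn x) w = c * (w \<bullet> sgn x)"
    unfolding model_metric_def Let_def dir along using False by (simp only: if_False diff_self inner_zero_left mult_zero_right add_0_right)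
  then show ?thesis by (simp only: inner_scaleR_left inner_commute[of w "sgn x"])
qed

context expanding_model
begin

text \<open>
  The tail is dominated by the derivative of \<open>- K / (c N) \<psi>\<^sup>-\<^sup>N\<close>, which vanishes at infinity.
\<close>
lemma finite_weighted_integral:
  assumes g: "continuous_on {0..} g" "\<And>r. 0 \<le> r \<Longrightarrow> 0 \<le> g r"
    and K: "0 \<le> K" "\<forall>\<^sub>F r in at_top. g r * \<psi> r ^ N \<le> K * \<psi> r powr (- real N)"
  shows "(\<integral>\<^sup>+r. ennreal (g r * \<psi> r ^ N) * indicator {0<..} r \<partial>lborel) < \<infinity>"
proof -
  obtain c r0 where c: "0 < c" "0 < r0" "\<And>r. r0 \<le> r \<Longrightarrow> c * \<psi> r \<le> \<psi>' r"
    using exponential_growth by metis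
  from K(2) obtain r1 where r1: "\<And>r. r1 \<le> r \<Longrightarrow> g r * \<psi> r ^ N \<le> K * \<psi> r powr (- real N)"
    by (auto simp: eventually_at_top_linorder)
  define a where "a = max r0 r1"
  have a: "0 < a" "r0 \<le> a" "r1 \<le> a" using c by (auto simp: a_def)
  have N0: "0 < real N" using N2 by simp
  define F where "F r = - (K / (c * real N)) * \<psi> r powr (- real N)" for r
  define f where "f r = indicator {a..} r *\<^sub>R (K / c * (\<psi> r powr (- real N - 1) * \<psi>' r))" for r
  have psi0: "\<psi> r \<noteq> 0" if "a \<le> r" for r using psi_pos[of r] a that by simp
  have gc: "continuous_on {0..a} (\<lambda>r. g r * \<psi> r ^ N)"
    by (intro continuous_intros continuous_on_subset[OF g(1)] continuous_on_subset[OF psi_cont(1)]) auto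
  have "integrable lborel (\<lambda>r. indicator {0..a} r *\<^sub>R (g r * \<psi> r ^ N))"
    by (rule borel_integrable_compact[OF compact_Icc gc])
  then have gm: "(\<lambda>r. indicator {0..a} r *\<^sub>R (g r * \<psi> r ^ N)) \<in> borel_measurable lborel"
    and gfin: "(\<integral>\<^sup>+r. ennreal (norm (indicator {0..a} r *\<^sub>R (g r * \<psi> r ^ N))) \<partial>lborel) < \<infinity>"
    by (auto simp: integrable_iff_bounded)
  have fm: "f \<in> borel_measurable borel"
    unfolding f_def using a psi0
    by (intro borel_measurable_continuous_on_indicator continuous_intros
        continuous_on_subset[OF psi_cont(1)] continuous_on_subset[OF psi_cont(2)]) auto
  have f0: "0 \<le> f r" if "a \<le> r" for r
    unfolding f_def using K c(1) psi'_nonneg[of r] a that by simp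
  have tail: "(\<integral>\<^sup>+r. ennreal (f r) * indicator {a..} r \<partial>lborel) = ennreal (0 - F a)"
  proof (rule nn_integral_FTC_atLeast[OF fm _ f0])
    fix x assume x: "a \<le> x"
    have x0: "0 < x" using x a by simp
    have "(F has_real_derivative - (K / (c * real N)) * (- real N * \<psi> x powr (- real N - 1) * \<psi>' x)) (at x)"
      unfolding F_def[abs_def] by (intro DERIV_cmult psi_powr_deriv x0)
    then show "(F has_real_derivative f x) (at x)" using x N0 by (simp add: f_def)
  next
    have "(F \<longlongrightarrow> - (K / (c * real N)) * 0) at_top"
      unfolding F_def[abs_def] using N0 by (intro tendsto_intros psi_powr_neg_tendsto) simp
    then show "(F \<longlongrightarrow> 0) at_top" by simp
  qed
  have "(\<integral>\<^sup>+r. ennreal (g r * \<psi> r ^ N) * indicator {0<..} r \<partial>lborel) \<le>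
      (\<integral>\<^sup>+r. ennreal (norm (indicator {0..a} r *\<^sub>R (g r * \<psi> r ^ N))) + ennreal (f r) * indicator {a..} r \<partial>lborel)"
  proof (rule nn_integral_mono)
    fix r :: real
    show "ennreal (g r * \<psi> r ^ N) * indicator {0<..} r \<le>
      ennreal (norm (indicator {0..a} r *\<^sub>R (g r * \<psi> r ^ N))) + ennreal (f r) * indicator {a..} r"
    proof (cases "0 < r \<and> a < r")
      case False
      then show ?thesis by (auto simp: indicator_def intro: ennreal_leI add_increasing2)
    next
      case True
      have P: "0 < \<psi> r" using psi_pos True by simp
      have "g r * \<psi> r ^ N \<le> K * \<psi> r powr (- real N)" using r1[of r] True a by simp
      also have "\<dots> = K * (\<psi> r powr (- real N - 1) * \<psi> r)"
        using P powr_add[of "\<psi> r" "- real N - 1" 1] by simp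
      also have "\<dots> \<le> K * (\<psi> r powr (- real N - 1) * (\<psi>' r / c))"
        using K(1) c(1) c(3)[of r] True a by (intro mult_left_mono) (auto simp: pos_le_divide_eq mult.commute)
      also have "\<dots> = f r" using True by (simp add: f_def)
      finally have "ennreal (g r * \<psi> r ^ N) \<le> ennreal (f r)" by (rule ennreal_leI)
      then show ?thesis using True by simp
    qed
  qed
  also have "\<dots> = (\<integral>\<^sup>+r. ennreal (norm (indicator {0..a} r *\<^sub>R (g r * \<psi> r ^ N))) \<partial>lborel)
      + (\<integral>\<^sup>+r. ennreal (f r) * indicator {a..} r \<partial>lborel)"
    using gm fm by (intro nn_integral_add) auto
  also have "\<dots> < \<infinity>" unfolding tail using gfin by simp
  finally show ?thesis .
qed

text \<open>
  In polar coordinates the integral of \<open>V\<^sup>2\<close> over the manifold is a multiple of that of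
  \<open>V\<^sup>2 \<psi>\<^sup>N\<close> over the half-line.
\<close>
lemma H1_imp_square_integrable:
  fixes V :: "real \<Rightarrow> real"
  assumes dim: "CARD('n) = Suc N" and V: "continuous_on {0..} V"
    and H: "(\<lambda>x::real^'n. V (norm x)) \<in> H1 (model_metric \<psi>)"
  shows "\<exists>K. \<forall>R\<ge>0. integral {0..R} (\<lambda>r. (V r)\<^sup>2 * \<psi> r ^ N) \<le> K"
proof -
  define C where "C = real (Suc N) * unit_ball_vol (real (Suc N))"
  have C0: "0 < C" by (simp add: C_def del: of_nat_Suc)
  define I where "I = (\<integral>\<^sup>+r. ennreal ((V r)\<^sup>2 * \<psi> r ^ N) * indicator {0<..} r \<partial>lborel)"
  have "integrable (riemannian_volume (model_metric \<psi> :: real^'n \<Rightarrow> _)) (\<lambda>x. (V (norm x))\<^sup>2)"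
    using H by (simp add: H1_def)
  then have "(\<integral>\<^sup>+x. ennreal ((V (norm x))\<^sup>2) \<partial>riemannian_volume (model_metric \<psi> :: real^'n \<Rightarrow> _)) < \<infinity>"
    by (simp add: integrable_iff_bounded)
  moreover have "(\<integral>\<^sup>+x. ennreal ((V (norm x))\<^sup>2) \<partial>riemannian_volume (model_metric \<psi> :: real^'n \<Rightarrow> _)) = ennreal C * I"
    unfolding C_def I_def
  proof (rule nn_integral_model_volume(1))
    show "continuous_on {0..} (\<lambda>r. (V r)\<^sup>2)" by (intro continuous_intros V)
  qed (use psi_cont psi_pos dim in auto)
  ultimately have "ennreal C * I < \<infinity>" by (simp only:)
  then have fin: "I < \<infinity>" using C0 by (auto simp: ennreal_mult_less_top)
  have "integral {0..R} (\<lambda>r. (V r)\<^sup>2 * \<psi> r ^ N) \<le> enn2real I" if R: "0 \<le> R" for R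
  proof -
    let ?f = "\<lambda>r. (V r)\<^sup>2 * \<psi> r ^ N"
    have fc: "continuous_on {0..R} ?f"
      by (intro continuous_intros continuous_on_subset[OF V] continuous_on_subset[OF psi_cont(1)]) auto
    have si: "set_integrable lborel {0..R} ?f"
      unfolding set_integrable_def by (rule borel_integrable_compact[OF compact_Icc fc])
    have "ennreal (integral {0..R} ?f) = ennreal (\<integral>r. indicator {0..R} r *\<^sub>R ?f r \<partial>lborel)"
      using set_borel_integral_eq_integral(2)[OF si] by (simp add: set_lebesgue_integral_def)
    also have "\<dots> = (\<integral>\<^sup>+r. ennreal (indicator {0..R} r *\<^sub>R ?f r) \<partial>lborel)"
    proof (rule nn_integral_eq_integral[symmetric])
      show "integrable lborel (\<lambda>r. indicator {0..R} r *\<^sub>R ?f r)" using si by (simp add: set_integrable_def)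
      show "AE r in lborel. 0 \<le> indicator {0..R} r *\<^sub>R ?f r"
        using psi_nonneg by (auto simp: indicator_def)
    qed
    also have "\<dots> \<le> I"
      unfolding I_def
    proof (rule nn_integral_mono_AE)
      have "AE r in (lborel :: real measure). r \<noteq> 0" by (rule AE_lborel_singleton)
      then show "AE r in lborel. ennreal (indicator {0..R} r *\<^sub>R ?f r) \<le> ennreal (?f r) * indicator {0<..} r"
        by eventually_elim (auto simp: indicator_def)
    qed
    finally have "ennreal (integral {0..R} ?f) \<le> I" .
    moreover have "0 \<le> integral {0..R} ?f"
      using psi_nonneg by (intro integral_nonneg integrable_continuous_interval fc) auto
    ultimately show ?thesis
      using enn2real_mono[of "ennreal (integral {0..R} ?f)" I] fin by simp
  qed
  then show ?thesis by blast
qed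

text \<open>
  A radial function with \<open>u'(0) = 0\<close> is of class \<open>C\<^sup>1\<close> on the whole space. Under fast decay both
  \<open>u\<^sup>2 \<psi>\<^sup>N\<close> and \<open>u'\<^sup>2 \<psi>\<^sup>N = z\<^sup>2 \<psi>\<^sup>-\<^sup>N\<close> are of the order \<open>\<psi>\<^sup>-\<^sup>N\<close>.
\<close>
lemma fast_imp_H1:
  assumes dim: "CARD('n) = Suc N"
    and al: "0 < \<alpha>" and pos: "\<And>r. 0 \<le> r \<Longrightarrow> 0 < usol \<alpha> r" and fast: "fast \<alpha>"
  shows "(\<lambda>x::real^'n. usol \<alpha> (norm x)) \<in> H1 (model_metric \<psi>)"
proof -
  define D where "D r = - (zsol \<alpha> r / \<psi> r ^ N)" for r
  define w where "w x = usol \<alpha> (norm x)" for x :: "real^'n"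
  define X where "X x = D (norm x) *\<^sub>R sgn x" for x :: "real^'n"
  have Dc: "continuous_on {0..} D"
    unfolding D_def by (rule continuous_on_minus[OF zsol_quotient_cont[OF al]])
  have D0: "D 0 = 0" using solD(2)[OF sol_usol[OF al]] by (simp add: D_def)
  have Dn: "continuous_on UNIV (\<lambda>x::real^'n. D (norm x))"
    by (rule continuous_on_compose2[OF Dc continuous_on_norm_id]) auto
  have Xc: "continuous_on UNIV X"
  proof (rule continuous_at_imp_continuous_on, rule ballI)
    fix x :: "real^'n"
    show "isCont X x"
    proof (cases "x = 0")
      case True
      have "(X \<longlongrightarrow> 0) (at 0)"
      proof (rule Lim_null_comparison)
        show "\<forall>\<^sub>F x in at 0. norm (X x) \<le> \<bar>D (norm x)\<bar>"
          by (intro always_eventually) (auto simp: X_def norm_sgn)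
        have "isCont (\<lambda>x::real^'n. D (norm x)) 0" using Dn by (simp add: continuous_on_eq_continuous_at)
        then have "((\<lambda>x::real^'n. D (norm x)) \<longlongrightarrow> 0) (at 0)" by (simp add: isCont_def D0)
        then show "((\<lambda>x::real^'n. \<bar>D (norm x)\<bar>) \<longlongrightarrow> 0) (at 0)" by (rule tendsto_rabs_zero)
      qed
      then show ?thesis using True by (simp add: isCont_def X_def)
    next
      case False
      have "isCont (\<lambda>x::real^'n. D (norm x)) x" using Dn by (simp add: continuous_on_eq_continuous_at)
      then show ?thesis unfolding X_def sgn_div_norm using False by (intro continuous_intros) auto
    qed
  qed
  have der: "(w has_derivative (\<lambda>v. X x \<bullet> v)) (at x)" for x
  proof (cases "x = 0")
    case True
    have "((\<lambda>h. norm (w (0 + h) - w 0 - 0) / norm h) \<longlongrightarrow> 0) (at 0)"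
    proof (rule Lim_null_comparison)
      show "\<forall>\<^sub>F h in at (0::real^'n). norm (norm (w (0 + h) - w 0 - 0) / norm h) \<le> \<alpha> powr p / 2 * norm h"
        unfolding eventually_at
      proof (intro exI[of _ 1] conjI ballI impI)
        fix h :: "real^'n" assume "h \<noteq> 0 \<and> dist h 0 < 1"
        then have h: "0 < norm h" by simp
        have "\<bar>w (0 + h) - w 0 - 0\<bar> \<le> \<alpha> powr p / 2 * norm h * norm h"
          using u_lower[OF sol_usol[OF al] al, of "norm h" "norm h"] usol_antimono[OF al, of 0 "norm h"] usol_0[OF al]
          by (simp add: w_def power2_eq_square)
        then show "norm (norm (w (0 + h) - w 0 - 0) / norm h) \<le> \<alpha> powr p / 2 * norm h"
          using h by (simp add: pos_divide_le_eq)
      qed simp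
      show "((\<lambda>h::real^'n. \<alpha> powr p / 2 * norm h) \<longlongrightarrow> 0) (at 0)"
        by (auto intro!: tendsto_eq_intros)
    qed
    then show ?thesis using True by (simp add: has_derivative_at X_def)
  next
    case False
    have "(usol \<alpha> has_derivative (\<lambda>h. D (norm x) * h)) (at (norm x))"
      unfolding D_def has_field_derivative_def[symmetric]
      by (rule usol_has_derivative(1)[OF al]) (use False in simp)
    moreover have "(norm has_derivative (\<lambda>h. h \<bullet> sgn x)) (at x)"
      using GDERIV_norm[OF False] by (simp add: gderiv_def)
    ultimately have "((\<lambda>x. usol \<alpha> (norm x)) has_derivative (\<lambda>h. D (norm x) * (h \<bullet> sgn x))) (at x)"
      by (rule has_derivative_compose[rotated])
    then show ?thesis by (simp add: w_def[abs_def] X_def inner_commute)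
  qed
  have weak: "weak_riemannian_gradient (model_metric \<psi>) w X"
    by (rule weak_gradient_of_C1[OF der Xc]) (simp only: X_def model_metric_radial inner_axis, simp)
  have XX: "model_metric \<psi> x (X x) (X x) = (D (norm x))\<^sup>2" for x
  proof (cases "x = 0")
    case True
    then show ?thesis by (simp add: X_def D0 model_metric_def)
  next
    case False
    then have "sgn x \<bullet> sgn x = 1" by (simp add: dot_square_norm norm_sgn)
    then show ?thesis unfolding X_def model_metric_radial by (simp add: power2_eq_square)
  qed
  have int: "integrable (riemannian_volume (model_metric \<psi> :: real^'n \<Rightarrow> _)) F"
    if F: "\<And>x. F x = f (norm x)" and f: "continuous_on {0..} f" "\<And>r. 0 \<le> r \<Longrightarrow> 0 \<le> f r"
      and K: "0 \<le> K" "\<forall>\<^sub>F r in at_top. f r * \<psi> r ^ N \<le> K * \<psi> r powr (- real N)"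
    for F :: "real^'n \<Rightarrow> real" and f K
  proof -
    note vol = nn_integral_model_volume[where F = F and f = f, OF F f psi_cont(1) psi_pos dim]
    have "ennreal (real (Suc N) * unit_ball_vol (real (Suc N))) *
        (\<integral>\<^sup>+r. ennreal (f r * \<psi> r ^ N) * indicator {0<..} r \<partial>lborel) < \<infinity>"
      using finite_weighted_integral[OF f K] by (simp add: ennreal_mult_less_top del: of_nat_Suc)
    then have "(\<integral>\<^sup>+x. ennreal (F x) \<partial>riemannian_volume (model_metric \<psi> :: real^'n \<Rightarrow> _)) < \<infinity>"
      by (simp only: vol(1))
    moreover have "norm (F x) = F x" for x using f(2)[of "norm x"] by (simp add: F)
    moreover have "F \<in> borel_measurable (riemannian_volume (model_metric \<psi> :: real^'n \<Rightarrow> _))"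
      using vol(3) by (simp add: riemannian_volume_def)
    ultimately show ?thesis by (simp add: integrable_iff_bounded)
  qed
  obtain C where C: "\<forall>\<^sub>F r in at_top. usol \<alpha> r \<le> C * \<psi> r powr (- real N) \<and> zsol \<alpha> r \<le> C"
    using fast unfolding fast_def by blast
  have weight: "(\<psi> r powr (- real N))\<^sup>2 * \<psi> r ^ N = \<psi> r powr (- real N)" if "0 < r" for r
    using psi_power_powr[OF that] psi_pos[OF that] by (simp add: power2_eq_square powr_add[symmetric])
  have iu: "integrable (riemannian_volume (model_metric \<psi>)) (\<lambda>x. (w x)\<^sup>2)"
  proof (rule int[where f = "\<lambda>r. (usol \<alpha> r)\<^sup>2" and K = "C\<^sup>2"])
    show "\<forall>\<^sub>F r in at_top. (usol \<alpha> r)\<^sup>2 * \<psi> r ^ N \<le> C\<^sup>2 * \<psi> r powr (- real N)"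
      using C eventually_gt_at_top[of 0]
    proof eventually_elim
      case (elim r)
      have "(usol \<alpha> r)\<^sup>2 \<le> (C * \<psi> r powr (- real N))\<^sup>2"
        using elim pos[of r] by (intro power_mono) auto
      then have "(usol \<alpha> r)\<^sup>2 * \<psi> r ^ N \<le> C\<^sup>2 * ((\<psi> r powr (- real N))\<^sup>2 * \<psi> r ^ N)"
        using psi_nonneg[of r] elim by (simp add: power_mult_distrib mult_right_mono flip: mult.assoc)
      then show ?case using weight elim by simp
    qed
  qed (auto intro!: continuous_intros usol_cont[OF al] simp: w_def)
  have ix: "integrable (riemannian_volume (model_metric \<psi>)) (\<lambda>x. model_metric \<psi> x (X x) (X x))"
  proof (rule int[where f = "\<lambda>r. (D r)\<^sup>2" and K = "C\<^sup>2"])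
    show "\<forall>\<^sub>F r in at_top. (D r)\<^sup>2 * \<psi> r ^ N \<le> C\<^sup>2 * \<psi> r powr (- real N)"
      using C eventually_gt_at_top[of 0]
    proof eventually_elim
      case (elim r)
      have "D r = - (zsol \<alpha> r * \<psi> r powr (- real N))"
        using psi_power_powr[of r] elim by (simp add: D_def powr_minus divide_inverse)
      then have "(D r)\<^sup>2 = (zsol \<alpha> r)\<^sup>2 * (\<psi> r powr (- real N))\<^sup>2"
        by (simp add: power_mult_distrib)
      then have "(D r)\<^sup>2 * \<psi> r ^ N = (zsol \<alpha> r)\<^sup>2 * \<psi> r powr (- real N)"
        using weight[of r] elim by (simp add: mult.assoc)
      also have "\<dots> \<le> C\<^sup>2 * \<psi> r powr (- real N)"
        using elim sol_monotone(3)[OF sol_usol[OF al], of r r r] by (intro mult_right_mono power_mono) auto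
      finally show ?case .
    qed
  qed (auto intro!: continuous_intros Dc simp: XX)
  have "w \<in> borel_measurable borel"
    by (rule borel_measurable_continuous_onI)
       (use has_derivative_continuous[OF der] in \<open>intro continuous_at_imp_continuous_on, simp\<close>)
  moreover have "X \<in> borel_measurable borel" by (rule borel_measurable_continuous_onI[OF Xc])
  ultimately have "w \<in> H1 (model_metric \<psi>)"
    unfolding H1_def using weak iu ix by blast
  then show ?thesis by (simp add: w_def[abs_def])
qed

end

theorem theorem2p4:
  fixes n :: nat and p \<delta> :: real and \<psi> \<psi>' \<psi>'' G :: "real \<Rightarrow> real" and l :: ereal
  assumes dim: "n = CARD('n::finite)" "n \<ge> 3"
    and p: "1 < p" "p < (real n + 2) / (real n - 2)"
    and psi_C2:
      "\<And>r. r \<ge> 0 \<Longrightarrow> (\<psi> has_real_derivative \<psi>' r) (at r within {0..})"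
      "\<And>r. r \<ge> 0 \<Longrightarrow> (\<psi>' has_real_derivative \<psi>'' r) (at r within {0..})"
      "continuous_on {0..} \<psi>''"
    and psi_pos: "\<And>r. r > 0 \<Longrightarrow> \<psi> r > 0"
    and psi_0: "\<psi> 0 = 0" "\<psi>'' 0 = 0" "\<psi>' 0 = 1"
    and psi_mono: "\<And>r. r > 0 \<Longrightarrow> \<psi>' r \<ge> 0"
    and l_pos: "0 < l"
    and lim_l:
      "((\<lambda>r. ereal (\<psi>' r / \<psi> r)) \<longlongrightarrow> l) at_top"
      "((\<lambda>r. ereal (\<psi>'' r / \<psi>' r)) \<longlongrightarrow> l) at_top"
    and delta: "\<delta> = 2 * (real n - 1) / (p + 3)"
    and G: "G = (\<lambda>r. \<delta> * \<psi> r powr (\<delta> * (p - 1) - 2) *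
                   ((\<delta> + 2 - real n) * (\<psi>' r)\<^sup>2 - \<psi>'' r * \<psi> r))"
    and Lambda: "Lambda_property G"
    and l_infinite:
      "l = \<infinity> \<Longrightarrow> (\<lambda>r. \<psi>' r / \<psi> r) \<in> o[at_top](\<lambda>r. \<psi> r powr \<delta>)"
      "l = \<infinity> \<Longrightarrow> (\<lambda>r. \<psi>'' r / \<psi>' r) \<in> o[at_top](\<lambda>r. \<psi> r powr \<delta>)"
  shows "\<exists>U.
    (\<exists>\<alpha>. \<alpha> \<noteq> 0 \<and> cauchy_solution \<psi> n p \<alpha> U) \<and> positive_sol U \<and>
    (\<lambda>x::real^'n. U (norm x)) \<in> H1 (model_metric \<psi>) \<and>
    (\<forall>V. (\<exists>\<alpha>. \<alpha> \<noteq> 0 \<and> cauchy_solution \<psi> n p \<alpha> V) \<and> positive_sol V \<and>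
         (\<lambda>x::real^'n. V (norm x)) \<in> H1 (model_metric \<psi>) \<longrightarrow>
         (\<forall>r\<ge>0. V r = U r)) \<and>
    (\<forall>\<alpha> u. 0 < \<alpha> \<and> \<alpha> < U 0 \<and> cauchy_solution \<psi> n p \<alpha> u \<longrightarrow> one_sign u) \<and>
    (\<forall>\<alpha> u. U 0 < \<alpha> \<and> cauchy_solution \<psi> n p \<alpha> u \<longrightarrow> sign_changing u)"
proof -
  define N where "N = n - 1"
  have nN: "n = Suc N" using dim(2) by (simp add: N_def)
  have dimN: "CARD('n) = Suc N" using dim(1) nN by simp
  have rn: "real n = real N + 1" by (simp add: nN)
  have N2: "2 \<le> N" using dim(2) nN by simp
  have sub: "p < (real N + 3) / (real N - 1)"
    using p(2) unfolding rn by (simp add: algebra_simps)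
  have del: "\<delta> = 2 * real N / (p + 3)" using delta unfolding rn by simp
  have G': "G = (\<lambda>r. \<delta> * \<psi> r powr (\<delta> * (p - 1) - 2) *
                   ((\<delta> + 1 - real N) * (\<psi>' r)\<^sup>2 - \<psi>'' r * \<psi> r))"
  proof -
    have "\<delta> + 2 - real n = \<delta> + 1 - real N" by (simp add: rn)
    then show ?thesis using G by (simp only:)
  qed
  interpret expanding_model N p \<psi> \<psi>' \<psi>'' \<delta> G l
    by unfold_locales (fact N2 p(1) psi_C2 psi_pos psi_0 psi_mono sub del G' Lambda l_pos lim_l l_infinite)+
  obtain \<alpha>\<^sub>0 where a0: "0 < \<alpha>\<^sub>0" and pos: "\<And>r. 0 \<le> r \<Longrightarrow> 0 < usol \<alpha>\<^sub>0 r" and fast: "fast \<alpha>\<^sub>0"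
    and below: "\<And>\<beta> r. 0 < \<beta> \<Longrightarrow> \<beta> < \<alpha>\<^sub>0 \<Longrightarrow> 0 \<le> r \<Longrightarrow> 0 < usol \<beta> r"
    and above: "\<And>\<beta>. \<alpha>\<^sub>0 < \<beta> \<Longrightarrow> \<exists>r\<ge>0. usol \<beta> r \<le> 0"
    and uniq: "\<And>\<beta>. 0 < \<beta> \<Longrightarrow> (\<And>r. 0 \<le> r \<Longrightarrow> 0 < usol \<beta> r) \<Longrightarrow> fast \<beta> \<Longrightarrow> \<beta> = \<alpha>\<^sub>0"
    using classification by blast
  have U0: "usol \<alpha>\<^sub>0 0 = \<alpha>\<^sub>0" by (rule usol_0[OF a0])
  show ?thesis
  proof (intro exI[of _ "usol \<alpha>\<^sub>0"] conjI allI impI)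
    show "\<exists>\<alpha>. \<alpha> \<noteq> 0 \<and> cauchy_solution \<psi> n p \<alpha> (usol \<alpha>\<^sub>0)"
      using cauchy_solution_usol[OF a0] pos a0 unfolding nN by (intro exI[of _ \<alpha>\<^sub>0]) simp
    show "positive_sol (usol \<alpha>\<^sub>0)" using pos by (simp add: positive_sol_def)
    show "(\<lambda>x::real^'n. usol \<alpha>\<^sub>0 (norm x)) \<in> H1 (model_metric \<psi>)"
      by (rule fast_imp_H1[OF dimN a0 _ fast]) (rule pos)
  next
    fix V r
    assume "(\<exists>\<alpha>. \<alpha> \<noteq> 0 \<and> cauchy_solution \<psi> n p \<alpha> V) \<and> positive_sol V \<and>
         (\<lambda>x::real^'n. V (norm x)) \<in> H1 (model_metric \<psi>)" and r: "0 \<le> (r::real)"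
    then obtain \<beta> where V: "cauchy_solution \<psi> (Suc N) p \<beta> V" and Vpos: "\<And>r. 0 \<le> r \<Longrightarrow> 0 < V r"
      and VH: "(\<lambda>x::real^'n. V (norm x)) \<in> H1 (model_metric \<psi>)"
      unfolding nN positive_sol_def by blast
    have b: "0 < \<beta>" using Vpos[of 0] cauchy_cont(2)[OF V] by simp
    have Veq: "V s = usol \<beta> s" if "0 \<le> s" for s
      by (rule cauchy_eq_usol[OF V b _ that order_refl]) (use Vpos in \<open>auto intro: less_imp_le\<close>)
    obtain K where K: "\<And>R. 0 \<le> R \<Longrightarrow> integral {0..R} (\<lambda>r. (V r)\<^sup>2 * \<psi> r ^ N) \<le> K"
      using H1_imp_square_integrable[OF dimN cauchy_cont(1)[OF V] VH] by blast
    have "integral {0..R} (\<lambda>r. (usol \<beta> r)\<^sup>2 * \<psi> r ^ N) \<le> K" if "0 \<le> R" for R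
    proof -
      have "integral {0..R} (\<lambda>r. (usol \<beta> r)\<^sup>2 * \<psi> r ^ N) = integral {0..R} (\<lambda>r. (V r)\<^sup>2 * \<psi> r ^ N)"
        by (rule Henstock_Kurzweil_Integration.integral_cong) (simp add: Veq)
      then show ?thesis using K[OF that] by simp
    qed
    moreover have upos: "0 < usol \<beta> s" if "0 \<le> s" for s using Veq[OF that] Vpos[OF that] by simp
    ultimately have "fast \<beta>" by (intro square_integrable_imp_fast[OF b])
    then have "\<beta> = \<alpha>\<^sub>0" by (intro uniq[OF b upos])
    then show "V r = usol \<alpha>\<^sub>0 r" using Veq[OF r] by simp
  next
    fix \<alpha> u assume "0 < \<alpha> \<and> \<alpha> < usol \<alpha>\<^sub>0 0 \<and> cauchy_solution \<psi> n p \<alpha> u"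
    then have a: "0 < \<alpha>" "\<alpha> < \<alpha>\<^sub>0" and u: "cauchy_solution \<psi> (Suc N) p \<alpha> u" by (simp_all add: U0 nN)
    have "0 < u r" if "0 \<le> r" for r
      using cauchy_usol_positive[OF u a(1) _ that] below[OF a] that by simp
    then show "one_sign u" by (simp add: one_sign_def)
  next
    fix \<alpha> u assume "usol \<alpha>\<^sub>0 0 < \<alpha> \<and> cauchy_solution \<psi> n p \<alpha> u"
    then have a: "\<alpha>\<^sub>0 < \<alpha>" and u: "cauchy_solution \<psi> (Suc N) p \<alpha> u" by (simp_all add: U0 nN)
    obtain R where "0 \<le> R" "usol \<alpha> R \<le> 0" using above[OF a] by blast
    then show "sign_changing u" using cauchy_usol_sign_changing[OF u] a a0 by simp
  qed
qed

end
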